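(* Assume $\theta_1<\theta_2$, $\mu_1\le0$ and $\mu_2\in\mathbb R$. Define $$w(x,1)=x-\theta_1,\quad x\in[\theta_1,\infty),\qquad w(x,2)=\begin{cases}0,&x\in[\theta_1,\theta_2],\\ x-\theta_2,&x\in(\theta_2,\infty).\end{cases}$$ Then $w(x,i)$, $i=1,2$, is the value function $V(x,i)$ of the dividend problem if and only if $\mu_2\le(\theta_1-\theta_2)\lambda_2$. Moreover, in this case it is optimal to pay immediately all the surplus as dividends in both regimes, i.e. the strategy $D_0=0$, $D_t=(x-\theta_i)^+$ for $t>0$ (under $\mathbb P_{x,i}$) is optimal.
   Context: Model. On a complete probability space $(\Omega,\mathcal F,\mathbb P)$ let $W$ be a standard Brownian motion and $\epsilon$ an independent right-continuous continuous-time Markov chain with values in $\mathcal S=\{1,2\}$ and transition intensity matrix $(q_{ij})$, $\lambda_i:=-q_{ii}>0$, $\sum_j q_{ij}=0$ (so $q_{12}=\lambda_1$, $q_{21}=\lambda_2$). $\mathbb F$ is the augmented filtration generated by $(W,\epsilon)$. Constants: $\mu_i\in\mathbb R$, $\sigma_i>0$, $\rho>0$, $\theta_i\in\mathbb R$. Under $\mathbb P_{x,i}$ (expectation $\mathbb E_{x,i}$), $X_0=x$, $\epsilon_0=i$. For an adapted process $D$, the surplus is $X^D_t=x+\int_0^t\mu_{\epsilon_s}ds+\int_0^t\sigma_{\epsilon_s}dW_s-D_t$, and the bankruptcy time is $\tau:=\inf\{t\ge0:X^D_t\le\theta_{\epsilon_t}\}$ ($\inf\emptyset=+\infty$). Admissible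 strategies $\mathcal A(x,i)$: $\mathbb F$-adapted nondecreasing processes $D$ with values in $\mathbb R_+$, $D_0=0$, left-continuous with right limits, such that $\mathbb P_{x,i}$-a.s. $D_{t+}-D_t\le (X^D_t-\theta_{\epsilon_t})^+$ for all $t\ge0$ and $dD_t=0$ for $t>\tau$. Payoff and value: $J(x,i;D):=\mathbb E_{x,i}\big[\int_0^\tau e^{-\rho t}dD_t\big]$, where the measure $dD$ includes the jumps $D_{t+}-D_t$ at all times $t\in[0,\tau]$ (including $t=0$ and $t=\tau$); $V(x,i):=\sup_{D\in\mathcal A(x,i)}J(x,i;D)$. A strategy attaining the supremum is called optimal. *)

theory Defs
  imports "HOL-Probability.Probability"
begin

text \<open>
  Processes are functions of a time in \<open>real\<close> and of an outcome; only times \<open>t \<ge> 0\<close> are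
  meaningful, and no definition below depends on values at negative times.
\<close>

definition generated_events ::
    "'a measure \<Rightarrow> 'b measure \<Rightarrow> (real \<Rightarrow> 'a \<Rightarrow> 'b) \<Rightarrow> real set \<Rightarrow> 'a set set" where
  "generated_events P N Y T =
     sigma_sets (space P) {Y s -` B \<inter> space P | s B. s \<in> T \<and> B \<in> sets N}"


section \<open>Brownian motion and Markov chain\<close>

definition standard_brownian_motion :: "'a measure \<Rightarrow> (real \<Rightarrow> 'a \<Rightarrow> real) \<Rightarrow> bool" where
  "standard_brownian_motion P W \<longleftrightarrow>
     (\<forall>t\<ge>0. W t \<in> borel_measurable P) \<and>
     (AE \<omega> in P. W 0 \<omega> = 0) \<and>
     (AE \<omega> in P. continuous_on {0..} (\<lambda>t. W t \<omega>)) \<and>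
     (\<forall>s t. 0 \<le> s \<and> s < t \<longrightarrow>
        distributed P lborel (\<lambda>\<omega>. W t \<omega> - W s \<omega>) (normal_density 0 (sqrt (t - s))) \<and>
        prob_space.indep_set P
          (generated_events P borel W {0..s})
          (sets (vimage_algebra (space P) (\<lambda>\<omega>. W t \<omega> - W s \<omega>) borel)))"

primrec matrix_pow :: "nat set \<Rightarrow> (nat \<Rightarrow> nat \<Rightarrow> real) \<Rightarrow> nat \<Rightarrow> nat \<Rightarrow> nat \<Rightarrow> real" where
  "matrix_pow S q 0 i j = (if i = j then 1 else 0)"
| "matrix_pow S q (Suc n) i j = (\<Sum>k\<in>S. q i k * matrix_pow S q n k j)"

text \<open>The entries of \<open>exp (t q)\<close>, for a matrix \<open>q\<close> indexed by the finite set \<open>S\<close>.\<close>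

definition transition_prob :: "nat set \<Rightarrow> (nat \<Rightarrow> nat \<Rightarrow> real) \<Rightarrow> real \<Rightarrow> nat \<Rightarrow> nat \<Rightarrow> real" where
  "transition_prob S q t i j = (\<Sum>n. t ^ n / fact n * matrix_pow S q n i j)"

text \<open>
  Right-continuity refers to the discrete topology on \<open>nat\<close>. The last conjunct is the Markov
  property \<open>P(\<epsilon> t = j | \<epsilon> u, u \<le> s) = exp ((t - s) q) (\<epsilon> s) j\<close>, integrated over the events of
  the past up to time \<open>s\<close>.
\<close>

definition markov_chain ::
    "'a measure \<Rightarrow> nat set \<Rightarrow> (nat \<Rightarrow> nat \<Rightarrow> real) \<Rightarrow> (real \<Rightarrow> 'a \<Rightarrow> nat) \<Rightarrow> bool" where
  "markov_chain P S q \<epsilon> \<longleftrightarrow>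
     (\<forall>t\<ge>0. \<epsilon> t \<in> measurable P (count_space S)) \<and>
     (AE \<omega> in P. \<forall>t\<ge>0. continuous (at_right t) (\<lambda>s. \<epsilon> s \<omega>)) \<and>
     (\<forall>s t. 0 \<le> s \<and> s \<le> t \<longrightarrow>
        (\<forall>A \<in> generated_events P (count_space S) \<epsilon> {0..s}. \<forall>i\<in>S. \<forall>j\<in>S.
           measure P {\<omega>\<in>A. \<epsilon> s \<omega> = i \<and> \<epsilon> t \<omega> = j} =
             transition_prob S q (t - s) i j * measure P {\<omega>\<in>A. \<epsilon> s \<omega> = i}))"

definition augmented_filtration ::
    "'a measure \<Rightarrow> (real \<Rightarrow> 'a \<Rightarrow> real) \<Rightarrow> nat set \<Rightarrow> (real \<Rightarrow> 'a \<Rightarrow> nat) \<Rightarrow> real \<Rightarrow> 'a measure" where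
  "augmented_filtration P W S \<epsilon> t =
     sigma (space P)
       (generated_events P borel W {0..t} \<union> generated_events P (count_space S) \<epsilon> {0..t} \<union>
        null_sets P)"


section \<open>The Ito integral\<close>

text \<open>
  An elementary integrand is \<open>\<Sum>k<n. \<xi>\<^sub>k 1\<^bsub>(p\<^sub>k, p\<^sub>k\<^sub>+\<^sub>1]\<^esub>\<close> with \<open>\<xi>\<^sub>k\<close> bounded and measurable at
  time \<open>p\<^sub>k\<close>. A process \<open>Z\<close> is (a version of) the integral of \<open>H\<close> against \<open>W\<close> if it is adapted,
  almost surely continuous and, for each \<open>T\<close>, \<open>Z T\<close> is the \<open>L\<^sup>2(P)\<close>-limit of the integrals over
  \<open>[0, T]\<close> of elementary integrands that converge to \<open>H\<close> in \<open>L\<^sup>2(dt \<otimes> P)\<close>. This determines \<open>Z\<close>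
  up to indistinguishability.
\<close>

definition elementary_integrand ::
    "'a measure \<Rightarrow> (real \<Rightarrow> 'a measure) \<Rightarrow> nat \<Rightarrow> (nat \<Rightarrow> real) \<Rightarrow> (nat \<Rightarrow> 'a \<Rightarrow> real) \<Rightarrow> bool" where
  "elementary_integrand P F n p \<xi> \<longleftrightarrow>
     0 \<le> p 0 \<and>
     (\<forall>k<n. p k \<le> p (Suc k) \<and> \<xi> k \<in> borel_measurable (F (p k)) \<and>
        (\<exists>C. \<forall>\<omega>\<in>space P. \<bar>\<xi> k \<omega>\<bar> \<le> C))"

definition elementary_process ::
    "nat \<Rightarrow> (nat \<Rightarrow> real) \<Rightarrow> (nat \<Rightarrow> 'a \<Rightarrow> real) \<Rightarrow> real \<Rightarrow> 'a \<Rightarrow> real" where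
  "elementary_process n p \<xi> s \<omega> = (\<Sum>k<n. \<xi> k \<omega> * indicator {p k<..p (Suc k)} s)"

definition elementary_integral ::
    "(real \<Rightarrow> 'a \<Rightarrow> real) \<Rightarrow> nat \<Rightarrow> (nat \<Rightarrow> real) \<Rightarrow> (nat \<Rightarrow> 'a \<Rightarrow> real) \<Rightarrow> real \<Rightarrow> 'a \<Rightarrow> real" where
  "elementary_integral W n p \<xi> T \<omega> =
     (\<Sum>k<n. \<xi> k \<omega> * (W (min (p (Suc k)) T) \<omega> - W (min (p k) T) \<omega>))"

definition is_ito_integral ::
    "'a measure \<Rightarrow> (real \<Rightarrow> 'a measure) \<Rightarrow> (real \<Rightarrow> 'a \<Rightarrow> real) \<Rightarrow> (real \<Rightarrow> 'a \<Rightarrow> real) \<Rightarrow>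
     (real \<Rightarrow> 'a \<Rightarrow> real) \<Rightarrow> bool" where
  "is_ito_integral P F W H Z \<longleftrightarrow>
     (\<forall>t\<ge>0. Z t \<in> borel_measurable (F t)) \<and>
     (AE \<omega> in P. continuous_on {0..} (\<lambda>t. Z t \<omega>)) \<and>
     (\<forall>T\<ge>0. \<exists>n p \<xi>.
        (\<forall>m. elementary_integrand P F (n m) (p m) (\<xi> m)) \<and>
        (\<lambda>m. \<integral>\<^sup>+\<omega>. (\<integral>\<^sup>+s\<in>{0..T}.
            ennreal ((H s \<omega> - elementary_process (n m) (p m) (\<xi> m) s \<omega>)\<^sup>2) \<partial>lborel) \<partial>P)
          \<longlonglongrightarrow> 0 \<and>
        (\<lambda>m. \<integral>\<^sup>+\<omega>. ennreal ((Z T \<omega> - elementary_integral W (n m) (p m) (\<xi> m) T \<omega>)\<^sup>2) \<partial>P)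
          \<longlonglongrightarrow> 0)"


section \<open>The dividend problem\<close>

definition right_limit :: "(real \<Rightarrow> real) \<Rightarrow> real \<Rightarrow> real" where
  "right_limit f t = Lim (at_right t) f"

text \<open>
  The measure \<open>df\<close> on \<open>[0, \<infinity>)\<close> of a nondecreasing left-continuous \<open>f\<close>: the mass of \<open>(a, b]\<close> is
  \<open>f(b+) - f(a+)\<close> and that of \<open>{t}\<close> is \<open>f(t+) - f(t)\<close>, also for \<open>t = 0\<close>. Times \<open>t < 0\<close> carry no
  mass.
\<close>

definition stieltjes :: "(real \<Rightarrow> real) \<Rightarrow> real measure" where
  "stieltjes f = interval_measure (\<lambda>t. if t < 0 then f 0 else right_limit f t)"

definition exit_rate :: "(nat \<Rightarrow> nat \<Rightarrow> real) \<Rightarrow> nat \<Rightarrow> real" where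
  "exit_rate q i = - q i i"

text \<open>
  \<open>P i\<close> is the law \<open>P\<^bsub>x,i\<^esub>\<close>; it does not depend on \<open>x\<close>, which enters only through the surplus.
  The two laws carry their own \<open>\<sigma>\<close>-algebras: each is complete, and no single \<open>\<sigma>\<close>-algebra can be
  complete for both, because \<open>{\<epsilon> 0 = 2}\<close> is \<open>P 1\<close>-null and \<open>{\<epsilon> 0 = 1}\<close> is \<open>P 2\<close>-null, so
  that every subset of the space would have to be measurable.
  \<open>Z\<close> is a version of the process \<open>\<integral>\<^sub>0\<^sup>t \<sigma>(\<epsilon> s) dW s\<close>.
\<close>

locale dividend_model =
  fixes P :: "nat \<Rightarrow> 'a measure"
    and W :: "real \<Rightarrow> 'a \<Rightarrow> real"
    and \<epsilon> :: "real \<Rightarrow> 'a \<Rightarrow> nat"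
    and Z :: "real \<Rightarrow> 'a \<Rightarrow> real"
    and q :: "nat \<Rightarrow> nat \<Rightarrow> real"
    and \<mu> \<sigma> \<theta> :: "nat \<Rightarrow> real"
    and \<rho> :: real
  assumes prob: "i \<in> {1, 2} \<Longrightarrow> prob_space (P i)"
    and complete: "i \<in> {1, 2} \<Longrightarrow> complete_measure (P i)"
    and brownian: "i \<in> {1, 2} \<Longrightarrow> standard_brownian_motion (P i) W"
    and chain: "i \<in> {1, 2} \<Longrightarrow> markov_chain (P i) {1, 2} q \<epsilon>"
    and indep: "i \<in> {1, 2} \<Longrightarrow>
      prob_space.indep_set (P i)
        (generated_events (P i) borel W {0..})
        (generated_events (P i) (count_space {1, 2}) \<epsilon> {0..})"
    and start: "i \<in> {1, 2} \<Longrightarrow> AE \<omega> in P i. \<epsilon> 0 \<omega> = i"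
    and ito: "i \<in> {1, 2} \<Longrightarrow>
      is_ito_integral (P i) (augmented_filtration (P i) W {1, 2} \<epsilon>) W (\<lambda>s \<omega>. \<sigma> (\<epsilon> s \<omega>)) Z"
    and rate_pos: "i \<in> {1, 2} \<Longrightarrow> exit_rate q i > 0"
    and rate_sum: "i \<in> {1, 2} \<Longrightarrow> (\<Sum>j\<in>{1, 2}. q i j) = 0"
    and sigma_pos: "i \<in> {1, 2} \<Longrightarrow> \<sigma> i > 0"
    and rho_pos: "\<rho> > 0"
begin

definition surplus :: "real \<Rightarrow> (real \<Rightarrow> 'a \<Rightarrow> real) \<Rightarrow> real \<Rightarrow> 'a \<Rightarrow> real" where
  "surplus x D t \<omega> = x + (LBINT s:{0..t}. \<mu> (\<epsilon> s \<omega>)) + Z t \<omega> - D t \<omega>"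

definition bankruptcy_time :: "real \<Rightarrow> (real \<Rightarrow> 'a \<Rightarrow> real) \<Rightarrow> 'a \<Rightarrow> ereal" where
  "bankruptcy_time x D \<omega> = Inf (ereal ` {t. 0 \<le> t \<and> surplus x D t \<omega> \<le> \<theta> (\<epsilon> t \<omega>)})"

definition admissible :: "real \<Rightarrow> nat \<Rightarrow> (real \<Rightarrow> 'a \<Rightarrow> real) set" where
  "admissible x i = {D.
     (\<forall>t\<ge>0. D t \<in> borel_measurable (augmented_filtration (P i) W {1, 2} \<epsilon> t)) \<and>
     (\<forall>\<omega>\<in>space (P i).
        D 0 \<omega> = 0 \<and>
        (\<forall>t\<ge>0. 0 \<le> D t \<omega>) \<and>
        mono_on {0..} (\<lambda>t. D t \<omega>) \<and>
        (\<forall>t>0. continuous (at_left t) (\<lambda>s. D s \<omega>)) \<and>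
        (\<forall>t\<ge>0. \<exists>l. ((\<lambda>s. D s \<omega>) \<longlongrightarrow> l) (at_right t))) \<and>
     (AE \<omega> in P i.
        (\<forall>t\<ge>0. right_limit (\<lambda>s. D s \<omega>) t - D t \<omega> \<le> max 0 (surplus x D t \<omega> - \<theta> (\<epsilon> t \<omega>))) \<and>
        emeasure (stieltjes (\<lambda>s. D s \<omega>)) {t. bankruptcy_time x D \<omega> < ereal t} = 0)}"

definition payoff :: "real \<Rightarrow> nat \<Rightarrow> (real \<Rightarrow> 'a \<Rightarrow> real) \<Rightarrow> ennreal" where
  "payoff x i D =
     (\<integral>\<^sup>+\<omega>. (\<integral>\<^sup>+t\<in>{t. 0 \<le> t \<and> ereal t \<le> bankruptcy_time x D \<omega>}.
        ennreal (exp (- \<rho> * t)) \<partial>stieltjes (\<lambda>s. D s \<omega>)) \<partial>P i)"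

definition value_function :: "real \<Rightarrow> nat \<Rightarrow> ennreal" where
  "value_function x i = (SUP D \<in> admissible x i. payoff x i D)"

definition optimal :: "real \<Rightarrow> nat \<Rightarrow> (real \<Rightarrow> 'a \<Rightarrow> real) \<Rightarrow> bool" where
  "optimal x i D \<longleftrightarrow> D \<in> admissible x i \<and> payoff x i D = value_function x i"

end

text \<open>Only used for \<open>x \<ge> \<theta> 1\<close> and \<open>i \<in> {1, 2}\<close>.\<close>

definition candidate :: "(nat \<Rightarrow> real) \<Rightarrow> real \<Rightarrow> nat \<Rightarrow> real" where
  "candidate \<theta> x i =
     (if i = 1 then x - \<theta> 1 else if x \<le> \<theta> 2 then 0 else x - \<theta> 2)"

definition pay_all_immediately :: "(nat \<Rightarrow> real) \<Rightarrow> real \<Rightarrow> nat \<Rightarrow> real \<Rightarrow> 'a \<Rightarrow> real" where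
  "pay_all_immediately \<theta> x i t \<omega> = (if t \<le> 0 then 0 else max 0 (x - \<theta> i))"

end

theory Submission
  imports Defs
begin

text \<open>
  Since \<open>exp (- \<rho> t) \<le> 1\<close>, the payoff of a strategy is at most the expected total dividends. Before
  bankruptcy the surplus lies above the threshold of the current regime, so the dividends paid so
  far are below the uncontrolled surplus minus that threshold; they are therefore at most
  \<open>x - \<theta> i + \<integral>\<mu> dt + Z + (\<theta> 2 - \<theta> 1) N\<close>, where \<open>N\<close> counts the jumps from regime 2 to regime 1. The
  compensator of \<open>N\<close> has density \<open>\<lambda>\<^sub>2\<close> in regime 2, so that this process is a supermartingale when
  \<open>\<mu> 1 \<le> 0\<close> and \<open>\<mu> 2 \<le> (\<theta> 1 - \<theta> 2) \<lambda>\<^sub>2\<close>. It is stopped at dyadic grid times, which avoids having to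
  show that bankruptcy is a stopping time, and the mesh then tends to 0.

  If \<open>\<mu> 2 > (\<theta> 1 - \<theta> 2) \<lambda>\<^sub>2\<close>, then in regime 2 and slightly above \<open>\<theta> 2\<close> the surplus minus the current
  threshold has a positive drift that beats discounting. Waiting for a short time and paying
  everything if bankruptcy has not occurred by then yields more than \<open>x - \<theta> 2\<close>.
\<close>

section \<open>Two-state transition probabilities\<close>

text \<open>The candidate is linear in \<open>x\<close>, so both directions can rest on first-order
  expansions of expectations over single grid cells, restricted to an event known when the cell
  begins. An error of order \<open>h^2\<close> per cell adds up to one of order \<open>T * h\<close>
  on \<open>[0, T]\<close>, which vanishes with the mesh. The obstacle is the interchange of limit
  and expectation. The pathwise bound on the dividends holds only once the grid is fine enough for
  the given path, so at every mesh there remains an exceptional event, of probability tending to 0,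
  on which the stopped sum may be very negative. Its martingale part is therefore controlled in
  second moment, uniformly in the mesh, and the dividends are truncated until the limit has been
  taken. For the converse the expected terminal payment is bounded from below; this takes jump
  probabilities bounded from both sides and a correction for paths whose failure a coarse grid
  overlooks.\<close>

lemma matrix_pow_two_states:
  fixes q :: "nat \<Rightarrow> nat \<Rightarrow> real"
  assumes rows: "\<And>i. i \<in> {1, 2} \<Longrightarrow> q i 1 + q i 2 = 0" and ij: "i \<in> {1, 2}" "j \<in> {1, 2}"
  shows "matrix_pow {1, 2} q (Suc n) i j = (q 1 1 + q 2 2) ^ n * q i j"
  using ij
proof (induction n arbitrary: i j)
  case 0
  then show ?case by auto
next
  case (Suc n)
  have q: "q 1 2 = - q 1 1" "q 2 1 = - q 2 2"
    using rows[of 1] rows[of 2] by simp_all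
  have "matrix_pow {1, 2} q (Suc (Suc n)) i j
      = q i 1 * matrix_pow {1, 2} q (Suc n) 1 j + q i 2 * matrix_pow {1, 2} q (Suc n) 2 j"
    by simp
  also have "\<dots> = (q 1 1 + q 2 2) ^ n * (q i 1 * q 1 j + q i 2 * q 2 j)"
    using Suc.IH[of 1 j] Suc.IH[of 2 j] Suc.prems by (simp add: distrib_left del: matrix_pow.simps)
  \<comment> \<open>Cayley-Hamilton for a 2 by 2 matrix with zero row sums: its determinant
    vanishes, so its square is its trace times itself.\<close>
  also have "q i 1 * q 1 j + q i 2 * q 2 j = (q 1 1 + q 2 2) * q i j"
    using Suc.prems q by (auto simp: algebra_simps)
  finally show ?case by (simp del: matrix_pow.simps)
qed

text \<open>Beyond the zeroth term every power of \<open>q\<close> is a scalar multiple of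
  \<open>q\<close>, so what remains is the scalar series of \<open>exp (- L * t)\<close> without its
  constant term, divided by \<open>- L\<close>.\<close>

lemma transition_prob_two_states:
  fixes q :: "nat \<Rightarrow> nat \<Rightarrow> real"
  assumes rows: "\<And>i. i \<in> {1, 2} \<Longrightarrow> q i 1 + q i 2 = 0" and ij: "i \<in> {1, 2}" "j \<in> {1, 2}"
    and L: "L = - q 1 1 - q 2 2" "L > 0"
  shows "transition_prob {1, 2} q t i j = (if i = j then 1 else 0) + q i j * (1 - exp (- L * t)) / L"
proof -
  have e: "(\<lambda>n. (- L * t) ^ n / fact n) sums exp (- L * t)"
    using exp_converges[of "- L * t"] by (simp add: field_simps)
  have z: "(\<lambda>n. if n = 0 then 1 else 0) sums (1::real)"
    using sums_single[of 0 "\<lambda>_. 1::real"] by simp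
  \<comment> \<open>The constant term is taken out of the exponential by an indicator of
    \<open>n = 0\<close>: the bracket vanishes there and only the identity matrix remains.\<close>
  have "(\<lambda>n. (if i = j then 1 else 0) * (if n = 0 then 1 else 0)
      + q i j / L * ((if n = 0 then 1 else 0) - (- L * t) ^ n / fact n))
    sums ((if i = j then 1 else 0) * 1 + q i j / L * (1 - exp (- L * t)))"
    by (intro sums_add sums_mult sums_diff e z)
  moreover have "(if i = j then 1 else 0) * (if n = 0 then 1 else 0)
      + q i j / L * ((if n = 0 then 1 else 0) - (- L * t) ^ n / fact n)
    = t ^ n / fact n * matrix_pow {1, 2} q n i j" for n
  proof (cases n)
    case (Suc k)
    have "matrix_pow {1, 2} q n i j = (- L) ^ k * q i j"
      unfolding Suc by (subst matrix_pow_two_states[OF rows ij]) (simp_all add: L add.commute)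
    then show ?thesis
      using L(2) by (simp add: Suc power_mult_distrib divide_simps power_minus[of "L * t"] power_minus[of L] del: matrix_pow.simps)
  qed simp
  ultimately show ?thesis
    unfolding transition_prob_def by (simp add: sums_iff)
qed

text \<open>The first two bounds come from \<open>1 + y \<le> exp y\<close>. The quadratic lower
  bound keeps the loss per cell of order \<open>h^2\<close> where a minimal number of jumps has to
  be guaranteed.\<close>

lemma one_minus_exp_bounds:
  fixes y :: real
  assumes "y \<ge> 0"
  shows "1 - exp (- y) \<le> y" "1 - exp (- y) \<ge> y - y\<^sup>2" "1 - exp (- y) \<ge> 0"
proof -
  show "1 - exp (- y) \<le> y" using exp_ge_add_one_self[of "- y"] by simp
  have "exp (- y) \<le> 1 / (1 + y)"
    using exp_ge_add_one_self[of y] assms by (simp add: exp_minus divide_simps)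
  also have "\<dots> \<le> 1 - y + y\<^sup>2"
  proof -
    have "(1 - y + y\<^sup>2) * (1 + y) = 1 + y ^ 3" by algebra
    then show ?thesis using assms by (simp add: divide_simps mult.commute)
  qed
  finally show "1 - exp (- y) \<ge> y - y\<^sup>2" by simp
  show "1 - exp (- y) \<ge> 0" using assms by simp
qed

text \<open>The upper bound limits the jumps that have to be paid for; the last one guarantees the
  downward jumps of the threshold from which waiting profits.\<close>

lemma transition_prob_two_states_bounds:
  fixes q :: "nat \<Rightarrow> nat \<Rightarrow> real"
  assumes rows: "\<And>i. i \<in> {1, 2} \<Longrightarrow> q i 1 + q i 2 = 0" and ij: "i \<in> {1, 2}" "j \<in> {1, 2}" "i \<noteq> j"
    and pos: "\<And>i. i \<in> {1, 2} \<Longrightarrow> q i i < 0" and t: "t \<ge> 0"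
  shows "transition_prob {1, 2} q t i j \<ge> 0"
    and "transition_prob {1, 2} q t i j \<le> - q i i * t"
    and "transition_prob {1, 2} q t i j \<ge> - q i i * (t - (- q 1 1 - q 2 2) * t\<^sup>2)"
proof -
  define L where "L = - q 1 1 - q 2 2"
  have L: "L > 0" using pos[of 1] pos[of 2] by (simp add: L_def)
  have qij: "q i j = - q i i" using rows[of i] ij by auto
  have p: "transition_prob {1, 2} q t i j = q i j * (1 - exp (- L * t)) / L"
    using transition_prob_two_states[OF rows ij(1,2) L_def L] ij by simp
  have qpos: "q i j > 0" using pos[of i] ij qij by auto
  note b = one_minus_exp_bounds[of "L * t"]
  have Lt: "L * t \<ge> 0" using L t by simp
  show "transition_prob {1, 2} q t i j \<ge> 0"
    unfolding p using b(3)[OF Lt] qpos L by (intro divide_nonneg_pos mult_nonneg_nonneg) auto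
  have "(1 - exp (- L * t)) / L \<le> t"
    using b(1)[OF Lt] L by (simp add: field_simps)
  then have "q i j * ((1 - exp (- L * t)) / L) \<le> q i j * t"
    using qpos by (intro mult_left_mono) auto
  then show "transition_prob {1, 2} q t i j \<le> - q i i * t"
    unfolding p qij by simp
  have "(1 - exp (- L * t)) / L \<ge> t - L * t\<^sup>2"
  proof -
    have "L * (t - L * t\<^sup>2) \<le> 1 - exp (- (L * t))"
      using b(2)[OF Lt] by (simp add: power2_eq_square algebra_simps)
    then show ?thesis using L by (simp add: pos_le_divide_eq mult.commute)
  qed
  then have "q i j * ((1 - exp (- L * t)) / L) \<ge> q i j * (t - L * t\<^sup>2)"
    using qpos by (intro mult_left_mono) auto
  then show "transition_prob {1, 2} q t i j \<ge> - q i i * (t - (- q 1 1 - q 2 2) * t\<^sup>2)"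
    unfolding p qij L_def by simp
qed

section \<open>Stieltjes measures\<close>

locale increasing_path =
  fixes f :: "real \<Rightarrow> real"
  assumes mono: "mono_on {0..} f"
    and right_limits: "t \<ge> 0 \<Longrightarrow> \<exists>l. (f \<longlongrightarrow> l) (at_right t)"
begin

lemma right_limit: "t \<ge> 0 \<Longrightarrow> (f \<longlongrightarrow> right_limit f t) (at_right t)"
  unfolding right_limit_def using right_limits[of t] tendsto_Lim[of "at_right t" f] by auto

lemma le_right_limit:
  assumes "0 \<le> t" shows "f t \<le> right_limit f t"
proof (rule tendsto_lowerbound[OF right_limit[OF assms]])
  show "\<forall>\<^sub>F x in at_right t. f t \<le> f x"
    using assms mono by (auto simp: eventually_at_filter mono_on_def intro!: always_eventually)
qed simp

lemma right_limit_le: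
  assumes "0 \<le> s" "s < t" shows "right_limit f s \<le> f t"
proof (rule tendsto_upperbound[OF right_limit[OF assms(1)]])
  show "\<forall>\<^sub>F x in at_right s. f x \<le> f t"
    unfolding eventually_at_right[OF assms(2)]
    using assms mono by (auto simp: mono_on_def intro!: exI[of _ t])
qed simp

text \<open>The distribution function of \<open>stieltjes f\<close>. The value \<open>f 0\<close> at
  negative times turns a payment at time 0 into a jump of it.\<close>

definition right_version :: "real \<Rightarrow> real" where
  "right_version t = (if t < 0 then f 0 else right_limit f t)"

lemma right_version_mono: "x \<le> y \<Longrightarrow> right_version x \<le> right_version y"
proof -
  assume xy: "x \<le> y"
  consider "y < 0" | "x < 0" "0 \<le> y" | "0 \<le> x" "x < y" | "x = y" using xy by linarith
  then show "right_version x \<le> right_version y"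
  proof cases
    case 2
    have "f 0 \<le> f y" using mono 2 by (auto simp: mono_on_def)
    then show ?thesis using 2 le_right_limit[of y] by (simp add: right_version_def)
  next
    case 3
    then show ?thesis using right_limit_le[of x y] le_right_limit[of y] by (simp add: right_version_def)
  qed (use xy in \<open>auto simp: right_version_def\<close>)
qed

text \<open>An upper bound on \<open>f\<close> to the right of \<open>a\<close> passes to the right
  limits there: between \<open>x\<close> and the end of that interval lies another point
  \<open>z\<close>, and \<open>right_limit f x \<le> f z\<close>. The lower bound is
  monotonicity.\<close>

lemma right_version_continuous: "continuous (at_right a) right_version"
proof (cases "a < 0")
  case True
  have "\<forall>\<^sub>F x in at_right a. right_version x = right_version a"
    unfolding eventually_at_right[OF True] using True by (auto simp: right_version_def intro!: exI[of _ 0])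
  then have "(right_version \<longlongrightarrow> right_version a) (at_right a)"
    by (rule tendsto_eventually)
  then show ?thesis by (simp add: continuous_within)
next
  case False
  then have a: "a \<ge> 0" by simp
  have "(right_version \<longlongrightarrow> right_version a) (at_right a)"
  proof (rule order_tendstoI)
    fix y assume "y < right_version a"
    then have "y < right_version x" if "a < x" for x
      using right_version_mono[of a x] that by linarith
    then show "\<forall>\<^sub>F x in at_right a. y < right_version x"
      unfolding eventually_at_filter by (intro always_eventually) auto
  next
    fix y assume "right_version a < y"
    then have "right_limit f a < y" using False by (simp add: right_version_def)
    from order_tendstoD(2)[OF right_limit[OF a] this]
    obtain b where b: "b > a" "\<And>x. a < x \<Longrightarrow> x < b \<Longrightarrow> f x < y"
      by (auto simp: eventually_at_right_field)
    have "right_version x < y" if ax: "a < x" and xb: "x < b" for x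
    proof -
      obtain z where "x < z" "z < b" using dense[OF xb] by auto
      then have "right_limit f x \<le> f z" "f z < y"
        using right_limit_le[of x z] ax a b by auto
      then show ?thesis using ax a by (simp add: right_version_def)
    qed
    then show "\<forall>\<^sub>F x in at_right a. right_version x < y"
      using b(1) by (auto simp: eventually_at_right_field)
  qed
  then show ?thesis by (simp add: continuous_within)
qed

lemma sets_stieltjes [simp, measurable_cong]: "sets (stieltjes f) = sets borel"
  by (simp add: stieltjes_def)

lemma space_stieltjes [simp]: "space (stieltjes f) = UNIV"
  by (simp add: stieltjes_def)

lemma emeasure_stieltjes_Ioc:
  "a \<le> b \<Longrightarrow> emeasure (stieltjes f) {a<..b} = ennreal (right_version b - right_version a)"
proof -
  have "stieltjes f = interval_measure right_version"
    unfolding stieltjes_def right_version_def ..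
  then show "a \<le> b \<Longrightarrow> ?thesis"
    using emeasure_interval_measure_Ioc[of a b right_version] right_version_mono right_version_continuous by auto
qed

text \<open>The mass of \<open>(-1, n]\<close> is \<open>right_limit f n\<close>, which is at most
  \<open>f (n + 1)\<close>. Starting at -1 includes the jump at time 0.\<close>

lemma emeasure_stieltjes_nonneg:
  assumes "f 0 = 0"
  shows "emeasure (stieltjes f) {0..} \<le> (SUP n. ennreal (f (real n)))"
proof -
  have "emeasure (stieltjes f) {0..} \<le> emeasure (stieltjes f) (\<Union>n::nat. {-1<..real n})"
  proof (rule emeasure_mono)
    show "{0..} \<subseteq> (\<Union>n::nat. {-1<..real n})"
    proof
      fix x :: real assume "x \<in> {0..}"
      moreover obtain n :: nat where "x \<le> real n" using real_arch_simple by blast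
      ultimately show "x \<in> (\<Union>n::nat. {-1<..real n})" by force
    qed
  qed auto
  also have "\<dots> = (SUP n. emeasure (stieltjes f) {-1<..real n})"
    by (rule SUP_emeasure_incseq[symmetric]) (auto simp: incseq_def)
  also have "\<dots> \<le> (SUP n. ennreal (f (real n)))"
  proof (rule SUP_mono)
    fix n :: nat
    have "emeasure (stieltjes f) {-1<..real n} \<le> ennreal (f (real (Suc n)))"
      using emeasure_stieltjes_Ioc[of "-1" "real n"] right_limit_le[of "real n" "real (Suc n)"] assms
      by (auto simp: right_version_def intro!: ennreal_leI)
    then show "\<exists>m\<in>UNIV. emeasure (stieltjes f) {-1<..real n} \<le> ennreal (f (real m))" by blast
  qed
  finally show ?thesis .
qed

text \<open>Turns the absence of mass after \<open>\<tau>\<close> into a statement on values. The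
  right limit includes a payment made at \<open>\<tau>\<close> itself.\<close>

lemma constant_after:
  assumes null: "emeasure (stieltjes f) {t. \<tau> < t} = 0" and \<tau>: "0 \<le> \<tau>" and t: "\<tau> < t"
  shows "f t \<le> right_limit f \<tau>"
proof -
  have "emeasure (stieltjes f) {\<tau><..t} \<le> emeasure (stieltjes f) {t. \<tau> < t}"
    by (rule emeasure_mono) auto
  then have "ennreal (right_version t - right_version \<tau>) = 0"
    using null emeasure_stieltjes_Ioc[of \<tau> t] t by simp
  then have "right_version t \<le> right_version \<tau>" by (simp add: ennreal_eq_0_iff)
  then show ?thesis using \<tau> t le_right_limit[of t] by (simp add: right_version_def)
qed

end

section \<open>Paths with a single jump\<close>

lemma increasing_path_step:
  assumes "c \<ge> 0"
  shows "increasing_path (\<lambda>t. if t \<le> h then 0 else c :: real)"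
proof
  show "mono_on {0..} (\<lambda>t. if t \<le> h then 0 else c)"
    using assms by (auto simp: mono_on_def)
  show "\<exists>l. ((\<lambda>t. if t \<le> h then 0 else c) \<longlongrightarrow> l) (at_right t)" for t
  proof (cases "t < h")
    case True
    have "\<forall>\<^sub>F s in at_right t. (if s \<le> h then 0 else c) = 0"
      unfolding eventually_at_right[OF True] using True by (auto intro!: exI[of _ h])
    then show ?thesis by (blast intro: tendsto_eventually)
  next
    case False
    then have "\<forall>\<^sub>F s in at_right t. (if s \<le> h then 0 else c) = c"
      by (auto simp: eventually_at_filter intro!: always_eventually)
    then show ?thesis by (blast intro: tendsto_eventually)
  qed
qed

lemma right_limit_step:
  "right_limit (\<lambda>t. if t \<le> h then 0 else c :: real) t = (if t < h then 0 else c)"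
proof -
  have "((\<lambda>t. if t \<le> h then 0 else c :: real) \<longlongrightarrow> (if t < h then 0 else c)) (at_right t)"
  proof (cases "t < h")
    case True
    have "\<forall>\<^sub>F s in at_right t. (if s \<le> h then 0 else c) = 0"
      unfolding eventually_at_right[OF True] using True by (auto intro!: exI[of _ h])
    then show ?thesis using True by (simp add: tendsto_eventually)
  next
    case False
    then have "\<forall>\<^sub>F s in at_right t. (if s \<le> h then 0 else c) = c"
      by (auto simp: eventually_at_filter intro!: always_eventually)
    then show ?thesis using False by (simp add: tendsto_eventually)
  qed
  then show ?thesis unfolding right_limit_def by (intro tendsto_Lim) auto
qed

lemma emeasure_stieltjes_step:
  assumes c: "c \<ge> 0" and h: "h \<ge> 0"
  defines "f \<equiv> \<lambda>t. if t \<le> h then 0 else c :: real"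
  shows "emeasure (stieltjes f) {h} = ennreal c"
    and "emeasure (stieltjes f) {t. h < t} = 0"
proof -
  interpret increasing_path f unfolding f_def by (rule increasing_path_step[OF c])
  \<comment> \<open>This covers \<open>h = 0\<close> too: at negative times
    \<open>right_version\<close> is \<open>f 0 = 0\<close>, so the jump at time 0 has mass
    \<open>c\<close>.\<close>
  have F: "right_version t = (if t < h then 0 else c)" for t
    unfolding right_version_def using h unfolding f_def right_limit_step by auto
  have "emeasure (stieltjes f) {h} = emeasure (stieltjes f) (\<Inter>n::nat. {h - 1 / (real n + 1)<..h})"
  proof (rule arg_cong[where f = "emeasure _"])
    have "x = h" if "\<And>n::nat. h - 1 / (real n + 1) < x" "x \<le> h" for x
    proof (rule ccontr)
      assume "x \<noteq> h"
      then have "h - x > 0" using that by simp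
      then obtain n :: nat where "inverse (real (Suc n)) < h - x" using reals_Archimedean by blast
      then show False using that(1)[of n] by (simp add: inverse_eq_divide add.commute)
    qed
    then show "{h} = (\<Inter>n::nat. {h - 1 / (real n + 1)<..h})" by auto
  qed
  also have "\<dots> = (INF n::nat. emeasure (stieltjes f) {h - 1 / (real n + 1)<..h})"
  proof (rule INF_emeasure_decseq[symmetric])
    show "decseq (\<lambda>n. {h - 1 / (real n + 1)<..h})"
    proof (rule decseq_SucI)
      fix n
      have "1 / (real (Suc n) + 1) \<le> 1 / (real n + 1)" by (intro divide_left_mono) auto
      then show "{h - 1 / (real (Suc n) + 1)<..h} \<subseteq> {h - 1 / (real n + 1)<..h}" by auto
    qed
  qed (auto simp: emeasure_stieltjes_Ioc)
  also have "\<dots> = ennreal c"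
    by (subst emeasure_stieltjes_Ioc) (auto simp: F)
  finally show "emeasure (stieltjes f) {h} = ennreal c" .
  have "{t. h < t} = (\<Union>n::nat. {h<..h + real n})"
  proof -
    have "\<exists>n::nat. t \<le> h + real n" for t
      using real_arch_simple[of "t - h"] by (auto simp: algebra_simps)
    then show ?thesis by auto
  qed
  also have "emeasure (stieltjes f) \<dots> = (SUP n::nat. emeasure (stieltjes f) {h<..h + real n})"
    by (rule SUP_emeasure_incseq[symmetric]) (auto simp: incseq_def)
  also have "\<dots> = 0"
    by (subst emeasure_stieltjes_Ioc) (auto simp: F)
  finally show "emeasure (stieltjes f) {t. h < t} = 0" .
qed

section \<open>The filtration\<close>

(* simp would otherwise rewrite the state space {1, 2} to {Suc 0, 2}. *)
declare One_nat_def [simp del]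

lemma sigma_algebra_generated_events:
  "sigma_algebra (space P) (generated_events P N Y T)"
  unfolding generated_events_def by (rule sigma_algebra_sigma_sets) auto

lemma generated_events_mono: "T \<subseteq> T' \<Longrightarrow> generated_events P N Y T \<subseteq> generated_events P N Y T'"
  unfolding generated_events_def by (rule sigma_sets_mono') auto

lemma generated_events_vimage:
  "s \<in> T \<Longrightarrow> B \<in> sets N \<Longrightarrow> Y s -` B \<inter> space P \<in> generated_events P N Y T"
  unfolding generated_events_def by (rule sigma_sets.Basic) auto

text \<open>The two laws of the model live on different \<sigma>-algebras, so the theory is
  developed for a single one; the initial regime stays open.\<close>

locale switching_law = prob_space M + complete_measure M
  for M :: "'a measure" +
  fixes W :: "real \<Rightarrow> 'a \<Rightarrow> real"
    and \<epsilon> :: "real \<Rightarrow> 'a \<Rightarrow> nat"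
    and q :: "nat \<Rightarrow> nat \<Rightarrow> real"
  assumes brownian: "standard_brownian_motion M W"
    and chain: "markov_chain M {1, 2} q \<epsilon>"
    and indep: "indep_set (generated_events M borel W {0..})
      (generated_events M (count_space {1, 2}) \<epsilon> {0..})"
    and rate_neg: "i \<in> {1, 2} \<Longrightarrow> q i i < 0"
    and rows: "i \<in> {1, 2} \<Longrightarrow> q i 1 + q i 2 = 0"
begin

abbreviation F :: "real \<Rightarrow> 'a measure" where
  "F \<equiv> augmented_filtration M W {1, 2} \<epsilon>"

abbreviation W_events :: "real set \<Rightarrow> 'a set set" where
  "W_events \<equiv> generated_events M borel W"

abbreviation chain_events :: "real set \<Rightarrow> 'a set set" where
  "chain_events \<equiv> generated_events M (count_space {1, 2}) \<epsilon>"

lemma W_measurable: "t \<ge> 0 \<Longrightarrow> W t \<in> borel_measurable M"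
  using brownian by (simp add: standard_brownian_motion_def)

lemma \<epsilon>_measurable_space: "t \<ge> 0 \<Longrightarrow> \<epsilon> t \<in> measurable M (count_space {1, 2})"
  using chain by (simp add: markov_chain_def)

lemma \<epsilon>_measurable: "t \<ge> 0 \<Longrightarrow> \<epsilon> t \<in> measurable M (count_space UNIV)"
  using \<epsilon>_measurable_space by (rule measurable_compose[OF _ measurable_count_space])

lemma \<epsilon>_range: "t \<ge> 0 \<Longrightarrow> \<omega> \<in> space M \<Longrightarrow> \<epsilon> t \<omega> \<in> {1, 2}"
  using measurable_space[OF \<epsilon>_measurable_space] by simp

lemma \<epsilon>_cases: "t \<ge> 0 \<Longrightarrow> \<omega> \<in> space M \<Longrightarrow> \<epsilon> t \<omega> = 1 \<or> \<epsilon> t \<omega> = 2"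
  using \<epsilon>_range by auto

lemma W_events_sets: "T \<subseteq> {0..} \<Longrightarrow> W_events T \<subseteq> sets M"
  unfolding generated_events_def
  by (rule sets.sigma_sets_subset) (auto intro!: measurable_sets[OF W_measurable])

lemma chain_events_sets: "T \<subseteq> {0..} \<Longrightarrow> chain_events T \<subseteq> sets M"
  unfolding generated_events_def
  by (rule sets.sigma_sets_subset) (auto intro!: measurable_sets[OF \<epsilon>_measurable_space])

lemma generating_subset:
  "0 \<le> t \<Longrightarrow> W_events {0..t} \<union> chain_events {0..t} \<union> null_sets M \<subseteq> sets M"
  using W_events_sets[of "{0..t}"] chain_events_sets[of "{0..t}"] by auto

lemma generating_Pow: "W_events {0..t} \<union> chain_events {0..t} \<union> null_sets M \<subseteq> Pow (space M)"
proof -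
  interpret A: sigma_algebra "space M" "W_events {0..t}" by (rule sigma_algebra_generated_events)
  interpret B: sigma_algebra "space M" "chain_events {0..t}" by (rule sigma_algebra_generated_events)
  show ?thesis using A.space_closed B.space_closed sets.sets_into_space by blast
qed

lemma space_F [simp]: "space (F t) = space M"
  unfolding augmented_filtration_def by (rule space_measure_of) (rule generating_Pow)

lemma sets_F: "sets (F t) =
    sigma_sets (space M) (W_events {0..t} \<union> chain_events {0..t} \<union> null_sets M)"
  unfolding augmented_filtration_def by (rule sets_measure_of) (rule generating_Pow)

lemma sets_F_subset: "0 \<le> t \<Longrightarrow> sets (F t) \<subseteq> sets M"
  unfolding sets_F by (rule sets.sigma_sets_subset) (rule generating_subset)

lemma sets_F_mono: "s \<le> t \<Longrightarrow> sets (F s) \<subseteq> sets (F t)"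
  unfolding sets_F
  by (intro sigma_sets_mono' Un_mono generated_events_mono) auto

lemma measurable_F_mono: "f \<in> measurable (F s) N \<Longrightarrow> s \<le> t \<Longrightarrow> f \<in> measurable (F t) N"
  using sets_F_mono[of s t] by (auto simp: measurable_def)

lemma measurable_F_M: "f \<in> measurable (F s) N \<Longrightarrow> 0 \<le> s \<Longrightarrow> f \<in> measurable M N"
  using sets_F_subset[of s] by (auto simp: measurable_def)

lemma null_sets_F: "N \<in> null_sets M \<Longrightarrow> N \<in> sets (F t)"
  unfolding sets_F by (intro sigma_sets.Basic) auto

lemma W_measurable_F: "0 \<le> s \<Longrightarrow> s \<le> t \<Longrightarrow> W s \<in> borel_measurable (F t)"
  by (rule measurableI)
     (auto simp: sets_F intro!: sigma_sets.Basic generated_events_vimage)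

lemma \<epsilon>_measurable_F_space: "0 \<le> s \<Longrightarrow> s \<le> t \<Longrightarrow> \<epsilon> s \<in> measurable (F t) (count_space {1, 2})"
  using \<epsilon>_range[of s]
  by (intro measurableI)
     (auto simp: sets_F intro!: sigma_sets.Basic generated_events_vimage)

lemma \<epsilon>_measurable_F: "0 \<le> s \<Longrightarrow> s \<le> t \<Longrightarrow> \<epsilon> s \<in> measurable (F t) (count_space UNIV)"
  by (rule measurable_compose[OF \<epsilon>_measurable_F_space measurable_count_space])

text \<open>Every \<open>F t\<close> contains all null sets of a complete space. Processes may
  therefore be replaced by versions with good paths without losing adaptedness.\<close>

lemma AE_eq_measurable_F:
  fixes f g :: "'a \<Rightarrow> 'b :: topological_space"
  assumes g: "g \<in> borel_measurable (F t)" and eq: "AE \<omega> in M. f \<omega> = g \<omega>"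
  shows "f \<in> borel_measurable (F t)"
proof (rule measurableI)
  fix A :: "'b set" assume A: "A \<in> sets borel"
  define N where "N = {\<omega> \<in> space M. f \<omega> \<noteq> g \<omega>}"
  have N: "N \<in> null_sets M"
    using eq unfolding AE_iff_null_sets N_def by simp
  have "f -` A \<inter> space (F t) = (g -` A \<inter> space (F t) - N) \<union> (f -` A \<inter> N)"
    by (auto simp: N_def)
  moreover have "f -` A \<inter> N \<in> null_sets M"
    using N by (rule complete2[rotated]) auto
  moreover have "g -` A \<inter> space (F t) \<in> sets (F t)"
    using g A by (rule measurable_sets)
  ultimately show "f -` A \<inter> space (F t) \<in> sets (F t)"
    using null_sets_F[OF N, of t] null_sets_F[of "f -` A \<inter> N" t] by auto
qed auto

text \<open>
  Intersections of an event of the past of \<open>W\<close> with one of the past of \<open>\<epsilon>\<close>, together with the null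
  sets, form a \<open>\<pi>\<close>-system that generates \<open>F s\<close>.
\<close>

lemma prob_Int_filtration:
  assumes s: "0 \<le> s" and E: "E \<in> events" "E' \<in> events"
    and eq: "\<And>A C. A \<in> W_events {0..s} \<Longrightarrow> C \<in> chain_events {0..s} \<Longrightarrow>
      prob (A \<inter> C \<inter> E) = p * prob (A \<inter> C \<inter> E')"
    and B: "B \<in> sets (F s)"
  shows "prob (B \<inter> E) = p * prob (B \<inter> E')"
proof -
  interpret A: sigma_algebra "space M" "W_events {0..s}" by (rule sigma_algebra_generated_events)
  interpret C: sigma_algebra "space M" "chain_events {0..s}" by (rule sigma_algebra_generated_events)
  define \<G> where "\<G> = {A \<inter> C | A C. A \<in> W_events {0..s} \<and> C \<in> chain_events {0..s}} \<union> null_sets M"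
  have \<G>_sets: "\<G> \<subseteq> sets M"
    using W_events_sets[of "{0..s}"] chain_events_sets[of "{0..s}"] by (auto simp: \<G>_def)
  have "Int_stable \<G>"
  proof (rule Int_stableI)
    fix a b assume a: "a \<in> \<G>" and b: "b \<in> \<G>"
    show "a \<inter> b \<in> \<G>"
    proof (cases "a \<in> null_sets M \<or> b \<in> null_sets M")
      case True
      then have "a \<inter> b \<in> null_sets M"
        using a b \<G>_sets by (auto intro: null_set_Int1 null_set_Int2)
      then show ?thesis by (simp add: \<G>_def)
    next
      case False
      then obtain A C A' C' where *: "a = A \<inter> C" "b = A' \<inter> C'"
        "A \<in> W_events {0..s}" "C \<in> chain_events {0..s}" "A' \<in> W_events {0..s}" "C' \<in> chain_events {0..s}"
        using a b unfolding \<G>_def by blast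
      then have "a \<inter> b = (A \<inter> A') \<inter> (C \<inter> C')" by auto
      then show ?thesis using * unfolding \<G>_def by blast
    qed
  qed
  moreover have "\<G> \<subseteq> Pow (space M)"
    using \<G>_sets sets.sets_into_space by blast
  moreover have "B \<in> sigma_sets (space M) \<G>"
  proof -
    have "W_events {0..s} \<union> chain_events {0..s} \<union> null_sets M \<subseteq> \<G>"
    proof -
      have "A \<in> \<G>" if "A \<in> W_events {0..s}" for A
      proof -
        have "A = A \<inter> space M" using that A.space_closed by auto
        then show ?thesis using that C.top unfolding \<G>_def by blast
      qed
      moreover have "C \<in> \<G>" if "C \<in> chain_events {0..s}" for C
      proof -
        have "C = space M \<inter> C" using that C.space_closed by auto
        then show ?thesis using that A.top unfolding \<G>_def by blast
      qed
      ultimately show ?thesis by (auto simp: \<G>_def)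
    qed
    then show ?thesis using B sigma_sets_mono' unfolding sets_F by blast
  qed
  ultimately show ?thesis
  proof (induction rule: sigma_sets_induct_disjoint)
    case (basic a)
    show ?case
    proof (cases "a \<in> null_sets M")
      case True
      then have "a \<inter> E \<in> null_sets M" "a \<inter> E' \<in> null_sets M"
        using E by (auto intro: null_set_Int2)
      then show ?thesis by (simp add: measure_eq_0_null_sets)
    next
      case False
      then show ?thesis using basic eq unfolding \<G>_def by blast
    qed
  next
    case empty
    show ?case by simp
  next
    case (compl a)
    have a: "a \<in> sets M"
      using compl.hyps \<G>_sets sets.sigma_sets_subset by blast
    \<comment> \<open>The case \<open>A = C = space M\<close> of the hypothesis, from which
      complements are subtracted.\<close>
    have "prob (space M \<inter> E) = p * prob (space M \<inter> E')"
      using eq[OF A.top C.top] by simp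
    moreover have "prob ((space M - a) \<inter> D) = prob (space M \<inter> D) - prob (a \<inter> D)" if "D \<in> events" for D
    proof -
      have "(space M - a) \<inter> D = space M \<inter> D - a \<inter> D" by auto
      then show ?thesis
        using a that sets.sets_into_space[OF a] by (subst finite_measure_Diff[symmetric]) auto
    qed
    ultimately show ?case using compl.IH E by (simp add: right_diff_distrib)
  next
    case (union a)
    have a: "range a \<subseteq> sets M"
      using union.hyps \<G>_sets sets.sigma_sets_subset by blast
    have sm: "(\<lambda>n. prob (a n \<inter> D)) sums prob (\<Union> (range a) \<inter> D)" if "D \<in> events" for D
    proof -
      have "(\<Union> (range a) \<inter> D) = (\<Union>n. a n \<inter> D)" by auto
      moreover have "(\<lambda>n. prob (a n \<inter> D)) sums prob (\<Union>n. a n \<inter> D)"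
        using a that union.hyps
        by (intro finite_measure_UNION) (auto simp: disjoint_family_on_def)
      ultimately show ?thesis by simp
    qed
    have "(\<lambda>n. prob (a n \<inter> E)) sums (p * prob (\<Union> (range a) \<inter> E'))"
      using sums_mult[OF sm[OF E(2)], of p] union.IH by simp
    then show ?case using sm[OF E(1)] sums_unique2 by blast
  qed
qed

text \<open>The model states the Markov property for the past of the chain alone. An event of the
  past of \<open>W\<close> factors out by independence on both sides, and null sets change
  nothing.\<close>

lemma markov:
  assumes st: "0 \<le> s" "s \<le> t" and B: "B \<in> sets (F s)" and ij: "i \<in> {1, 2}" "j \<in> {1, 2}"
  shows "prob (B \<inter> {\<omega> \<in> space M. \<epsilon> s \<omega> = i \<and> \<epsilon> t \<omega> = j})
    = transition_prob {1, 2} q (t - s) i j * prob (B \<inter> {\<omega> \<in> space M. \<epsilon> s \<omega> = i})"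
proof (rule prob_Int_filtration[OF st(1) _ _ _ B])
  note [measurable] = \<epsilon>_measurable[OF st(1)] \<epsilon>_measurable[OF order_trans[OF st]]
  show "{\<omega> \<in> space M. \<epsilon> s \<omega> = i \<and> \<epsilon> t \<omega> = j} \<in> events" by measurable
  show "{\<omega> \<in> space M. \<epsilon> s \<omega> = i} \<in> events" by measurable
  fix A C assume A: "A \<in> W_events {0..s}" and C: "C \<in> chain_events {0..s}"
  have sets: "A \<in> sets M" "C \<in> sets M"
    using A C W_events_sets[of "{0..s}"] chain_events_sets[of "{0..s}"] by auto
  have A': "A \<in> W_events {0..}" and C': "C \<in> chain_events {0..}"
    using A C generated_events_mono[of "{0..s}" "{0..}"] by auto
  interpret E: sigma_algebra "space M" "chain_events {0..}" by (rule sigma_algebra_generated_events)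
  have s0: "{\<omega> \<in> space M. \<epsilon> s \<omega> = i} \<in> chain_events {0..}"
    using generated_events_vimage[of s "{0..}" "{i}" "count_space {1, 2}" \<epsilon> M] st ij
    by (simp add: vimage_def Int_def conj_commute)
  have t0: "{\<omega> \<in> space M. \<epsilon> t \<omega> = j} \<in> chain_events {0..}"
    using generated_events_vimage[of t "{0..}" "{j}" "count_space {1, 2}" \<epsilon> M] st ij
    by (simp add: vimage_def Int_def conj_commute)
  have "prob (A \<inter> C \<inter> {\<omega> \<in> space M. \<epsilon> s \<omega> = i \<and> \<epsilon> t \<omega> = j})
      = prob (A \<inter> (C \<inter> ({\<omega> \<in> space M. \<epsilon> s \<omega> = i} \<inter> {\<omega> \<in> space M. \<epsilon> t \<omega> = j})))"
    by (rule arg_cong[where f = prob]) auto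
  also have "\<dots> = prob A * prob (C \<inter> ({\<omega> \<in> space M. \<epsilon> s \<omega> = i} \<inter> {\<omega> \<in> space M. \<epsilon> t \<omega> = j}))"
    using A' C' s0 t0 by (intro indep_setD[OF indep]) auto
  also have "C \<inter> ({\<omega> \<in> space M. \<epsilon> s \<omega> = i} \<inter> {\<omega> \<in> space M. \<epsilon> t \<omega> = j})
      = {\<omega> \<in> C. \<epsilon> s \<omega> = i \<and> \<epsilon> t \<omega> = j}"
    using sets.sets_into_space[OF sets(2)] by auto
  also have "prob \<dots> = transition_prob {1, 2} q (t - s) i j * prob {\<omega> \<in> C. \<epsilon> s \<omega> = i}"
    using chain st C ij unfolding markov_chain_def by blast
  also have "{\<omega> \<in> C. \<epsilon> s \<omega> = i} = C \<inter> {\<omega> \<in> space M. \<epsilon> s \<omega> = i}"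
    using sets.sets_into_space[OF sets(2)] by auto
  also have "prob A * (transition_prob {1, 2} q (t - s) i j * prob (C \<inter> {\<omega> \<in> space M. \<epsilon> s \<omega> = i}))
      = transition_prob {1, 2} q (t - s) i j * (prob A * prob (C \<inter> {\<omega> \<in> space M. \<epsilon> s \<omega> = i}))"
    by simp
  also have "prob A * prob (C \<inter> {\<omega> \<in> space M. \<epsilon> s \<omega> = i}) = prob (A \<inter> (C \<inter> {\<omega> \<in> space M. \<epsilon> s \<omega> = i}))"
    using A' C' s0 by (intro indep_setD[OF indep, symmetric]) auto
  finally show "prob (A \<inter> C \<inter> {\<omega> \<in> space M. \<epsilon> s \<omega> = i \<and> \<epsilon> t \<omega> = j})
      = transition_prob {1, 2} q (t - s) i j * prob (A \<inter> C \<inter> {\<omega> \<in> space M. \<epsilon> s \<omega> = i})"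
    by (simp add: Int_assoc)
qed

section \<open>Brownian increments under the augmented filtration\<close>

lemma increment_distributed:
  "0 \<le> s \<Longrightarrow> s < t \<Longrightarrow>
    distributed M lborel (\<lambda>\<omega>. W t \<omega> - W s \<omega>) (normal_density 0 (sqrt (t - s)))"
  using brownian by (simp add: standard_brownian_motion_def)

lemma increment_measurable:
  "0 \<le> s \<Longrightarrow> s \<le> t \<Longrightarrow> (\<lambda>\<omega>. W t \<omega> - W s \<omega>) \<in> borel_measurable M"
  by (intro borel_measurable_diff W_measurable) auto

text \<open>The model makes the increment independent of the past of \<open>W\<close> only.
  Independence of \<open>W\<close> and the chain on the whole half-line first splits off the chain
  event \<open>C\<close>, with the increment still attached to \<open>A\<close>; independence of the
  increment from the past of \<open>W\<close> then splits off \<open>A\<close>.\<close>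

lemma increment_indep:
  assumes st: "0 \<le> s" "s < t" and f: "f \<in> measurable (F s) N"
  shows "indep_var N f borel (\<lambda>\<omega>. W t \<omega> - W s \<omega>)"
  unfolding indep_var_eq
proof (intro conjI)
  let ?D = "\<lambda>\<omega>. W t \<omega> - W s \<omega>"
  show fM: "random_variable N f" using measurable_F_M[OF f st(1)] .
  show DM: "random_variable borel ?D" using increment_measurable st by simp
  have ind: "prob (B \<inter> E) = prob B * prob E"
    if B: "B \<in> sets (F s)" and E: "E \<in> {?D -` A \<inter> space M | A. A \<in> sets borel}" for B E
  proof -
    obtain K where K: "E = ?D -` K \<inter> space M" "K \<in> sets borel" using E by auto
    have ED: "E \<in> sets (vimage_algebra (space M) ?D borel)"
      unfolding K sets_vimage_algebra by (rule sigma_sets.Basic) (use K in auto)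
    have EM: "E \<in> events" using K DM by auto
    have "prob (B \<inter> E) = prob E * prob (B \<inter> space M)"
    \<comment> \<open>With \<open>space M\<close> as the comparison event and \<open>prob E\<close>
      as the factor, the extension to \<open>F s\<close> is precisely independence.\<close>
    proof (rule prob_Int_filtration[OF st(1) EM _ _ B])
      fix A C assume A: "A \<in> W_events {0..s}" and C: "C \<in> chain_events {0..s}"
      have C': "C \<in> chain_events {0..}"
        using C generated_events_mono[of "{0..s}" "{0..}"] by auto
      have A': "A \<in> W_events {0..}"
        using A generated_events_mono[of "{0..s}" "{0..}"] by auto
      interpret S: sigma_algebra "space M" "W_events {0..}" by (rule sigma_algebra_generated_events)
      have EW: "E \<in> W_events {0..}"
      proof -
        let ?S = "sigma (space M) (W_events {0..})"
        have sp: "space ?S = space M" "sets ?S = W_events {0..}"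
          using S.space_closed by (auto simp: S.sets_measure_of_eq S.space_measure_of_eq)
        have *: "W u \<in> borel_measurable ?S" if "u \<ge> 0" for u
          by (rule measurableI) (auto simp: sp that intro: generated_events_vimage)
        have "?D \<in> borel_measurable ?S"
          using st by (intro borel_measurable_diff *) auto
        then have "?D -` K \<inter> space ?S \<in> sets ?S" using K by (intro measurable_sets)
        then show ?thesis by (simp add: sp K)
      qed
      have "prob (A \<inter> C \<inter> E) = prob ((A \<inter> E) \<inter> C)"
        by (rule arg_cong[where f = prob]) auto
      also have "\<dots> = prob (A \<inter> E) * prob C"
        using A' EW C' by (intro indep_setD[OF indep]) auto
      also have "prob (A \<inter> E) = prob A * prob E"
        using brownian st A ED unfolding standard_brownian_motion_def by (intro indep_setD) auto
      also have "prob A * prob E * prob C = prob E * (prob A * prob C)" by simp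
      also have "prob A * prob C = prob (A \<inter> C)"
        by (intro indep_setD[OF indep, symmetric] A' C')
      finally have "prob (A \<inter> C \<inter> E) = prob E * prob (A \<inter> C)" .
      moreover have "A \<inter> C = A \<inter> C \<inter> space M"
        using A' S.space_closed by blast
      ultimately show "prob (A \<inter> C \<inter> E) = prob E * prob (A \<inter> C \<inter> space M)" by metis
    qed simp
    then show ?thesis
      using sets.sets_into_space[OF B] by (simp add: Int_absorb2 mult.commute)
  qed
  have "indep_set (sets (F s)) {?D -` A \<inter> space M | A. A \<in> sets borel}"
    using ind sets_F_subset[OF st(1)] DM by (intro indep_setI) auto
  then have "indep_set (sigma_sets (space M) (sets (F s)))
      (sigma_sets (space M) {?D -` A \<inter> space M | A. A \<in> sets borel})"
  proof (rule indep_set_sigma_sets)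
    show "Int_stable (sets (F s))" by (auto simp: Int_stable_def)
    show "Int_stable {?D -` A \<inter> space M | A. A \<in> sets borel}"
    proof (rule Int_stableI)
      fix a b assume "a \<in> {?D -` A \<inter> space M | A. A \<in> sets borel}"
        "b \<in> {?D -` A \<inter> space M | A. A \<in> sets borel}"
      then obtain A B where "a = ?D -` A \<inter> space M" "b = ?D -` B \<inter> space M"
        "A \<in> sets borel" "B \<in> sets borel" by blast
      then have "a \<inter> b = ?D -` (A \<inter> B) \<inter> space M" "A \<inter> B \<in> sets borel" by auto
      then show "a \<inter> b \<in> {?D -` A \<inter> space M | A. A \<in> sets borel}" by blast
    qed
  qed
  then show "indep_set (sigma_sets (space M) {f -` A \<inter> space M |A. A \<in> sets N})
     (sigma_sets (space M) {?D -` A \<inter> space M |A. A \<in> sets borel})"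
    unfolding indep_set_def
  proof (rule indep_sets_mono_sets)
    fix b :: bool
    have "{f -` A \<inter> space M |A. A \<in> sets N} \<subseteq> sets (F s)"
      using f by (auto simp: measurable_def)
    then show "(case b of True \<Rightarrow> sigma_sets (space M) {f -` A \<inter> space M |A. A \<in> sets N}
        | False \<Rightarrow> sigma_sets (space M) {?D -` A \<inter> space M |A. A \<in> sets borel})
      \<subseteq> (case b of True \<Rightarrow> sigma_sets (space M) (sets (F s))
        | False \<Rightarrow> sigma_sets (space M) {?D -` A \<inter> space M |A. A \<in> sets borel})"
      by (cases b) (auto intro!: sigma_sets_mono' simp del: sets_F)
  qed
qed

lemma increment_moments:
  assumes st: "0 \<le> s" "s \<le> t"
  shows "integrable M (\<lambda>\<omega>. W t \<omega> - W s \<omega>)"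
    and "expectation (\<lambda>\<omega>. W t \<omega> - W s \<omega>) = 0"
    and "integrable M (\<lambda>\<omega>. (W t \<omega> - W s \<omega>)\<^sup>2)"
    and "expectation (\<lambda>\<omega>. (W t \<omega> - W s \<omega>)\<^sup>2) = t - s"
proof -
  let ?D = "\<lambda>\<omega>. W t \<omega> - W s \<omega>"
  have "integrable M ?D \<and> expectation ?D = 0 \<and> integrable M (\<lambda>\<omega>. (?D \<omega>)\<^sup>2) \<and>
    expectation (\<lambda>\<omega>. (?D \<omega>)\<^sup>2) = t - s"
  \<comment> \<open>The normal law of the model requires \<open>s < t\<close>; for
    \<open>s = t\<close> the increment is identically 0.\<close>
  proof (cases "s = t")
    case False
    then have s: "s < t" "0 < sqrt (t - s)" using st by auto
    note d = increment_distributed[OF st(1) s(1)]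
    have 1: "integrable M ?D"
      using distributed_integrable[OF d, of "\<lambda>x. x"] integrable_normal_moment[OF s(2), of 0 1]
      by simp
    have 2: "integrable M (\<lambda>\<omega>. (?D \<omega>)\<^sup>2)"
      using distributed_integrable[OF d, of "\<lambda>x. x\<^sup>2"] integrable_normal_moment[OF s(2), of 0 2]
      by simp
    have 3: "expectation ?D = 0"
      using normal_distributed_expectation[OF s(2) d] .
    have "variance ?D = (sqrt (t - s))\<^sup>2"
      using normal_distributed_variance[OF s(2) d] .
    then show ?thesis using 1 2 3 s by simp
  qed simp
  then show "integrable M ?D" "expectation ?D = 0" "integrable M (\<lambda>\<omega>. (?D \<omega>)\<^sup>2)"
    "expectation (\<lambda>\<omega>. (?D \<omega>)\<^sup>2) = t - s" by auto
qed

lemma increment_product: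
  fixes f :: "'a \<Rightarrow> real"
  assumes st: "0 \<le> s" "s \<le> t" and f: "f \<in> borel_measurable (F s)" "integrable M f"
  shows "integrable M (\<lambda>\<omega>. f \<omega> * (W t \<omega> - W s \<omega>))"
    and "expectation (\<lambda>\<omega>. f \<omega> * (W t \<omega> - W s \<omega>)) = 0"
    and "integrable M (\<lambda>\<omega>. f \<omega> * (W t \<omega> - W s \<omega>)\<^sup>2)"
    and "expectation (\<lambda>\<omega>. f \<omega> * (W t \<omega> - W s \<omega>)\<^sup>2) = expectation f * (t - s)"
proof -
  let ?D = "\<lambda>\<omega>. W t \<omega> - W s \<omega>"
  note m = increment_moments[OF st]
  have "integrable M (\<lambda>\<omega>. f \<omega> * ?D \<omega>) \<and> expectation (\<lambda>\<omega>. f \<omega> * ?D \<omega>) = 0 \<and>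
    integrable M (\<lambda>\<omega>. f \<omega> * (?D \<omega>)\<^sup>2) \<and> expectation (\<lambda>\<omega>. f \<omega> * (?D \<omega>)\<^sup>2) = expectation f * (t - s)"
  proof (cases "s = t")
    case False
    then have s: "s < t" using st by auto
    note i1 = increment_indep[OF st(1) s f(1)]
    have i2: "indep_var borel f borel (\<lambda>\<omega>. (?D \<omega>)\<^sup>2)"
      using indep_var_compose[OF i1, of "\<lambda>x. x" borel "\<lambda>x. x\<^sup>2" borel] by (simp add: comp_def)
    show ?thesis
      using indep_var_integrable[OF i1 f(2) m(1)] indep_var_lebesgue_integral[OF i1 f(2) m(1)]
        indep_var_integrable[OF i2 f(2) m(3)] indep_var_lebesgue_integral[OF i2 f(2) m(3)] m
      by simp
  qed simp
  then show "integrable M (\<lambda>\<omega>. f \<omega> * ?D \<omega>)" "expectation (\<lambda>\<omega>. f \<omega> * ?D \<omega>) = 0"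
    "integrable M (\<lambda>\<omega>. f \<omega> * (?D \<omega>)\<^sup>2)" "expectation (\<lambda>\<omega>. f \<omega> * (?D \<omega>)\<^sup>2) = expectation f * (t - s)"
    by auto
qed

end

section \<open>The Ito isometry for elementary integrands\<close>

context prob_space
begin

definition square_integrable :: "('a \<Rightarrow> real) \<Rightarrow> bool" where
  "square_integrable f \<longleftrightarrow> f \<in> borel_measurable M \<and> integrable M (\<lambda>\<omega>. (f \<omega>)\<^sup>2)"

lemma square_integrable_measurable: "square_integrable f \<Longrightarrow> f \<in> borel_measurable M"
  by (simp add: square_integrable_def)

lemma square_integrable_square: "square_integrable f \<Longrightarrow> integrable M (\<lambda>\<omega>. (f \<omega>)\<^sup>2)"
  by (simp add: square_integrable_def)

lemma integrable_mult_square_integrable: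
  assumes "square_integrable f" "square_integrable g"
  shows "integrable M (\<lambda>\<omega>. f \<omega> * g \<omega>)"
proof (rule Bochner_Integration.integrable_bound)
  show "integrable M (\<lambda>\<omega>. (f \<omega>)\<^sup>2 + (g \<omega>)\<^sup>2)"
    using assms by (auto simp: square_integrable_def)
  have "\<bar>x * y\<bar> \<le> x\<^sup>2 + y\<^sup>2" for x y :: real
  proof -
    have "0 \<le> \<bar>x\<bar> * \<bar>y\<bar>" "(\<bar>x\<bar>)\<^sup>2 = x\<^sup>2" "(\<bar>y\<bar>)\<^sup>2 = y\<^sup>2" by simp_all
    then show ?thesis
      using sum_squares_bound[of "\<bar>x\<bar>" "\<bar>y\<bar>"] unfolding abs_mult by linarith
  qed
  then show "AE \<omega> in M. norm (f \<omega> * g \<omega>) \<le> norm ((f \<omega>)\<^sup>2 + (g \<omega>)\<^sup>2)"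
    by (intro always_eventually) (auto intro: order_trans abs_ge_self)
qed (use assms in \<open>auto simp: square_integrable_def\<close>)

lemma square_integrable_bounded:
  assumes "f \<in> borel_measurable M" "\<And>\<omega>. \<omega> \<in> space M \<Longrightarrow> \<bar>f \<omega>\<bar> \<le> C"
  shows "square_integrable f"
  unfolding square_integrable_def
proof
  have "(f \<omega>)\<^sup>2 \<le> C\<^sup>2" if "\<omega> \<in> space M" for \<omega>
    using power_mono[OF assms(2)[OF that], of 2] by simp
  then show "integrable M (\<lambda>\<omega>. (f \<omega>)\<^sup>2)"
    using assms(1) by (intro integrable_const_bound[of _ "C\<^sup>2"]) auto
qed fact

lemma square_integrable_integrable: "square_integrable f \<Longrightarrow> integrable M f"
  using integrable_mult_square_integrable[of f "\<lambda>_. 1"] square_integrable_bounded[of "\<lambda>_. 1" 1]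
  by simp

lemma square_integrable_add:
  assumes "square_integrable f" "square_integrable g"
  shows "square_integrable (\<lambda>\<omega>. f \<omega> + g \<omega>)"
proof -
  have "(\<lambda>\<omega>. (f \<omega> + g \<omega>)\<^sup>2) = (\<lambda>\<omega>. (f \<omega>)\<^sup>2 + (g \<omega>)\<^sup>2 + 2 * (f \<omega> * g \<omega>))"
    by (auto simp: power2_sum)
  then show ?thesis
    using assms integrable_mult_square_integrable[OF assms] by (auto simp: square_integrable_def)
qed

lemma square_integrable_bounded_mult:
  assumes f: "f \<in> borel_measurable M" "\<And>\<omega>. \<omega> \<in> space M \<Longrightarrow> \<bar>f \<omega>\<bar> \<le> C"
    and g: "square_integrable g"
  shows "square_integrable (\<lambda>\<omega>. f \<omega> * g \<omega>)"
  unfolding square_integrable_def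
proof
  show "integrable M (\<lambda>\<omega>. (f \<omega> * g \<omega>)\<^sup>2)"
  proof (rule Bochner_Integration.integrable_bound)
    show "integrable M (\<lambda>\<omega>. C\<^sup>2 * (g \<omega>)\<^sup>2)"
      using g by (auto simp: square_integrable_def)
    have "(f \<omega>)\<^sup>2 \<le> C\<^sup>2" if "\<omega> \<in> space M" for \<omega>
      using power_mono[OF f(2)[OF that], of 2] by simp
    then show "AE \<omega> in M. norm ((f \<omega> * g \<omega>)\<^sup>2) \<le> norm (C\<^sup>2 * (g \<omega>)\<^sup>2)"
      by (auto simp: power_mult_distrib intro!: mult_right_mono)
  qed (use f g in \<open>auto simp: square_integrable_def\<close>)
qed (use f g in \<open>auto simp: square_integrable_def\<close>)

lemma square_integrable_cmult: "square_integrable f \<Longrightarrow> square_integrable (\<lambda>\<omega>. c * f \<omega>)"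
  using square_integrable_bounded_mult[of "\<lambda>_. c" "\<bar>c\<bar>" f] by simp

lemma square_integrable_diff:
  "square_integrable f \<Longrightarrow> square_integrable g \<Longrightarrow> square_integrable (\<lambda>\<omega>. f \<omega> - g \<omega>)"
  using square_integrable_add[OF _ square_integrable_cmult[of g "-1"], of f] by simp

lemma square_integrable_const: "square_integrable (\<lambda>_. c)"
  by (rule square_integrable_bounded[of _ "\<bar>c\<bar>"]) auto

lemma square_integrable_sum:
  "(\<And>k. k \<in> I \<Longrightarrow> square_integrable (f k)) \<Longrightarrow> square_integrable (\<lambda>\<omega>. \<Sum>k\<in>I. f k \<omega>)"
  by (induction I rule: infinite_finite_induct)
     (auto intro: square_integrable_add square_integrable_const)

lemma square_integrable_difference:
  assumes f: "f \<in> borel_measurable M" and g: "square_integrable g"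
    and fin: "(\<integral>\<^sup>+\<omega>. ennreal ((f \<omega> - g \<omega>)\<^sup>2) \<partial>M) < \<infinity>"
  shows "square_integrable f"
proof -
  have "square_integrable (\<lambda>\<omega>. f \<omega> - g \<omega>)"
    unfolding square_integrable_def
    using f square_integrable_measurable[OF g] fin by (auto intro!: integrableI_bounded)
  from square_integrable_add[OF this g] show ?thesis by simp
qed

text \<open>A weighted Young inequality in place of Cauchy-Schwarz. The weight is free: with
  \<open>K\<close> fixed the second term can be sent to 0, and \<open>K\<close> is made small
  afterwards.\<close>

lemma expectation_product_le:
  assumes f: "square_integrable f" and g: "square_integrable g" and K: "K > 0"
  shows "\<bar>expectation (\<lambda>\<omega>. f \<omega> * g \<omega>)\<bar> \<le> K * expectation (\<lambda>\<omega>. (f \<omega>)\<^sup>2) + expectation (\<lambda>\<omega>. (g \<omega>)\<^sup>2) / K"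
proof -
  have pt: "\<bar>x * y\<bar> \<le> K * x\<^sup>2 + y\<^sup>2 / K" for x y :: real
  proof -
    have "0 \<le> (K * \<bar>x\<bar> - \<bar>y\<bar>)\<^sup>2" by simp
    then have "2 * (\<bar>x\<bar> * \<bar>y\<bar>) * K \<le> K\<^sup>2 * x\<^sup>2 + y\<^sup>2"
      by (simp add: power2_eq_square algebra_simps)
    moreover have "0 \<le> \<bar>x\<bar> * \<bar>y\<bar> * K" using K by simp
    ultimately have "\<bar>x * y\<bar> * K \<le> K\<^sup>2 * x\<^sup>2 + y\<^sup>2" unfolding abs_mult by linarith
    then show ?thesis using K by (simp add: field_simps power2_eq_square)
  qed
  have "\<bar>expectation (\<lambda>\<omega>. f \<omega> * g \<omega>)\<bar> \<le> expectation (\<lambda>\<omega>. \<bar>f \<omega> * g \<omega>\<bar>)"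
    by (rule integral_abs_bound)
  also have "\<dots> \<le> expectation (\<lambda>\<omega>. K * (f \<omega>)\<^sup>2 + (g \<omega>)\<^sup>2 / K)"
    using f g pt integrable_mult_square_integrable[OF f g]
    by (intro integral_mono) (auto simp: square_integrable_def)
  also have "\<dots> = K * expectation (\<lambda>\<omega>. (f \<omega>)\<^sup>2) + expectation (\<lambda>\<omega>. (g \<omega>)\<^sup>2) / K"
    using f g by (simp add: square_integrable_def)
  finally show ?thesis .
qed

lemma integrable_indicator_mult:
  fixes f :: "'a \<Rightarrow> real"
  shows "B \<in> events \<Longrightarrow> integrable M f \<Longrightarrow> integrable M (\<lambda>\<omega>. indicator B \<omega> * f \<omega>)"
  using integrable_mult_indicator[of B M f] by simp

end

lemma elementary_integrandD:
  assumes "elementary_integrand P G n p \<xi>"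
  shows "\<And>k. k < n \<Longrightarrow> p k \<le> p (Suc k)"
    and "\<And>k. k < n \<Longrightarrow> \<xi> k \<in> borel_measurable (G (p k))"
    and "\<And>k. k < n \<Longrightarrow> \<exists>C. \<forall>\<omega>\<in>space P. \<bar>\<xi> k \<omega>\<bar> \<le> C"
    and "\<And>k. k \<le> n \<Longrightarrow> 0 \<le> p k"
proof -
  show p: "p k \<le> p (Suc k)" if "k < n" for k
    using assms that by (simp add: elementary_integrand_def)
  show "\<xi> k \<in> borel_measurable (G (p k))" "\<exists>C. \<forall>\<omega>\<in>space P. \<bar>\<xi> k \<omega>\<bar> \<le> C" if "k < n" for k
    using assms that by (simp_all add: elementary_integrand_def)
  show "0 \<le> p k" if "k \<le> n" for k
    using that
  proof (induction k)
    case 0 then show ?case using assms by (simp add: elementary_integrand_def)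
  next
    case (Suc k) then show ?case using p[of k] by auto
  qed
qed

lemma ennreal_square_triangle:
  fixes x y z :: real
  shows "ennreal ((x - z)\<^sup>2) \<le> 2 * ennreal ((x - y)\<^sup>2) + 2 * ennreal ((y - z)\<^sup>2)"
proof -
  have "(x - z)\<^sup>2 \<le> 2 * (x - y)\<^sup>2 + 2 * (y - z)\<^sup>2"
    using sum_squares_bound[of "x - y" "y - z"] by (simp add: power2_eq_square algebra_simps)
  then have "ennreal ((x - z)\<^sup>2) \<le> ennreal (2 * (x - y)\<^sup>2 + 2 * (y - z)\<^sup>2)"
    by (rule ennreal_leI)
  also have "\<dots> = 2 * ennreal ((x - y)\<^sup>2) + 2 * ennreal ((y - z)\<^sup>2)"
    by (simp add: ennreal_plus ennreal_mult)
  finally show ?thesis .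
qed

section \<open>Orthogonality of weighted increments and the isometry\<close>

context switching_law
begin

lemma square_integrable_increment:
  "0 \<le> s \<Longrightarrow> s \<le> t \<Longrightarrow> square_integrable (\<lambda>\<omega>. W t \<omega> - W s \<omega>)"
  unfolding square_integrable_def using increment_moments(3) increment_measurable by auto

lemma square_integrable_mult_increment:
  assumes "0 \<le> a" "a \<le> b" "\<xi> \<in> borel_measurable (F c)" "0 \<le> c" "\<And>\<omega>. \<omega> \<in> space M \<Longrightarrow> \<bar>\<xi> \<omega>\<bar> \<le> C"
  shows "square_integrable (\<lambda>\<omega>. \<xi> \<omega> * (W b \<omega> - W a \<omega>))"
  using assms measurable_F_M[OF assms(3,4)]
  by (intro square_integrable_bounded_mult[of _ C] square_integrable_increment) auto

text \<open>Both coefficients are known at \<open>c\<close>, the later left endpoint. An increment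
  that begins when the remaining factors are known has mean 0, so only the square of the increment
  over the overlap contributes.\<close>

lemma expectation_increment_pair_aux:
  assumes ab: "0 \<le> a" "a \<le> b" and cd: "c \<le> d" and ac: "a \<le> c"
    and \<xi>: "\<xi> \<in> borel_measurable (F a)" "\<And>\<omega>. \<omega> \<in> space M \<Longrightarrow> \<bar>\<xi> \<omega>\<bar> \<le> C"
    and \<eta>: "\<eta> \<in> borel_measurable (F c)" "\<And>\<omega>. \<omega> \<in> space M \<Longrightarrow> \<bar>\<eta> \<omega>\<bar> \<le> C'"
  shows "expectation (\<lambda>\<omega>. (\<xi> \<omega> * (W b \<omega> - W a \<omega>)) * (\<eta> \<omega> * (W d \<omega> - W c \<omega>)))
    = expectation (\<lambda>\<omega>. \<xi> \<omega> * \<eta> \<omega>) * measure lborel ({a<..b} \<inter> {c<..d})"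
proof -
  define \<zeta> where "\<zeta> \<omega> = \<xi> \<omega> * \<eta> \<omega>" for \<omega>
  have c0: "0 \<le> c" using ab ac by simp
  have \<zeta>F: "\<zeta> \<in> borel_measurable (F e)" if "c \<le> e" for e
    unfolding \<zeta>_def using ac that
    by (intro borel_measurable_times measurable_F_mono[OF \<xi>(1)] measurable_F_mono[OF \<eta>(1)]) auto
  have \<zeta>b: "\<bar>\<zeta> \<omega>\<bar> \<le> C * C'" if "\<omega> \<in> space M" for \<omega>
    unfolding \<zeta>_def abs_mult using \<xi>(2)[OF that] \<eta>(2)[OF that] by (intro mult_mono) auto
  note \<zeta>M = measurable_F_M[OF \<zeta>F[OF order_refl] c0]
  have \<zeta>i: "integrable M \<zeta>"
    using \<zeta>b \<zeta>M by (intro integrable_const_bound[of _ "C * C'"]) auto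
  \<comment> \<open>One statement for all cross terms: at time \<open>x\<close> both
    \<open>\<zeta>\<close> and the earlier increment are known.\<close>
  have zero: "integrable M (\<lambda>\<omega>. \<zeta> \<omega> * (W v \<omega> - W u \<omega>) * (W y \<omega> - W x \<omega>)) \<and>
      expectation (\<lambda>\<omega>. \<zeta> \<omega> * (W v \<omega> - W u \<omega>) * (W y \<omega> - W x \<omega>)) = 0"
    if "0 \<le> u" "u \<le> v" "v \<le> x" "x \<le> y" "c \<le> x" for u v x y
  proof -
    have "(\<lambda>\<omega>. \<zeta> \<omega> * (W v \<omega> - W u \<omega>)) \<in> borel_measurable (F x)"
      using that by (intro borel_measurable_times \<zeta>F borel_measurable_diff W_measurable_F) auto
    moreover have "integrable M (\<lambda>\<omega>. \<zeta> \<omega> * (W v \<omega> - W u \<omega>))"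
      using that \<zeta>b by (intro square_integrable_integrable
        square_integrable_mult_increment[OF _ _ \<zeta>F[OF order_refl] c0]) auto
    ultimately show ?thesis
      using increment_product(1,2)[of x y "\<lambda>\<omega>. \<zeta> \<omega> * (W v \<omega> - W u \<omega>)"] that by auto
  qed
  show ?thesis
  proof (cases "b \<le> c")
    case True
    have "{a<..b} \<inter> {c<..d} = {}" using True by auto
    then have len: "measure lborel ({a<..b} \<inter> {c<..d}) = 0" by (simp only: measure_empty)
    have "expectation (\<lambda>\<omega>. \<zeta> \<omega> * (W b \<omega> - W a \<omega>) * (W d \<omega> - W c \<omega>)) = 0"
      using zero[of a b c d] ab cd True by auto
    then show ?thesis unfolding len by (simp add: \<zeta>_def mult_ac)
  next
    case False
    \<comment> \<open>The overlap is \<open>(c, e]\<close>. Both increments are split at its ends;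
      since \<open>e\<close> is \<open>b\<close> or \<open>d\<close>, one of the last two terms of
      \<open>split\<close> is 0.\<close>
    define e where "e = min b d"
    have e: "c \<le> e" "e \<le> b" "e \<le> d" "e = b \<or> e = d" using False cd by (auto simp: e_def)
    have "{a<..b} \<inter> {c<..d} = {c<..e}" using ac by (auto simp: e_def)
    then have len: "measure lborel ({a<..b} \<inter> {c<..d}) = e - c" using e by simp
    have split: "(\<xi> \<omega> * (W b \<omega> - W a \<omega>)) * (\<eta> \<omega> * (W d \<omega> - W c \<omega>))
        = \<zeta> \<omega> * (W c \<omega> - W a \<omega>) * (W d \<omega> - W c \<omega>) + \<zeta> \<omega> * (W e \<omega> - W c \<omega>)\<^sup>2
          + (\<zeta> \<omega> * (W e \<omega> - W c \<omega>) * (W d \<omega> - W e \<omega>)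
            + \<zeta> \<omega> * (W e \<omega> - W c \<omega>) * (W b \<omega> - W e \<omega>))" for \<omega>
      using e(4) by (auto simp: \<zeta>_def power2_eq_square algebra_simps)
    show ?thesis
      unfolding split len
      using zero[of a c c d] zero[of c e e d] zero[of c e e b] ab ac cd c0 e
        increment_product(3,4)[OF c0 e(1) \<zeta>F[OF order_refl] \<zeta>i]
      by (simp add: \<zeta>_def[symmetric])
  qed
qed

lemma expectation_increment_pair:
  assumes ab: "0 \<le> a" "a \<le> b" and cd: "0 \<le> c" "c \<le> d"
    and \<xi>: "\<xi> \<in> borel_measurable (F a)" "\<And>\<omega>. \<omega> \<in> space M \<Longrightarrow> \<bar>\<xi> \<omega>\<bar> \<le> C"
    and \<eta>: "\<eta> \<in> borel_measurable (F c)" "\<And>\<omega>. \<omega> \<in> space M \<Longrightarrow> \<bar>\<eta> \<omega>\<bar> \<le> C'"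
  shows "expectation (\<lambda>\<omega>. (\<xi> \<omega> * (W b \<omega> - W a \<omega>)) * (\<eta> \<omega> * (W d \<omega> - W c \<omega>)))
    = expectation (\<lambda>\<omega>. \<xi> \<omega> * \<eta> \<omega>) * measure lborel ({a<..b} \<inter> {c<..d})"
proof (cases "a \<le> c")
  case True
  then show ?thesis by (rule expectation_increment_pair_aux[OF ab cd(2) _ \<xi> \<eta>])
next
  case False
  then have "c \<le> a" by simp
  from expectation_increment_pair_aux[OF cd ab(2) this \<eta> \<xi>]
  show ?thesis by (simp add: mult_ac Int_commute)
qed

text \<open>Both sides are the same double sum, in which a pair of terms is weighted by the length
  of the overlap of its intervals. Intervals may overlap arbitrarily, so that a difference of two
  elementary integrals is covered without a common refinement.\<close>

lemma ito_isometry_elementary: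
  fixes a b :: "'i \<Rightarrow> real" and \<xi> :: "'i \<Rightarrow> 'a \<Rightarrow> real"
  assumes I: "finite I"
    and ab: "\<And>k. k \<in> I \<Longrightarrow> 0 \<le> a k" "\<And>k. k \<in> I \<Longrightarrow> a k \<le> b k"
    and \<xi>: "\<And>k. k \<in> I \<Longrightarrow> \<xi> k \<in> borel_measurable (F (a k))"
    and bd: "\<And>k. k \<in> I \<Longrightarrow> \<exists>C. \<forall>\<omega>\<in>space M. \<bar>\<xi> k \<omega>\<bar> \<le> C"
  shows "square_integrable (\<lambda>\<omega>. \<Sum>k\<in>I. \<xi> k \<omega> * (W (b k) \<omega> - W (a k) \<omega>))"
    and "(\<integral>\<^sup>+\<omega>. ennreal ((\<Sum>k\<in>I. \<xi> k \<omega> * (W (b k) \<omega> - W (a k) \<omega>))\<^sup>2) \<partial>M)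
      = (\<integral>\<^sup>+\<omega>. (\<integral>\<^sup>+s. ennreal ((\<Sum>k\<in>I. \<xi> k \<omega> * indicator {a k<..b k} s)\<^sup>2) \<partial>lborel) \<partial>M)"
proof -
  obtain C where C: "\<And>k \<omega>. k \<in> I \<Longrightarrow> \<omega> \<in> space M \<Longrightarrow> \<bar>\<xi> k \<omega>\<bar> \<le> C k"
    using bd by metis
  define X where "X k \<omega> = \<xi> k \<omega> * (W (b k) \<omega> - W (a k) \<omega>)" for k \<omega>
  have \<xi>M: "\<xi> k \<in> borel_measurable M" if "k \<in> I" for k
    using measurable_F_M[OF \<xi>[OF that] ab(1)[OF that]] .
  have \<xi>2: "square_integrable (\<xi> k)" if "k \<in> I" for k
    using \<xi>M[OF that] C[OF that] by (rule square_integrable_bounded)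
  have X2: "square_integrable (X k)" if "k \<in> I" for k
    unfolding X_def
    by (rule square_integrable_mult_increment[OF ab[OF that] \<xi>[OF that] ab(1)[OF that] C[OF that]])
  show S: "square_integrable (\<lambda>\<omega>. \<Sum>k\<in>I. \<xi> k \<omega> * (W (b k) \<omega> - W (a k) \<omega>))"
    using square_integrable_sum[of I X, OF X2] by (simp add: X_def)
  have "(\<integral>\<^sup>+\<omega>. ennreal ((\<Sum>k\<in>I. X k \<omega>)\<^sup>2) \<partial>M) = ennreal (expectation (\<lambda>\<omega>. (\<Sum>k\<in>I. X k \<omega>)\<^sup>2))"
    using S by (intro nn_integral_eq_integral) (auto simp: square_integrable_def X_def)
  also have "expectation (\<lambda>\<omega>. (\<Sum>k\<in>I. X k \<omega>)\<^sup>2) = expectation (\<lambda>\<omega>. \<Sum>k\<in>I. \<Sum>l\<in>I. X k \<omega> * X l \<omega>)"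
    by (simp add: power2_eq_square sum_product)
  also have "\<dots> = (\<Sum>k\<in>I. \<Sum>l\<in>I. expectation (\<lambda>\<omega>. X k \<omega> * X l \<omega>))"
    using X2 by (subst Bochner_Integration.integral_sum)
      (auto intro!: integrable_mult_square_integrable Bochner_Integration.integrable_sum
        sum.cong Bochner_Integration.integral_sum)
  also have "\<dots> = (\<Sum>k\<in>I. \<Sum>l\<in>I. expectation (\<lambda>\<omega>. \<xi> k \<omega> * \<xi> l \<omega>) *
      measure lborel ({a k<..b k} \<inter> {a l<..b l}))"
    unfolding X_def
    by (intro sum.cong refl expectation_increment_pair[OF _ _ _ _ _ C _ C] ab \<xi>) auto
  also have "\<dots> = expectation (\<lambda>\<omega>. \<Sum>k\<in>I. \<Sum>l\<in>I. \<xi> k \<omega> * \<xi> l \<omega> *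
      measure lborel ({a k<..b k} \<inter> {a l<..b l}))"
  proof -
    have "integrable M (\<lambda>\<omega>. \<xi> k \<omega> * \<xi> l \<omega> * c)" if "k \<in> I" "l \<in> I" for k l c
      by (rule integrable_mult_left)
        (use that in \<open>auto intro: integrable_mult_square_integrable \<xi>2\<close>)
    then show ?thesis
      by (simp add: Bochner_Integration.integral_sum)
  qed
  also have "ennreal \<dots> = (\<integral>\<^sup>+\<omega>. ennreal (\<Sum>k\<in>I. \<Sum>l\<in>I. \<xi> k \<omega> * \<xi> l \<omega> *
      measure lborel ({a k<..b k} \<inter> {a l<..b l})) \<partial>M)"
    (is "ennreal (expectation ?Q) = _")
  proof (rule nn_integral_eq_integral[symmetric])
    show "integrable M ?Q"
      by (intro Bochner_Integration.integrable_sum integrable_mult_left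
        integrable_mult_square_integrable \<xi>2)
    have "?Q \<omega> = (\<integral>s. (\<Sum>k\<in>I. \<xi> k \<omega> * indicator {a k<..b k} s)\<^sup>2 \<partial>lborel)" for \<omega>
    proof -
      have "(\<lambda>s. (\<Sum>k\<in>I. \<xi> k \<omega> * indicator {a k<..b k} s)\<^sup>2)
        = (\<lambda>s. \<Sum>k\<in>I. \<Sum>l\<in>I. (\<xi> k \<omega> * \<xi> l \<omega>) * indicator ({a k<..b k} \<inter> {a l<..b l}) s :: real)"
        by (simp add: power2_eq_square sum_product indicator_inter_arith mult_ac del: Int_greaterThanAtMost)
      moreover have "emeasure lborel ({a k<..b k} \<inter> {a l<..b l}) < \<infinity>" for k l
        by (rule le_less_trans[OF emeasure_mono[of _ "{a k..b k}"]]) (auto simp: emeasure_lborel_Icc_eq)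
      ultimately show ?thesis
        by (simp add: Bochner_Integration.integral_sum)
    qed
    then show "AE \<omega> in M. 0 \<le> ?Q \<omega>" by simp
  qed
  also have "\<dots> = (\<integral>\<^sup>+\<omega>. (\<integral>\<^sup>+s. ennreal ((\<Sum>k\<in>I. \<xi> k \<omega> * indicator {a k<..b k} s)\<^sup>2) \<partial>lborel) \<partial>M)"
  proof (rule nn_integral_cong)
    fix \<omega> assume "\<omega> \<in> space M"
    have eq: "(\<lambda>s. (\<Sum>k\<in>I. \<xi> k \<omega> * indicator {a k<..b k} s)\<^sup>2)
      = (\<lambda>s. \<Sum>k\<in>I. \<Sum>l\<in>I. (\<xi> k \<omega> * \<xi> l \<omega>) * indicator ({a k<..b k} \<inter> {a l<..b l}) s :: real)"
      by (simp add: power2_eq_square sum_product indicator_inter_arith mult_ac del: Int_greaterThanAtMost)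
    have fin: "emeasure lborel ({a k<..b k} \<inter> {a l<..b l}) < \<infinity>" for k l
      by (rule le_less_trans[OF emeasure_mono[of _ "{a k..b k}"]]) (auto simp: emeasure_lborel_Icc_eq)
    have int: "integrable lborel (\<lambda>s. (\<Sum>k\<in>I. \<xi> k \<omega> * indicator {a k<..b k} s)\<^sup>2)"
      unfolding eq using fin by (auto intro!: Bochner_Integration.integrable_sum)
    have "(\<Sum>k\<in>I. \<Sum>l\<in>I. \<xi> k \<omega> * \<xi> l \<omega> * measure lborel ({a k<..b k} \<inter> {a l<..b l}))
      = (\<integral>s. (\<Sum>k\<in>I. \<xi> k \<omega> * indicator {a k<..b k} s)\<^sup>2 \<partial>lborel)"
      unfolding eq using fin by (simp add: Bochner_Integration.integral_sum)
    then show "ennreal (\<Sum>k\<in>I. \<Sum>l\<in>I. \<xi> k \<omega> * \<xi> l \<omega> * measure lborel ({a k<..b k} \<inter> {a l<..b l}))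
      = (\<integral>\<^sup>+s. ennreal ((\<Sum>k\<in>I. \<xi> k \<omega> * indicator {a k<..b k} s)\<^sup>2) \<partial>lborel)"
      using nn_integral_eq_integral[OF int] by simp
  qed
  finally show "(\<integral>\<^sup>+\<omega>. ennreal ((\<Sum>k\<in>I. \<xi> k \<omega> * (W (b k) \<omega> - W (a k) \<omega>))\<^sup>2) \<partial>M)
      = (\<integral>\<^sup>+\<omega>. (\<integral>\<^sup>+s. ennreal ((\<Sum>k\<in>I. \<xi> k \<omega> * indicator {a k<..b k} s)\<^sup>2) \<partial>lborel) \<partial>M)"
    unfolding X_def .
qed

text \<open>A cell that begins after \<open>T\<close> collapses to the point \<open>T\<close>, at
  which its coefficient need not be known. Replacing this coefficient by 0 restores adaptedness and
  changes neither the integral nor the process on \<open>[0, T]\<close>.\<close>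

lemma elementary_truncate:
  assumes T: "T \<ge> 0" and el: "elementary_integrand M F n p \<xi>"
  defines "a \<equiv> \<lambda>k. min (p k) T" and "b \<equiv> \<lambda>k. min (p (Suc k)) T"
    and "\<eta> \<equiv> \<lambda>k \<omega>. if p k \<le> T then \<xi> k \<omega> else 0"
  shows "\<And>k. k < n \<Longrightarrow> 0 \<le> a k" "\<And>k. k < n \<Longrightarrow> a k \<le> b k"
    and "\<And>k. k < n \<Longrightarrow> \<eta> k \<in> borel_measurable (F (a k))"
    and "\<And>k. k < n \<Longrightarrow> \<exists>C. \<forall>\<omega>\<in>space M. \<bar>\<eta> k \<omega>\<bar> \<le> C"
    and "elementary_integral W n p \<xi> T \<omega> = (\<Sum>k<n. \<eta> k \<omega> * (W (b k) \<omega> - W (a k) \<omega>))"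
    and "elementary_process n p \<xi> s \<omega> * indicator {0..T} s = (\<Sum>k<n. \<eta> k \<omega> * indicator {a k<..b k} s)"
proof -
  note p = elementary_integrandD(1-3)[OF el] and p0 = elementary_integrandD(4)[OF el]
  show "0 \<le> a k" if "k < n" for k using p0[of k] T that by (simp add: a_def)
  show "a k \<le> b k" if "k < n" for k using p(1)[OF that] by (simp add: a_def b_def)
  show "\<eta> k \<in> borel_measurable (F (a k))" if "k < n" for k
    using p(2)[OF that] by (cases "p k \<le> T") (auto simp: \<eta>_def a_def min_def)
  show "\<exists>C. \<forall>\<omega>\<in>space M. \<bar>\<eta> k \<omega>\<bar> \<le> C" if "k < n" for k
    using p(3)[OF that] by (cases "p k \<le> T") (auto simp: \<eta>_def)
  show "elementary_integral W n p \<xi> T \<omega> = (\<Sum>k<n. \<eta> k \<omega> * (W (b k) \<omega> - W (a k) \<omega>))"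
    unfolding elementary_integral_def
  proof (rule sum.cong)
    fix k assume "k \<in> {..<n}"
    then show "\<xi> k \<omega> * (W (min (p (Suc k)) T) \<omega> - W (min (p k) T) \<omega>) = \<eta> k \<omega> * (W (b k) \<omega> - W (a k) \<omega>)"
      using p(1)[of k] by (auto simp: \<eta>_def a_def b_def min_def)
  qed simp
  show "elementary_process n p \<xi> s \<omega> * indicator {0..T} s = (\<Sum>k<n. \<eta> k \<omega> * indicator {a k<..b k} s)"
    unfolding elementary_process_def sum_distrib_right
  proof (rule sum.cong)
    fix k assume "k \<in> {..<n}"
    then show "\<xi> k \<omega> * indicator {p k<..p (Suc k)} s * indicator {0..T} s = \<eta> k \<omega> * indicator {a k<..b k} s"
      using p0[of k] by (auto simp: \<eta>_def a_def b_def min_def indicator_def)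
  qed simp
qed

lemma square_integrable_elementary_integral:
  assumes "T \<ge> 0" "elementary_integrand M F n p \<xi>"
  shows "square_integrable (elementary_integral W n p \<xi> T)"
proof -
  note e = elementary_truncate[OF assms]
  have "elementary_integral W n p \<xi> T = (\<lambda>\<omega>. \<Sum>k<n. (if p k \<le> T then \<xi> k \<omega> else 0) *
      (W (min (p (Suc k)) T) \<omega> - W (min (p k) T) \<omega>))"
    using e(5) by blast
  then show ?thesis
    using ito_isometry_elementary(1)[of "{..<n}", OF _ e(1,2,3,4)] by simp
qed

lemma ito_isometry_difference:
  assumes T: "T \<ge> 0" and el: "elementary_integrand M F n p \<xi>" "elementary_integrand M F n' p' \<xi>'"
  shows "(\<integral>\<^sup>+\<omega>. ennreal ((elementary_integral W n p \<xi> T \<omega> - elementary_integral W n' p' \<xi>' T \<omega>)\<^sup>2) \<partial>M)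
    = (\<integral>\<^sup>+\<omega>. (\<integral>\<^sup>+s\<in>{0..T}. ennreal ((elementary_process n p \<xi> s \<omega> - elementary_process n' p' \<xi>' s \<omega>)\<^sup>2)
        \<partial>lborel) \<partial>M)"
proof -
  note e = elementary_truncate[OF T el(1)] and e' = elementary_truncate[OF T el(2)]
  \<comment> \<open>A disjoint sum of the two index sets; the second integrand enters with negated
    coefficients.\<close>
  define I where "I = {..<n} <+> {..<n'}"
  define a where "a = case_sum (\<lambda>k. min (p k) T) (\<lambda>k. min (p' k) T)"
  define b where "b = case_sum (\<lambda>k. min (p (Suc k)) T) (\<lambda>k. min (p' (Suc k)) T)"
  define \<eta> where "\<eta> = case_sum (\<lambda>k \<omega>. if p k \<le> T then \<xi> k \<omega> else 0)
    (\<lambda>k \<omega>. - (if p' k \<le> T then \<xi>' k \<omega> else 0))"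
  have I: "finite I" by (simp add: I_def)
  have 1: "0 \<le> a k" if "k \<in> I" for k
    using that e(1) e'(1) by (auto simp: I_def a_def)
  have 2: "a k \<le> b k" if "k \<in> I" for k
    using that e(2) e'(2) by (auto simp: I_def a_def b_def)
  have 3: "\<eta> k \<in> borel_measurable (F (a k))" if "k \<in> I" for k
    using that e(3) e'(3)[THEN borel_measurable_uminus] by (auto simp: I_def a_def \<eta>_def)
  have 4: "\<exists>C. \<forall>\<omega>\<in>space M. \<bar>\<eta> k \<omega>\<bar> \<le> C" if "k \<in> I" for k
    using that e(4) e'(4) by (auto simp: I_def \<eta>_def)
  have X: "(\<Sum>k\<in>I. \<eta> k \<omega> * (W (b k) \<omega> - W (a k) \<omega>))
      = elementary_integral W n p \<xi> T \<omega> - elementary_integral W n' p' \<xi>' T \<omega>" for \<omega>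
    unfolding e(5) e'(5) I_def
    by (subst sum.Plus) (auto simp: a_def b_def \<eta>_def sum_negf[symmetric] simp del: sum_negf)
  have Y: "(\<Sum>k\<in>I. \<eta> k \<omega> * indicator {a k<..b k} s)
      = (elementary_process n p \<xi> s \<omega> - elementary_process n' p' \<xi>' s \<omega>) * indicator {0..T} s" for \<omega> s
    unfolding left_diff_distrib e(6) e'(6) I_def
    by (subst sum.Plus) (simp_all add: a_def b_def \<eta>_def sum_negf)
  have "ennreal (((elementary_process n p \<xi> s \<omega> - elementary_process n' p' \<xi>' s \<omega>) * indicator {0..T} s)\<^sup>2)
     = ennreal ((elementary_process n p \<xi> s \<omega> - elementary_process n' p' \<xi>' s \<omega>)\<^sup>2) * indicator {0..T} s"
    for s \<omega> by (auto simp: indicator_def)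
  then show ?thesis
    using ito_isometry_elementary(2)[of I a b \<eta>, OF I 1 2 3 4] unfolding X Y by simp
qed

text \<open>Clipped to \<open>[s, t]\<close>, a cell begins at \<open>max (p k) s\<close>, where
  both \<open>f\<close> and its coefficient are known; the Brownian increment over the clipped cell
  then has mean 0.\<close>

lemma expectation_elementary_increment:
  assumes st: "0 \<le> s" "s \<le> t" and el: "elementary_integrand M F n p \<xi>"
    and f: "f \<in> borel_measurable (F s)" "square_integrable f"
  shows "expectation (\<lambda>\<omega>. f \<omega> * (elementary_integral W n p \<xi> t \<omega> - elementary_integral W n p \<xi> s \<omega>)) = 0"
proof -
  note p = elementary_integrandD(1-3)[OF el] and p0 = elementary_integrandD(4)[OF el]
  let ?d = "\<lambda>k \<omega>. f \<omega> * \<xi> k \<omega> * ((W (min (p (Suc k)) t) \<omega> - W (min (p k) t) \<omega>)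
      - (W (min (p (Suc k)) s) \<omega> - W (min (p k) s) \<omega>))"
  have main: "integrable M (?d k) \<and> expectation (?d k) = 0" if k: "k < n" for k
  proof (cases "p (Suc k) \<le> s \<or> t \<le> p k")
    case True
    have "?d k = (\<lambda>_. 0)"
    proof -
      have "(W (min (p (Suc k)) t) \<omega> - W (min (p k) t) \<omega>)
        - (W (min (p (Suc k)) s) \<omega> - W (min (p k) s) \<omega>) = 0" for \<omega>
        using True
      proof
        assume "p (Suc k) \<le> s"
        then show ?thesis using p(1)[OF k] st by (simp add: min_absorb1)
      next
        assume "t \<le> p k"
        then show ?thesis using p(1)[OF k] st by (simp add: min_absorb2)
      qed
      then show ?thesis by simp
    qed
    then show ?thesis by simp
  next
    case False
    define c where "c = max (p k) s"
    define d where "d = min (p (Suc k)) t"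
    have c: "0 \<le> c" "p k \<le> c" "s \<le> c" "c \<le> d"
      using False p(1)[OF k] st by (auto simp: c_def d_def)
    have "(W (min (p (Suc k)) t) \<omega> - W (min (p k) t) \<omega>)
      - (W (min (p (Suc k)) s) \<omega> - W (min (p k) s) \<omega>) = W d \<omega> - W c \<omega>" for \<omega>
      using False p(1)[OF k] st by (auto simp: min_def max_def c_def d_def)
    then have eq: "?d k = (\<lambda>\<omega>. f \<omega> * \<xi> k \<omega> * (W d \<omega> - W c \<omega>))" by simp
    obtain C where C: "\<And>\<omega>. \<omega> \<in> space M \<Longrightarrow> \<bar>\<xi> k \<omega>\<bar> \<le> C" using p(3)[OF k] by blast
    have \<xi>M: "\<xi> k \<in> borel_measurable M" using measurable_F_M[OF p(2)[OF k] p0] k by simp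
    have "(\<lambda>\<omega>. f \<omega> * \<xi> k \<omega>) \<in> borel_measurable (F c)"
      by (intro borel_measurable_times measurable_F_mono[OF f(1) c(3)] measurable_F_mono[OF p(2)[OF k] c(2)])
    moreover have "integrable M (\<lambda>\<omega>. f \<omega> * \<xi> k \<omega>)"
      by (rule integrable_mult_square_integrable[OF f(2) square_integrable_bounded[OF \<xi>M C]])
    ultimately show ?thesis unfolding eq using increment_product(1,2)[OF c(1,4)] by blast
  qed
  have "(\<lambda>\<omega>. f \<omega> * (elementary_integral W n p \<xi> t \<omega> - elementary_integral W n p \<xi> s \<omega>))
     = (\<lambda>\<omega>. \<Sum>k<n. ?d k \<omega>)"
    by (simp add: elementary_integral_def sum_subtractf[symmetric] sum_distrib_left algebra_simps)
  then show ?thesis using main by (simp add: Bochner_Integration.integral_sum)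
qed

end

section \<open>Paths of the chain\<close>

context switching_law
begin

definition regular :: "'a set" where
  "regular = {\<omega> \<in> space M. \<forall>t\<ge>0. continuous (at_right t) (\<lambda>s. \<epsilon> s \<omega>)}"

lemma regular_space: "\<omega> \<in> regular \<Longrightarrow> \<omega> \<in> space M"
  by (simp add: regular_def)

lemma AE_regular: "AE \<omega> in M. \<omega> \<in> regular"
  using chain AE_space by (auto simp: markov_chain_def regular_def elim: AE_mp)

lemma regular_F: "regular \<in> sets (F t)"
proof -
  have "space M - regular \<in> null_sets M"
  proof -
    have "{x \<in> space M. x \<notin> regular} = space M - regular" by auto
    then show ?thesis using AE_regular unfolding AE_iff_null_sets by simp
  qed
  then have "space (F t) - (space M - regular) \<in> sets (F t)"
    by (intro sets.compl_sets null_sets_F)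
  moreover have "space (F t) - (space M - regular) = regular"
    by (auto dest: regular_space)
  ultimately show ?thesis by simp
qed

lemma regular_right_constant:
  assumes "\<omega> \<in> regular" "0 \<le> t"
  obtains d where "d > 0" "\<And>s. t \<le> s \<Longrightarrow> s < t + d \<Longrightarrow> \<epsilon> s \<omega> = \<epsilon> t \<omega>"
proof -
  have "((\<lambda>s. \<epsilon> s \<omega>) \<longlongrightarrow> \<epsilon> t \<omega>) (at_right t)"
    using assms by (simp add: regular_def continuous_within)
  then have "\<forall>\<^sub>F s in at_right t. \<epsilon> s \<omega> = \<epsilon> t \<omega>"
    by (simp add: tendsto_discrete)
  then obtain b where b: "b > t" "\<And>s. t < s \<Longrightarrow> s < b \<Longrightarrow> \<epsilon> s \<omega> = \<epsilon> t \<omega>"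
    by (auto simp: eventually_at_right_field)
  show ?thesis
  proof
    show "b - t > 0" using b(1) by simp
    show "\<epsilon> s \<omega> = \<epsilon> t \<omega>" if "t \<le> s" "s < t + (b - t)" for s
      using b(2)[of s] that by (cases "s = t") auto
  qed
qed

text \<open>A version that is right-continuous on every path. Off \<open>regular\<close> it is
  frozen at an arbitrary state, and \<open>max 0 s\<close> avoids negative times, about which the
  model says nothing.\<close>

definition chain_path :: "real \<Rightarrow> 'a \<Rightarrow> nat" where
  "chain_path s \<omega> = (if \<omega> \<in> regular then \<epsilon> (max 0 s) \<omega> else 1)"

lemma chain_path_measurable_F: "0 \<le> t \<Longrightarrow> s \<le> t \<Longrightarrow> chain_path s \<in> measurable (F t) (count_space UNIV)"
  unfolding chain_path_def using sets.Int[OF regular_F[of t] sets.top[of "F t"]]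
  by (intro measurable_If_set measurable_const \<epsilon>_measurable_F) auto

lemma chain_path_cases: "chain_path s \<omega> = 1 \<or> chain_path s \<omega> = 2"
  unfolding chain_path_def using \<epsilon>_cases[of "max 0 s" \<omega>] regular_space by auto

text \<open>Progressive measurability: times are rounded up to a grid, and by right-continuity the
  approximations eventually equal the limit. The cap \<open>min t\<close> keeps the rounded times
  from looking beyond \<open>t\<close>.\<close>

lemma chain_path_jointly_measurable:
  fixes f :: "nat \<Rightarrow> real"
  assumes t: "0 \<le> t"
  shows "(\<lambda>(\<omega>, u). f (chain_path (min t u) \<omega>)) \<in> borel_measurable (F t \<Otimes>\<^sub>M lborel)"
proof (rule borel_measurable_LIMSEQ_real)
  \<comment> \<open>Floor plus 1 lies strictly above the rounded time, also at grid points, and at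
    most one step \<open>1 / (n + 1)\<close> beyond it.\<close>
  define r where "r n u = (real_of_int \<lfloor>real (Suc n) * max 0 u\<rfloor> + 1) / real (Suc n)" for n u
  have r: "max 0 u < r n u" "r n u \<le> max 0 u + 1 / real (Suc n)" for n u
  proof -
    have "real (Suc n) * max 0 u < real_of_int \<lfloor>real (Suc n) * max 0 u\<rfloor> + 1" by linarith
    then show "max 0 u < r n u" unfolding r_def by (subst pos_less_divide_eq) (simp_all add: mult.commute del: max_less_iff_conj)
    have "real_of_int \<lfloor>real (Suc n) * max 0 u\<rfloor> + 1 \<le> real (Suc n) * max 0 u + 1" by linarith
    then have "r n u \<le> (real (Suc n) * max 0 u + 1) / real (Suc n)"
      unfolding r_def by (rule divide_right_mono) simp
    then show "r n u \<le> max 0 u + 1 / real (Suc n)" by (simp add: add_divide_distrib)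
  qed
  show "(\<lambda>(\<omega>, u). f (chain_path (min t (r n u)) \<omega>)) \<in> borel_measurable (F t \<Otimes>\<^sub>M lborel)" for n
  proof -
    have "(\<lambda>x. f (chain_path (min t ((real_of_int \<lfloor>real (Suc n) * max 0 (snd x)\<rfloor> + 1)
        / real (Suc n))) (fst x))) \<in> borel_measurable (F t \<Otimes>\<^sub>M lborel)"
    \<comment> \<open>The rounded time takes countably many values; for each of them only the
      outcome varies.\<close>
    proof (rule measurable_compose_countable[where
          f = "\<lambda>j x. f (chain_path (min t ((real_of_int j + 1) / real (Suc n))) (fst x))"
          and g = "\<lambda>x. \<lfloor>real (Suc n) * max 0 (snd x)\<rfloor>"])
      fix j :: int
      have "(\<lambda>\<omega>. f (chain_path (min t ((real_of_int j + 1) / real (Suc n))) \<omega>)) \<in> borel_measurable (F t)"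
        using t by (intro measurable_compose[OF chain_path_measurable_F]) auto
      then show "(\<lambda>x. f (chain_path (min t ((real_of_int j + 1) / real (Suc n))) (fst x)))
          \<in> borel_measurable (F t \<Otimes>\<^sub>M lborel)"
        by (rule measurable_compose[OF measurable_fst])
    qed measurable
    then show ?thesis by (simp add: r_def case_prod_beta')
  qed
  show "(\<lambda>n. (\<lambda>(\<omega>, u). f (chain_path (min t (r n u)) \<omega>)) x) \<longlonglongrightarrow> (\<lambda>(\<omega>, u). f (chain_path (min t u) \<omega>)) x"
    for x
  proof (cases "fst x \<in> regular")
    case False
    then show ?thesis by (auto simp: chain_path_def case_prod_beta')
  next
    case True
    define \<omega> u where "\<omega> = fst x" and "u = snd x"
    have "\<forall>\<^sub>F n in sequentially. f (chain_path (min t (r n u)) \<omega>) = f (chain_path (min t u) \<omega>)"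
    proof (cases "u < t")
      case False
      then have "min t (r n u) = t" for n using r(1)[of u n] by linarith
      then show ?thesis using False by (auto simp: min_absorb1)
    next
      case u: True
      obtain d where d: "d > 0" "\<And>s. max 0 u \<le> s \<Longrightarrow> s < max 0 u + d \<Longrightarrow> \<epsilon> s \<omega> = \<epsilon> (max 0 u) \<omega>"
        using regular_right_constant[of \<omega> "max 0 u"] True by (auto simp: \<omega>_def)
      obtain N :: nat where N: "inverse (real (Suc N)) < d" using reals_Archimedean[OF d(1)] by blast
      have "chain_path (min t (r n u)) \<omega> = chain_path u \<omega>" if "n \<ge> N" for n
      proof -
        have "1 / real (Suc n) \<le> inverse (real (Suc N))"
          using that by (simp add: divide_simps)
        then have "r n u < max 0 u + d" using r(2)[of n u] N by linarith
        then have "\<epsilon> (max 0 (min t (r n u))) \<omega> = \<epsilon> (max 0 u) \<omega>"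
          using r(1)[of u n] u t by (intro d(2)) auto
        then show ?thesis by (simp add: chain_path_def)
      qed
      then show ?thesis using u by (auto simp: eventually_sequentially min_absorb2 intro!: exI[of _ N])
    qed
    then show ?thesis by (auto simp: case_prod_beta' \<omega>_def u_def intro: tendsto_eventually)
  qed
qed

lemma chain_path_jointly_measurable_M:
  fixes f :: "nat \<Rightarrow> real"
  assumes t: "0 \<le> t"
  shows "(\<lambda>(\<omega>, u). f (chain_path (min t u) \<omega>)) \<in> borel_measurable (M \<Otimes>\<^sub>M lborel)"
proof -
  have "(\<lambda>x. (fst x, snd x)) \<in> measurable (M \<Otimes>\<^sub>M lborel) (F t \<Otimes>\<^sub>M lborel)"
    by (rule measurable_Pair[OF measurable_compose[OF measurable_fst, of "\<lambda>x. x"] measurable_snd])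
      (use sets_F_subset[OF t] in \<open>auto simp: measurable_def dest: sets.sets_into_space\<close>)
  from measurable_compose[OF this chain_path_jointly_measurable[OF t]]
  show ?thesis by simp
qed

lemma chain_path_eq: "\<omega> \<in> regular \<Longrightarrow> 0 \<le> s \<Longrightarrow> chain_path s \<omega> = \<epsilon> s \<omega>"
  by (simp add: chain_path_def max_absorb2)

lemma chain_path_section_measurable:
  fixes f :: "nat \<Rightarrow> real"
  assumes t: "0 \<le> t" and \<omega>: "\<omega> \<in> space M"
  shows "(\<lambda>u. f (chain_path (min t u) \<omega>)) \<in> borel_measurable lborel"
  using measurable_compose_Pair1[OF \<omega> chain_path_jointly_measurable_M[OF t]] by simp

lemma integrable_chain_path:
  fixes f :: "nat \<Rightarrow> real"
  assumes \<omega>: "\<omega> \<in> regular" and ab: "0 \<le> a" "a \<le> b"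
  shows "set_integrable lborel {a..b} (\<lambda>u. f (\<epsilon> u \<omega>))"
proof -
  have "integrable lborel (\<lambda>u. indicator {a..b} u *\<^sub>R f (chain_path (min b u) \<omega>))"
  proof (rule integrableI_bounded_set_indicator)
    show "(\<lambda>u. f (chain_path (min b u) \<omega>)) \<in> borel_measurable lborel"
      using chain_path_section_measurable[of b \<omega> f] regular_space[OF \<omega>] ab by simp
    have "norm (f (chain_path (min b u) \<omega>)) \<le> \<bar>f 1\<bar> + \<bar>f 2\<bar>" for u
      using chain_path_cases[of "min b u" \<omega>] by auto
    then show "AE u in lborel. u \<in> {a..b} \<longrightarrow> norm (f (chain_path (min b u) \<omega>)) \<le> \<bar>f 1\<bar> + \<bar>f 2\<bar>"
      by blast
  qed (auto simp: emeasure_lborel_Icc_eq)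
  moreover have "(\<lambda>u. indicator {a..b} u *\<^sub>R f (chain_path (min b u) \<omega>)) = (\<lambda>u. indicator {a..b} u *\<^sub>R f (\<epsilon> u \<omega>))"
    using ab chain_path_eq[OF \<omega>] by (auto simp: indicator_def min_absorb2)
  ultimately show ?thesis by (simp add: set_integrable_def)
qed

section \<open>Time integrals along the chain\<close>

definition drift :: "(nat \<Rightarrow> real) \<Rightarrow> real \<Rightarrow> 'a \<Rightarrow> real" where
  "drift f t \<omega> = (LBINT s:{0..t}. f (\<epsilon> s \<omega>))"

lemma drift_diff:
  assumes \<omega>: "\<omega> \<in> regular" and st: "0 \<le> s" "s \<le> t"
  shows "drift f t \<omega> - drift f s \<omega> = (LBINT u:{s..t}. f (\<epsilon> u \<omega>))"
proof -
  have "{0..t} = {0..s} \<union> {s..t}" using st by auto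
  then have "drift f t \<omega> = (LBINT u:{0..s} \<union> {s..t}. f (\<epsilon> u \<omega>))"
    by (simp add: drift_def)
  also have "\<dots> = drift f s \<omega> + (LBINT u:{s..t}. f (\<epsilon> u \<omega>))"
    unfolding drift_def
  proof (rule set_integral_Un_AE)
    show "AE x in lborel. \<not> (x \<in> {0..s} \<and> x \<in> {s..t})"
      using AE_lborel_singleton[of s] by eventually_elim auto
  qed (use integrable_chain_path[OF \<omega>] st in auto)
  finally show ?thesis by simp
qed

lemma drift_0 [simp]: "drift f 0 \<omega> = 0"
proof -
  have "AE s in lborel. indicator {0..0} s *\<^sub>R f (\<epsilon> s \<omega>) = 0"
    using AE_lborel_singleton[of 0] by eventually_elim auto
  then show ?thesis
    unfolding drift_def set_lebesgue_integral_def by (rule integral_eq_zero_AE)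
qed

lemma drift_Lipschitz:
  assumes \<omega>: "\<omega> \<in> regular" and st: "0 \<le> s" "s \<le> t" and C: "\<bar>f 1\<bar> \<le> C" "\<bar>f 2\<bar> \<le> C"
  shows "\<bar>drift f t \<omega> - drift f s \<omega>\<bar> \<le> C * (t - s)"
proof -
  have f: "\<bar>f (\<epsilon> u \<omega>)\<bar> \<le> C" if "u \<ge> 0" for u
    using \<epsilon>_cases[OF that regular_space[OF \<omega>]] C by auto
  have int: "integrable lborel (\<lambda>u. indicator {s..t} u *\<^sub>R f (\<epsilon> u \<omega>))"
    using integrable_chain_path[OF \<omega> st] by (simp add: set_integrable_def)
  have "norm (\<integral>u. indicator {s..t} u *\<^sub>R f (\<epsilon> u \<omega>) \<partial>lborel)
      \<le> (\<integral>u. norm (indicator {s..t} u *\<^sub>R f (\<epsilon> u \<omega>)) \<partial>lborel)"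
    by (rule integral_norm_bound)
  also have "\<dots> \<le> (\<integral>u. C * indicator {s..t} u \<partial>lborel)"
  proof (rule integral_mono)
    show "integrable lborel (\<lambda>u. C * indicator {s..t} u)"
      by (rule integrable_mult_right) (auto intro!: integrable_real_indicator simp: emeasure_lborel_Icc_eq)
  qed (use int st f in \<open>auto simp: indicator_def\<close>)
  also have "\<dots> = C * (t - s)" using st by simp
  finally show ?thesis using drift_diff[OF \<omega> st] by (simp add: set_lebesgue_integral_def)
qed

text \<open>Integrating a jointly measurable function over one variable leaves a measurable one. The
  drift agrees almost surely with such an integral of \<open>chain_path\<close>, and
  \<open>F t\<close> contains the null sets.\<close>

lemma drift_measurable_F:
  assumes t: "0 \<le> t"
  shows "drift f t \<in> borel_measurable (F t)"
proof (rule AE_eq_measurable_F)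
  have "(\<lambda>(\<omega>, u). indicator {0..t} u *\<^sub>R f (chain_path (min t u) \<omega>)) \<in> borel_measurable (F t \<Otimes>\<^sub>M lborel)"
  proof -
    have "(\<lambda>x. indicator {0..t} (snd x) :: real) \<in> borel_measurable (F t \<Otimes>\<^sub>M lborel)" by measurable
    then show ?thesis
      using borel_measurable_times[OF _ chain_path_jointly_measurable[OF t, of f]]
      by (simp add: case_prod_beta')
  qed
  then show "(\<lambda>\<omega>. \<integral>u. indicator {0..t} u *\<^sub>R f (chain_path (min t u) \<omega>) \<partial>lborel) \<in> borel_measurable (F t)"
    by (rule lborel.borel_measurable_lebesgue_integral)
  show "AE \<omega> in M. drift f t \<omega> = (\<integral>u. indicator {0..t} u *\<^sub>R f (chain_path (min t u) \<omega>) \<partial>lborel)"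
    using AE_regular
  proof eventually_elim
    fix \<omega> assume "\<omega> \<in> regular"
    then have "(\<lambda>u. indicator {0..t} u *\<^sub>R f (chain_path (min t u) \<omega>)) = (\<lambda>u. indicator {0..t} u *\<^sub>R f (\<epsilon> u \<omega>))"
      using t chain_path_eq by (auto simp: indicator_def min_absorb2)
    then show "drift f t \<omega> = (\<integral>u. indicator {0..t} u *\<^sub>R f (chain_path (min t u) \<omega>) \<partial>lborel)"
      by (simp add: drift_def set_lebesgue_integral_def)
  qed
qed

lemma chain_function_measurable_F:
  fixes f :: "nat \<Rightarrow> real"
  shows "0 \<le> t \<Longrightarrow> (\<lambda>\<omega>. f (\<epsilon> t \<omega>)) \<in> borel_measurable (F t)"
  by (rule measurable_compose[OF \<epsilon>_measurable_F[OF _ order_refl]]) simp_all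

text \<open>Stopping at the first grid time at or below \<open>\<eta>\<close> is encoded by these
  events: the increment over cell \<open>k\<close> counts on the \<open>k\<close>-th of them, which
  is known when the cell begins.\<close>

lemma grid_above_measurable_F:
  fixes Y :: "real \<Rightarrow> 'a \<Rightarrow> real"
  assumes Y: "\<And>t. 0 \<le> t \<Longrightarrow> Y t \<in> borel_measurable (F t)" and h: "0 \<le> h"
  shows "{\<omega> \<in> space M. \<forall>j\<le>k. \<eta> < Y (real j * h) \<omega>} \<in> sets (F (real k * h))"
proof -
  have "{\<omega> \<in> space M. \<forall>j\<le>k. \<eta> < Y (real j * h) \<omega>} =
      (\<Inter>j\<in>{..k}. {\<omega> \<in> space (F (real k * h)). \<eta> < Y (real j * h) \<omega>})"
    by auto
  also have "\<dots> \<in> sets (F (real k * h))"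
  proof (intro sets.finite_INT)
    fix j assume "j \<in> {..k}"
    then have "Y (real j * h) \<in> borel_measurable (F (real k * h))"
      using h by (intro measurable_F_mono[OF Y]) (auto intro!: mult_right_mono)
    then show "{\<omega> \<in> space (F (real k * h)). \<eta> < Y (real j * h) \<omega>} \<in> sets (F (real k * h))"
      by measurable
  qed auto
  finally show ?thesis .
qed

text \<open>Twofold use: as the decay rate in the transition probabilities, and as a crude bound on
  the rate of leaving either regime.\<close>

definition total_rate :: real where
  "total_rate = - q 1 1 - q 2 2"

lemma total_rate_pos: "total_rate > 0"
  using rate_neg[of 1] rate_neg[of 2] by (simp add: total_rate_def)

lemma chain_event [measurable]:
  "0 \<le> s \<Longrightarrow> {\<omega> \<in> space M. \<epsilon> s \<omega> = i} \<in> sets (F s)"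
  using measurable_sets[OF \<epsilon>_measurable_F[of s s], of "{i}"] by (simp add: vimage_def Int_def conj_commute)

lemma chain_event_M: "0 \<le> s \<Longrightarrow> {\<omega> \<in> space M. \<epsilon> s \<omega> = i} \<in> events"
  using chain_event sets_F_subset by blast

lemma jump_event_M: "0 \<le> s \<Longrightarrow> 0 \<le> t \<Longrightarrow> {\<omega> \<in> space M. \<epsilon> s \<omega> = i \<and> \<epsilon> t \<omega> = j} \<in> events"
proof -
  assume "0 \<le> s" "0 \<le> t"
  then have "{\<omega> \<in> space M. \<epsilon> s \<omega> = i} \<inter> {\<omega> \<in> space M. \<epsilon> t \<omega> = j} \<in> events"
    by (intro sets.Int chain_event_M)
  moreover have "{\<omega> \<in> space M. \<epsilon> s \<omega> = i} \<inter> {\<omega> \<in> space M. \<epsilon> t \<omega> = j}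
      = {\<omega> \<in> space M. \<epsilon> s \<omega> = i \<and> \<epsilon> t \<omega> = j}" by auto
  ultimately show ?thesis by simp
qed

lemma jump_prob_le:
  assumes st: "0 \<le> s" "s \<le> t" and B: "B \<in> sets (F s)" and ij: "i \<in> {1, 2}" "j \<in> {1, 2}" "i \<noteq> j"
  shows "prob (B \<inter> {\<omega> \<in> space M. \<epsilon> s \<omega> = i \<and> \<epsilon> t \<omega> = j})
    \<le> - q i i * (t - s) * prob (B \<inter> {\<omega> \<in> space M. \<epsilon> s \<omega> = i})"
  unfolding markov[OF st B ij(1,2)]
  using st by (intro mult_right_mono transition_prob_two_states_bounds(2)[OF rows ij rate_neg]) auto

lemma jump_prob_ge:
  assumes st: "0 \<le> s" "s \<le> t" and B: "B \<in> sets (F s)" and ij: "i \<in> {1, 2}" "j \<in> {1, 2}" "i \<noteq> j"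
  shows "prob (B \<inter> {\<omega> \<in> space M. \<epsilon> s \<omega> = i \<and> \<epsilon> t \<omega> = j})
    \<ge> - q i i * ((t - s) - total_rate * (t - s)\<^sup>2) * prob (B \<inter> {\<omega> \<in> space M. \<epsilon> s \<omega> = i})"
  unfolding markov[OF st B ij(1,2)] total_rate_def
  using st by (intro mult_right_mono transition_prob_two_states_bounds(3)[OF rows ij rate_neg]) auto

lemma prob_change_le:
  assumes st: "0 \<le> s" "s \<le> t"
  shows "prob {\<omega> \<in> space M. \<epsilon> t \<omega> \<noteq> \<epsilon> s \<omega>} \<le> total_rate * (t - s)"
proof -
  have t: "0 \<le> t" using st by simp
  let ?A = "\<lambda>i j. {\<omega> \<in> space M. \<epsilon> s \<omega> = i \<and> \<epsilon> t \<omega> = j}"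
  have 1: "prob (?A i j) \<le> - q i i * (t - s)" if ij: "i \<in> {1, 2}" "j \<in> {1, 2}" "i \<noteq> j" for i j
  proof -
    have "space M \<in> sets (F s)" using sets.top[of "F s"] by simp
    from jump_prob_le[OF st this ij]
    have "prob (?A i j) \<le> - q i i * (t - s) * prob {\<omega> \<in> space M. \<epsilon> s \<omega> = i}"
      by (simp add: Int_absorb1 Collect_mono inf.absorb2 subset_iff)
    also have "\<dots> \<le> - q i i * (t - s) * 1"
      using rate_neg[OF ij(1)] st by (intro mult_left_mono prob_le_1) (simp add: mult_nonpos_nonneg)
    finally show ?thesis by simp
  qed
  have "{\<omega> \<in> space M. \<epsilon> t \<omega> \<noteq> \<epsilon> s \<omega>} = ?A 1 2 \<union> ?A 2 1"
    using \<epsilon>_cases[OF st(1)] \<epsilon>_cases[OF t] by fastforce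
  then have "prob {\<omega> \<in> space M. \<epsilon> t \<omega> \<noteq> \<epsilon> s \<omega>} \<le> prob (?A 1 2) + prob (?A 2 1)"
    using jump_event_M[OF st(1) t] by (simp add: measure_Un_le)
  then show ?thesis
    using 1[of 1 2] 1[of 2 1] by (simp add: total_rate_def algebra_simps)
qed

text \<open>At a time \<open>u\<close> of the interval the integrand deviates from its initial value
  only if the regime differs, which has probability at most \<open>total_rate * (t - s)\<close>.
  Exchanging expectation and time integral supplies the second factor \<open>t - s\<close>.\<close>

lemma drift_increment_approx:
  assumes st: "0 \<le> s" "s \<le> t"
  shows "integrable M (\<lambda>\<omega>. \<bar>drift f t \<omega> - drift f s \<omega> - (t - s) * f (\<epsilon> s \<omega>)\<bar>)" (is "integrable M ?R")
    and "expectation (\<lambda>\<omega>. \<bar>drift f t \<omega> - drift f s \<omega> - (t - s) * f (\<epsilon> s \<omega>)\<bar>)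
      \<le> \<bar>f 1 - f 2\<bar> * total_rate * (t - s)\<^sup>2"
proof -
  have t: "0 \<le> t" using st by simp
  let ?K = "\<bar>f 1 - f 2\<bar> * (total_rate * (t - s))"
  have K: "?K \<ge> 0" using total_rate_pos st by simp
  \<comment> \<open>The exchange requires joint measurability, hence \<open>chain_path\<close>
    instead of \<open>\<epsilon>\<close>; on regular paths the two agree.\<close>
  define g where "g \<omega> u = ennreal \<bar>f (chain_path (min t u) \<omega>) - f (\<epsilon> s \<omega>)\<bar> * indicator {s..t} u" for \<omega> u
  have fs: "(\<lambda>\<omega>. f (\<epsilon> s \<omega>)) \<in> borel_measurable M"
    by (rule measurable_F_M[OF chain_function_measurable_F]) (use st in auto)
  have gm: "case_prod g \<in> borel_measurable (M \<Otimes>\<^sub>M lborel)"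
  proof -
    note [measurable] = chain_path_jointly_measurable_M[OF t, of f] fs
    have "(\<lambda>x. ennreal \<bar>(case x of (\<omega>, u) \<Rightarrow> f (chain_path (min t u) \<omega>)) - f (\<epsilon> s (fst x))\<bar> *
        indicator {s..t} (snd x)) \<in> borel_measurable (M \<Otimes>\<^sub>M lborel)"
      by measurable
    then show ?thesis by (simp add: g_def case_prod_beta')
  qed
  interpret pair_sigma_finite M lborel ..
  have le: "AE \<omega> in M. ennreal (?R \<omega>) \<le> (\<integral>\<^sup>+u. g \<omega> u \<partial>lborel)"
    using AE_regular
  proof eventually_elim
    fix \<omega> assume \<omega>: "\<omega> \<in> regular"
    have i1: "integrable lborel (\<lambda>u. indicator {s..t} u *\<^sub>R f (\<epsilon> u \<omega>))"
      using integrable_chain_path[OF \<omega> st] by (simp add: set_integrable_def)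
    have i2: "integrable lborel (\<lambda>u. indicator {s..t} u *\<^sub>R f (\<epsilon> s \<omega>))"
      by (auto simp: emeasure_lborel_Icc_eq)
    have "drift f t \<omega> - drift f s \<omega> - (t - s) * f (\<epsilon> s \<omega>)
      = (\<integral>u. indicator {s..t} u *\<^sub>R f (\<epsilon> u \<omega>) - indicator {s..t} u *\<^sub>R f (\<epsilon> s \<omega>) \<partial>lborel)"
      using st unfolding drift_diff[OF \<omega> st] set_lebesgue_integral_def
      by (subst Bochner_Integration.integral_diff[OF i1 i2]) simp
    then have "ennreal (?R \<omega>) \<le> (\<integral>\<^sup>+u. norm (indicator {s..t} u *\<^sub>R f (\<epsilon> u \<omega>) -
        indicator {s..t} u *\<^sub>R f (\<epsilon> s \<omega>)) \<partial>lborel)"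
      using integral_norm_bound_ennreal[OF Bochner_Integration.integrable_diff[OF i1 i2]] by simp
    also have "\<dots> = (\<integral>\<^sup>+u. g \<omega> u \<partial>lborel)"
      using chain_path_eq[OF \<omega>] st by (intro nn_integral_cong) (auto simp: g_def indicator_def min_absorb2)
    finally show "ennreal (?R \<omega>) \<le> (\<integral>\<^sup>+u. g \<omega> u \<partial>lborel)" .
  qed
  have "(\<integral>\<^sup>+\<omega>. ennreal (?R \<omega>) \<partial>M) \<le> (\<integral>\<^sup>+\<omega>. (\<integral>\<^sup>+u. g \<omega> u \<partial>lborel) \<partial>M)"
    by (rule nn_integral_mono_AE[OF le])
  also have "\<dots> = (\<integral>\<^sup>+u. (\<integral>\<^sup>+\<omega>. g \<omega> u \<partial>M) \<partial>lborel)"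
    by (rule Fubini'[OF gm, symmetric])
  also have "\<dots> \<le> (\<integral>\<^sup>+u. ennreal ?K * indicator {s..t} u \<partial>lborel)"
  proof (rule nn_integral_mono)
    fix u :: real
    show "(\<integral>\<^sup>+\<omega>. g \<omega> u \<partial>M) \<le> ennreal ?K * indicator {s..t} u"
    proof (cases "u \<in> {s..t}")
      case True
      then have u: "0 \<le> u" "s \<le> u" "u \<le> t" using st by auto
      have ch: "{\<omega> \<in> space M. \<epsilon> u \<omega> \<noteq> \<epsilon> s \<omega>} \<in> events"
      proof -
        have "{\<omega> \<in> space M. \<epsilon> u \<omega> \<noteq> \<epsilon> s \<omega>} = {\<omega> \<in> space M. \<epsilon> s \<omega> = 1 \<and> \<epsilon> u \<omega> = 2} \<union>
            {\<omega> \<in> space M. \<epsilon> s \<omega> = 2 \<and> \<epsilon> u \<omega> = 1}"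
          using \<epsilon>_cases[OF st(1)] \<epsilon>_cases[OF u(1)] by fastforce
        then show ?thesis using jump_event_M[OF st(1) u(1)] by simp
      qed
      have "(\<integral>\<^sup>+\<omega>. g \<omega> u \<partial>M)
          \<le> (\<integral>\<^sup>+\<omega>. ennreal \<bar>f 1 - f 2\<bar> * indicator {\<omega> \<in> space M. \<epsilon> u \<omega> \<noteq> \<epsilon> s \<omega>} \<omega> \<partial>M)"
      proof (rule nn_integral_mono_AE)
        show "AE \<omega> in M. g \<omega> u \<le> ennreal \<bar>f 1 - f 2\<bar> * indicator {\<omega> \<in> space M. \<epsilon> u \<omega> \<noteq> \<epsilon> s \<omega>} \<omega>"
          using AE_regular
        proof eventually_elim
          fix \<omega> assume \<omega>: "\<omega> \<in> regular"
          show "g \<omega> u \<le> ennreal \<bar>f 1 - f 2\<bar> * indicator {\<omega> \<in> space M. \<epsilon> u \<omega> \<noteq> \<epsilon> s \<omega>} \<omega>"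
            using \<epsilon>_cases[OF u(1) regular_space[OF \<omega>]] \<epsilon>_cases[OF st(1) regular_space[OF \<omega>]]
              regular_space[OF \<omega>] True chain_path_eq[OF \<omega> u(1)] u
            by (auto simp: g_def indicator_def min_absorb2 abs_minus_commute)
        qed
      qed
      also have "\<dots> = ennreal \<bar>f 1 - f 2\<bar> * emeasure M {\<omega> \<in> space M. \<epsilon> u \<omega> \<noteq> \<epsilon> s \<omega>}"
        by (rule nn_integral_cmult_indicator[OF ch])
      also have "\<dots> = ennreal (\<bar>f 1 - f 2\<bar> * prob {\<omega> \<in> space M. \<epsilon> u \<omega> \<noteq> \<epsilon> s \<omega>})"
        by (simp add: emeasure_eq_measure ennreal_mult)
      also have "\<dots> \<le> ennreal ?K"
      proof (intro ennreal_leI mult_left_mono)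
        have "prob {\<omega> \<in> space M. \<epsilon> u \<omega> \<noteq> \<epsilon> s \<omega>} \<le> total_rate * (u - s)"
          by (rule prob_change_le[OF st(1) u(2)])
        also have "\<dots> \<le> total_rate * (t - s)"
          using total_rate_pos u by (intro mult_left_mono) auto
        finally show "prob {\<omega> \<in> space M. \<epsilon> u \<omega> \<noteq> \<epsilon> s \<omega>} \<le> total_rate * (t - s)" .
      qed simp
      finally show ?thesis using True by simp
    qed (simp add: g_def)
  qed
  also have "\<dots> = ennreal ?K * ennreal (t - s)"
    using st by (subst nn_integral_cmult_indicator) auto
  also have "\<dots> = ennreal (\<bar>f 1 - f 2\<bar> * total_rate * (t - s)\<^sup>2)"
    using K st by (simp add: ennreal_mult[symmetric] power2_eq_square mult_ac)
  finally have main: "(\<integral>\<^sup>+\<omega>. ennreal (?R \<omega>) \<partial>M) \<le> ennreal (\<bar>f 1 - f 2\<bar> * total_rate * (t - s)\<^sup>2)" .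
  have Rm: "?R \<in> borel_measurable M"
    using measurable_F_M[OF drift_measurable_F[OF t] t, of f]
      measurable_F_M[OF drift_measurable_F[OF st(1)] st(1), of f] fs by simp
  show int: "integrable M ?R"
    using main Rm by (intro integrableI_bounded) (auto intro: le_less_trans)
  have "ennreal (expectation ?R) \<le> ennreal (\<bar>f 1 - f 2\<bar> * total_rate * (t - s)\<^sup>2)"
    using main nn_integral_eq_integral[OF int] by simp
  then show "expectation ?R \<le> \<bar>f 1 - f 2\<bar> * total_rate * (t - s)\<^sup>2"
    using total_rate_pos by (subst (asm) ennreal_le_iff) auto
qed

end

section \<open>The stochastic integral as a square-integrable martingale\<close>

locale switching_diffusion = switching_law M W \<epsilon> q
  for M :: "'a measure" and W \<epsilon> q +
  fixes \<sigma> :: "nat \<Rightarrow> real" and Z :: "real \<Rightarrow> 'a \<Rightarrow> real"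
  assumes ito: "is_ito_integral M F W (\<lambda>s \<omega>. \<sigma> (\<epsilon> s \<omega>)) Z"
begin

lemma Z_measurable_F: "0 \<le> t \<Longrightarrow> Z t \<in> borel_measurable (F t)"
  using ito by (simp add: is_ito_integral_def)

lemma Z_measurable: "0 \<le> t \<Longrightarrow> Z t \<in> borel_measurable M"
  using measurable_F_M[OF Z_measurable_F] by blast

lemma AE_Z_continuous: "AE \<omega> in M. continuous_on {0..} (\<lambda>t. Z t \<omega>)"
  using ito by (simp add: is_ito_integral_def)

text \<open>Two approximations chosen for different horizons approximate the same volatility on the
  common interval \<open>[0, s]\<close>, so they are close to each other there.\<close>

lemma elementary_process_triangle:
  assumes st: "0 \<le> s" "s \<le> t"
    and el: "elementary_integrand M F n p \<xi>" "elementary_integrand M F n' p' \<xi>'"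
  shows "(\<integral>\<^sup>+\<omega>. (\<integral>\<^sup>+u\<in>{0..s}. ennreal ((elementary_process n' p' \<xi>' u \<omega> - elementary_process n p \<xi> u \<omega>)\<^sup>2)
      \<partial>lborel) \<partial>M)
    \<le> 2 * (\<integral>\<^sup>+\<omega>. (\<integral>\<^sup>+u\<in>{0..s}. ennreal ((\<sigma> (\<epsilon> u \<omega>) - elementary_process n' p' \<xi>' u \<omega>)\<^sup>2) \<partial>lborel) \<partial>M)
      + 2 * (\<integral>\<^sup>+\<omega>. (\<integral>\<^sup>+u\<in>{0..t}. ennreal ((\<sigma> (\<epsilon> u \<omega>) - elementary_process n p \<xi> u \<omega>)\<^sup>2) \<partial>lborel) \<partial>M)"
proof -
  \<comment> \<open>Splitting the integral of a sum requires measurability, which the version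
    through \<open>chain_path\<close> provides; only the bound by the original integrals is used at
    the end.\<close>
  define d where "d n p \<xi> \<omega> u = ennreal ((\<sigma> (chain_path (min t u) \<omega>) - elementary_process n p \<xi> u \<omega>)\<^sup>2)
    * indicator {0..s} u" for n p \<xi> \<omega> u
  have dm: "case_prod (d n p \<xi>) \<in> borel_measurable (M \<Otimes>\<^sub>M lborel)"
    if el: "elementary_integrand M F n p \<xi>" for n p \<xi>
  proof -
    note p = elementary_integrandD(2)[OF el] and p0 = elementary_integrandD(4)[OF el]
    have \<xi>: "(\<lambda>x. \<xi> k (fst x)) \<in> borel_measurable (M \<Otimes>\<^sub>M lborel)" if "k < n" for k
      using measurable_compose[OF measurable_fst measurable_F_M[OF p[OF that] p0]] that by simp
    have ep: "(\<lambda>x. elementary_process n p \<xi> (snd x) (fst x)) \<in> borel_measurable (M \<Otimes>\<^sub>M lborel)"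
      unfolding elementary_process_def
      by (intro borel_measurable_sum borel_measurable_times \<xi>) (auto intro: borel_measurable_indicator')
    note [measurable] = ep
    have [measurable]: "(\<lambda>x. \<sigma> (chain_path (min t (snd x)) (fst x))) \<in> borel_measurable (M \<Otimes>\<^sub>M lborel)"
      using chain_path_jointly_measurable_M[of t \<sigma>] st by (simp add: case_prod_beta')
    have "(\<lambda>x. ennreal ((\<sigma> (chain_path (min t (snd x)) (fst x)) - elementary_process n p \<xi> (snd x) (fst x))\<^sup>2)
        * indicator {0..s} (snd x)) \<in> borel_measurable (M \<Otimes>\<^sub>M lborel)"
      by measurable
    then show ?thesis by (simp add: d_def case_prod_beta')
  qed
  have dle: "(\<integral>\<^sup>+\<omega>. (\<integral>\<^sup>+u. d n p \<xi> \<omega> u \<partial>lborel) \<partial>M)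
      \<le> (\<integral>\<^sup>+\<omega>. (\<integral>\<^sup>+u\<in>{0..r}. ennreal ((\<sigma> (\<epsilon> u \<omega>) - elementary_process n p \<xi> u \<omega>)\<^sup>2) \<partial>lborel) \<partial>M)"
    if "s \<le> r" for r n p \<xi>
  proof (rule nn_integral_mono_AE)
    show "AE \<omega> in M. (\<integral>\<^sup>+u. d n p \<xi> \<omega> u \<partial>lborel)
        \<le> (\<integral>\<^sup>+u\<in>{0..r}. ennreal ((\<sigma> (\<epsilon> u \<omega>) - elementary_process n p \<xi> u \<omega>)\<^sup>2) \<partial>lborel)"
      using AE_regular
    proof eventually_elim
      fix \<omega> assume \<omega>: "\<omega> \<in> regular"
      show "(\<integral>\<^sup>+u. d n p \<xi> \<omega> u \<partial>lborel)
        \<le> (\<integral>\<^sup>+u\<in>{0..r}. ennreal ((\<sigma> (\<epsilon> u \<omega>) - elementary_process n p \<xi> u \<omega>)\<^sup>2) \<partial>lborel)"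
        using that st chain_path_eq[OF \<omega>]
        by (intro nn_integral_mono) (auto simp: d_def indicator_def min_absorb2)
    qed
  qed
  have "(\<integral>\<^sup>+\<omega>. (\<integral>\<^sup>+u\<in>{0..s}. ennreal ((elementary_process n' p' \<xi>' u \<omega> - elementary_process n p \<xi> u \<omega>)\<^sup>2)
      \<partial>lborel) \<partial>M) \<le> (\<integral>\<^sup>+\<omega>. (\<integral>\<^sup>+u. 2 * d n' p' \<xi>' \<omega> u + 2 * d n p \<xi> \<omega> u \<partial>lborel) \<partial>M)"
  proof (intro nn_integral_mono)
    fix \<omega> and u :: real
    show "ennreal ((elementary_process n' p' \<xi>' u \<omega> - elementary_process n p \<xi> u \<omega>)\<^sup>2) * indicator {0..s} u
       \<le> 2 * d n' p' \<xi>' \<omega> u + 2 * d n p \<xi> \<omega> u"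
      using ennreal_square_triangle[of "elementary_process n' p' \<xi>' u \<omega>" "elementary_process n p \<xi> u \<omega>"
          "\<sigma> (chain_path (min t u) \<omega>)"]
      by (auto simp: d_def indicator_def power2_commute)
  qed
  also have "\<dots> = 2 * (\<integral>\<^sup>+\<omega>. (\<integral>\<^sup>+u. d n' p' \<xi>' \<omega> u \<partial>lborel) \<partial>M) + 2 * (\<integral>\<^sup>+\<omega>. (\<integral>\<^sup>+u. d n p \<xi> \<omega> u \<partial>lborel) \<partial>M)"
  proof -
    have s1: "(\<lambda>u. d n p \<xi> \<omega> u) \<in> borel_measurable lborel" if "\<omega> \<in> space M" "elementary_integrand M F n p \<xi>"
      for n p \<xi> \<omega>
      using measurable_compose_Pair1[OF that(1) dm[OF that(2)]] by simp
    have s2: "(\<lambda>\<omega>. \<integral>\<^sup>+u. d n p \<xi> \<omega> u \<partial>lborel) \<in> borel_measurable M" if "elementary_integrand M F n p \<xi>" for n p \<xi>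
      by (rule lborel.borel_measurable_nn_integral[OF dm[OF that]])
    have "(\<integral>\<^sup>+\<omega>. (\<integral>\<^sup>+u. 2 * d n' p' \<xi>' \<omega> u + 2 * d n p \<xi> \<omega> u \<partial>lborel) \<partial>M)
      = (\<integral>\<^sup>+\<omega>. 2 * (\<integral>\<^sup>+u. d n' p' \<xi>' \<omega> u \<partial>lborel) + 2 * (\<integral>\<^sup>+u. d n p \<xi> \<omega> u \<partial>lborel) \<partial>M)"
      using s1 el by (intro nn_integral_cong) (simp add: nn_integral_add nn_integral_cmult)
    also have "\<dots> = 2 * (\<integral>\<^sup>+\<omega>. (\<integral>\<^sup>+u. d n' p' \<xi>' \<omega> u \<partial>lborel) \<partial>M) + 2 * (\<integral>\<^sup>+\<omega>. (\<integral>\<^sup>+u. d n p \<xi> \<omega> u \<partial>lborel) \<partial>M)"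
      using s2 el by (simp add: nn_integral_add nn_integral_cmult)
    finally show ?thesis .
  qed
  also have "\<dots> \<le> 2 * (\<integral>\<^sup>+\<omega>. (\<integral>\<^sup>+u\<in>{0..s}. ennreal ((\<sigma> (\<epsilon> u \<omega>) - elementary_process n' p' \<xi>' u \<omega>)\<^sup>2) \<partial>lborel) \<partial>M)
      + 2 * (\<integral>\<^sup>+\<omega>. (\<integral>\<^sup>+u\<in>{0..t}. ennreal ((\<sigma> (\<epsilon> u \<omega>) - elementary_process n p \<xi> u \<omega>)\<^sup>2) \<partial>lborel) \<partial>M)"
    using dle[OF order_refl] dle[OF st(2)] by (intro add_mono mult_left_mono) auto
  finally show ?thesis .
qed

text \<open>
  The definition of the integral provides a separate approximating sequence for every time; the
  isometry shows that the one for \<open>t\<close> also works at earlier times.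
\<close>

lemma Z_approximation:
  assumes st: "0 \<le> s" "s \<le> t"
  shows "\<exists>n p \<xi>. (\<forall>m. elementary_integrand M F (n m) (p m) (\<xi> m)) \<and>
    (\<lambda>m. \<integral>\<^sup>+\<omega>. ennreal ((Z t \<omega> - elementary_integral W (n m) (p m) (\<xi> m) t \<omega>)\<^sup>2) \<partial>M) \<longlonglongrightarrow> 0 \<and>
    (\<lambda>m. \<integral>\<^sup>+\<omega>. ennreal ((Z s \<omega> - elementary_integral W (n m) (p m) (\<xi> m) s \<omega>)\<^sup>2) \<partial>M) \<longlonglongrightarrow> 0"
proof -
  have "0 \<le> t" using st by simp
  then obtain n p \<xi> where el: "\<And>m. elementary_integrand M F (n m) (p m) (\<xi> m)"
    and Q: "(\<lambda>m. \<integral>\<^sup>+\<omega>. (\<integral>\<^sup>+u\<in>{0..t}. ennreal ((\<sigma> (\<epsilon> u \<omega>) - elementary_process (n m) (p m) (\<xi> m) u \<omega>)\<^sup>2)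
      \<partial>lborel) \<partial>M) \<longlonglongrightarrow> 0" (is "?Q \<longlonglongrightarrow> 0")
    and Zt: "(\<lambda>m. \<integral>\<^sup>+\<omega>. ennreal ((Z t \<omega> - elementary_integral W (n m) (p m) (\<xi> m) t \<omega>)\<^sup>2) \<partial>M) \<longlonglongrightarrow> 0"
    using ito unfolding is_ito_integral_def by blast
  obtain n' p' \<xi>' where el': "\<And>m. elementary_integrand M F (n' m) (p' m) (\<xi>' m)"
    and Q': "(\<lambda>m. \<integral>\<^sup>+\<omega>. (\<integral>\<^sup>+u\<in>{0..s}. ennreal ((\<sigma> (\<epsilon> u \<omega>) - elementary_process (n' m) (p' m) (\<xi>' m) u \<omega>)\<^sup>2)
      \<partial>lborel) \<partial>M) \<longlonglongrightarrow> 0" (is "?Q' \<longlonglongrightarrow> 0")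
    and Zs: "(\<lambda>m. \<integral>\<^sup>+\<omega>. ennreal ((Z s \<omega> - elementary_integral W (n' m) (p' m) (\<xi>' m) s \<omega>)\<^sup>2) \<partial>M) \<longlonglongrightarrow> 0"
      (is "?R' \<longlonglongrightarrow> 0")
    using ito st(1) unfolding is_ito_integral_def by blast
  let ?X = "\<lambda>m. elementary_integral W (n m) (p m) (\<xi> m) s"
  let ?X' = "\<lambda>m. elementary_integral W (n' m) (p' m) (\<xi>' m) s"
  have le: "(\<integral>\<^sup>+\<omega>. ennreal ((Z s \<omega> - ?X m \<omega>)\<^sup>2) \<partial>M) \<le> 2 * ?R' m + 2 * (2 * ?Q' m + 2 * ?Q m)" for m
  proof -
    note Xm = square_integrable_measurable[OF square_integrable_elementary_integral[OF st(1) el[of m]]]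
    note Xm' = square_integrable_measurable[OF square_integrable_elementary_integral[OF st(1) el'[of m]]]
    note [measurable] = Xm Xm' Z_measurable[OF st(1)]
    have "(\<integral>\<^sup>+\<omega>. ennreal ((Z s \<omega> - ?X m \<omega>)\<^sup>2) \<partial>M)
        \<le> (\<integral>\<^sup>+\<omega>. 2 * ennreal ((Z s \<omega> - ?X' m \<omega>)\<^sup>2) + 2 * ennreal ((?X' m \<omega> - ?X m \<omega>)\<^sup>2) \<partial>M)"
      by (intro nn_integral_mono ennreal_square_triangle)
    also have "\<dots> = 2 * ?R' m + 2 * (\<integral>\<^sup>+\<omega>. ennreal ((?X' m \<omega> - ?X m \<omega>)\<^sup>2) \<partial>M)"
      by (simp add: nn_integral_add nn_integral_cmult)
    also have "\<dots> \<le> 2 * ?R' m + 2 * (2 * ?Q' m + 2 * ?Q m)"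
      unfolding ito_isometry_difference[OF st(1) el'[of m] el[of m]]
      by (intro add_left_mono mult_left_mono elementary_process_triangle st el el') simp
    finally show ?thesis .
  qed
  have "(\<lambda>m. 2 * ?R' m + 2 * (2 * ?Q' m + 2 * ?Q m)) \<longlonglongrightarrow> 2 * 0 + 2 * (2 * 0 + 2 * 0)"
    by (intro tendsto_add ennreal_tendsto_cmult Zs Q Q') auto
  then have lim: "(\<lambda>m. 2 * ?R' m + 2 * (2 * ?Q' m + 2 * ?Q m)) \<longlonglongrightarrow> 0" by simp
  have "(\<lambda>m. \<integral>\<^sup>+\<omega>. ennreal ((Z s \<omega> - ?X m \<omega>)\<^sup>2) \<partial>M) \<longlonglongrightarrow> 0"
    by (rule tendsto_sandwich[OF _ _ tendsto_const lim]) (use le in auto)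
  with el Zt show ?thesis by blast
qed

text \<open>A single elementary integral at finite distance suffices, and convergence to 0 provides
  one at distance below 1.\<close>

lemma square_integrable_Z:
  assumes t: "0 \<le> t"
  shows "square_integrable (Z t)"
proof -
  obtain n p \<xi> where el: "\<And>m. elementary_integrand M F (n m) (p m) (\<xi> m)"
    and lim: "(\<lambda>m. \<integral>\<^sup>+\<omega>. ennreal ((Z t \<omega> - elementary_integral W (n m) (p m) (\<xi> m) t \<omega>)\<^sup>2) \<partial>M) \<longlonglongrightarrow> 0"
    using Z_approximation[OF t order_refl] by blast
  from order_tendstoD(2)[OF lim, of 1]
  have "\<forall>\<^sub>F m in sequentially. (\<integral>\<^sup>+\<omega>. ennreal ((Z t \<omega> - elementary_integral W (n m) (p m) (\<xi> m) t \<omega>)\<^sup>2) \<partial>M) < 1"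
    by simp
  then obtain m where "(\<integral>\<^sup>+\<omega>. ennreal ((Z t \<omega> - elementary_integral W (n m) (p m) (\<xi> m) t \<omega>)\<^sup>2) \<partial>M) < 1"
    by (auto simp: eventually_sequentially)
  then have "(\<integral>\<^sup>+\<omega>. ennreal ((Z t \<omega> - elementary_integral W (n m) (p m) (\<xi> m) t \<omega>)\<^sup>2) \<partial>M) < \<infinity>"
    by (rule less_trans) simp
  with Z_measurable[OF t] square_integrable_elementary_integral[OF t el]
  show ?thesis by (rule square_integrable_difference)
qed

lemma AE_Z_0: "AE \<omega> in M. Z 0 \<omega> = 0"
proof -
  obtain n p \<xi> where el: "\<And>m. elementary_integrand M F (n m) (p m) (\<xi> m)"
    and lim: "(\<lambda>m. \<integral>\<^sup>+\<omega>. ennreal ((Z 0 \<omega> - elementary_integral W (n m) (p m) (\<xi> m) 0 \<omega>)\<^sup>2) \<partial>M) \<longlonglongrightarrow> 0"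
    using Z_approximation[OF order_refl order_refl] by blast
  have "elementary_integral W (n m) (p m) (\<xi> m) 0 \<omega> = 0" for m \<omega>
  proof -
    have "0 \<le> p m k" if "k \<le> n m" for k
      using elementary_integrandD(4)[OF el that] .
    then show ?thesis by (simp add: elementary_integral_def min_absorb2)
  qed
  then have "(\<integral>\<^sup>+\<omega>. ennreal ((Z 0 \<omega>)\<^sup>2) \<partial>M) = 0"
    using lim by (simp add: LIMSEQ_const_iff)
  then have "AE \<omega> in M. ennreal ((Z 0 \<omega>)\<^sup>2) = 0"
    using Z_measurable[of 0] by (subst (asm) nn_integral_0_iff_AE) auto
  then show ?thesis by eventually_elim (simp add: ennreal_eq_0_iff)
qed

text \<open>The martingale property in weak form, tested against square-integrable \<open>f\<close>
  known at \<open>s\<close>. It holds for elementary integrals; the error of the approximation at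
  \<open>t\<close> and at \<open>s\<close> is sent to 0 with \<open>K\<close> fixed, and only then
  is \<open>K\<close> made small.\<close>

lemma Z_martingale:
  assumes st: "0 \<le> s" "s \<le> t" and f: "f \<in> borel_measurable (F s)" "square_integrable f"
  shows "expectation (\<lambda>\<omega>. f \<omega> * (Z t \<omega> - Z s \<omega>)) = 0"
proof -
  have t: "0 \<le> t" using st by simp
  obtain n p \<xi> where el: "\<And>m. elementary_integrand M F (n m) (p m) (\<xi> m)"
    and lt: "(\<lambda>m. \<integral>\<^sup>+\<omega>. ennreal ((Z t \<omega> - elementary_integral W (n m) (p m) (\<xi> m) t \<omega>)\<^sup>2) \<partial>M) \<longlonglongrightarrow> 0"
    and ls: "(\<lambda>m. \<integral>\<^sup>+\<omega>. ennreal ((Z s \<omega> - elementary_integral W (n m) (p m) (\<xi> m) s \<omega>)\<^sup>2) \<partial>M) \<longlonglongrightarrow> 0"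
    using Z_approximation[OF st] by blast
  define X where "X m r = elementary_integral W (n m) (p m) (\<xi> m) r" for m r
  have X2: "square_integrable (X m r)" if "0 \<le> r" for m r
    unfolding X_def by (rule square_integrable_elementary_integral[OF that el])
  have D2: "square_integrable (\<lambda>\<omega>. Z r \<omega> - X m r \<omega>)" if "0 \<le> r" for m r
    by (intro square_integrable_diff square_integrable_Z X2 that)
  have conv: "(\<lambda>m. expectation (\<lambda>\<omega>. (Z r \<omega> - X m r \<omega>)\<^sup>2)) \<longlonglongrightarrow> 0"
    if "0 \<le> r" and l: "(\<lambda>m. \<integral>\<^sup>+\<omega>. ennreal ((Z r \<omega> - elementary_integral W (n m) (p m) (\<xi> m) r \<omega>)\<^sup>2) \<partial>M) \<longlonglongrightarrow> 0"
    for r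
  proof -
    have "(\<integral>\<^sup>+\<omega>. ennreal ((Z r \<omega> - elementary_integral W (n m) (p m) (\<xi> m) r \<omega>)\<^sup>2) \<partial>M)
        = ennreal (expectation (\<lambda>\<omega>. (Z r \<omega> - X m r \<omega>)\<^sup>2))" for m
      using square_integrable_square[OF D2[OF that(1), of m]] unfolding X_def
      by (rule nn_integral_eq_integral) simp
    with l show ?thesis by (simp add: ennreal_0[symmetric] del: ennreal_0)
  qed
  define E where "E = expectation (\<lambda>\<omega>. f \<omega> * (Z t \<omega> - Z s \<omega>))"
  have le: "\<bar>E\<bar> \<le> 2 * K * expectation (\<lambda>\<omega>. (f \<omega>)\<^sup>2)" if K: "K > 0" for K
  proof -
    let ?a = "\<lambda>m. expectation (\<lambda>\<omega>. (Z t \<omega> - X m t \<omega>)\<^sup>2)"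
    let ?b = "\<lambda>m. expectation (\<lambda>\<omega>. (Z s \<omega> - X m s \<omega>)\<^sup>2)"
    have "\<bar>E\<bar> \<le> (K * expectation (\<lambda>\<omega>. (f \<omega>)\<^sup>2) + ?a m / K) + (K * expectation (\<lambda>\<omega>. (f \<omega>)\<^sup>2) + ?b m / K)" for m
    proof -
      have i1: "integrable M (\<lambda>\<omega>. f \<omega> * (Z t \<omega> - X m t \<omega>))" and i2: "integrable M (\<lambda>\<omega>. f \<omega> * (Z s \<omega> - X m s \<omega>))"
        by (intro integrable_mult_square_integrable f D2 t st)+
      have i3: "integrable M (\<lambda>\<omega>. f \<omega> * (X m t \<omega> - X m s \<omega>))"
        by (intro integrable_mult_square_integrable f square_integrable_diff X2 t st)
      have "E = expectation (\<lambda>\<omega>. f \<omega> * (Z t \<omega> - X m t \<omega>) - f \<omega> * (Z s \<omega> - X m s \<omega>) + f \<omega> * (X m t \<omega> - X m s \<omega>))"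
        unfolding E_def by (intro Bochner_Integration.integral_cong) (auto simp: algebra_simps)
      also have "\<dots> = expectation (\<lambda>\<omega>. f \<omega> * (Z t \<omega> - X m t \<omega>)) - expectation (\<lambda>\<omega>. f \<omega> * (Z s \<omega> - X m s \<omega>))
          + expectation (\<lambda>\<omega>. f \<omega> * (X m t \<omega> - X m s \<omega>))"
        using i1 i2 i3 by simp
      also have "expectation (\<lambda>\<omega>. f \<omega> * (X m t \<omega> - X m s \<omega>)) = 0"
        unfolding X_def by (rule expectation_elementary_increment[OF st el f])
      finally show ?thesis
        using expectation_product_le[OF f(2) D2[OF t, of m] K]
          expectation_product_le[OF f(2) D2[OF st(1), of m] K] by linarith
    qed
    moreover have "(\<lambda>m. (K * expectation (\<lambda>\<omega>. (f \<omega>)\<^sup>2) + ?a m / K) + (K * expectation (\<lambda>\<omega>. (f \<omega>)\<^sup>2) + ?b m / K))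
        \<longlonglongrightarrow> (K * expectation (\<lambda>\<omega>. (f \<omega>)\<^sup>2) + 0 / K) + (K * expectation (\<lambda>\<omega>. (f \<omega>)\<^sup>2) + 0 / K)"
      using K by (intro tendsto_add tendsto_divide tendsto_const conv t st lt ls) auto
    ultimately have "\<bar>E\<bar> \<le> (K * expectation (\<lambda>\<omega>. (f \<omega>)\<^sup>2) + 0 / K) + (K * expectation (\<lambda>\<omega>. (f \<omega>)\<^sup>2) + 0 / K)"
      by (intro LIMSEQ_le_const) auto
    then show ?thesis by simp
  qed
  have "\<bar>E\<bar> \<le> 0"
  proof (rule field_le_epsilon)
    fix e :: real assume e: "e > 0"
    define A where "A = expectation (\<lambda>\<omega>. (f \<omega>)\<^sup>2)"
    have A: "A \<ge> 0" by (simp add: A_def)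
    \<comment> \<open>\<open>A + 1\<close> keeps the denominator positive when \<open>f\<close>
      vanishes almost surely.\<close>
    have "\<bar>E\<bar> \<le> 2 * (e / (2 * (A + 1))) * A"
      unfolding A_def by (rule le) (use A e in \<open>simp add: A_def add_nonneg_pos\<close>)
    also have "\<dots> \<le> e" using A e by (simp add: field_simps)
    finally show "\<bar>E\<bar> \<le> 0 + e" by simp
  qed
  then show ?thesis by (simp add: E_def)
qed

text \<open>A discrete martingale transform with weights 0 and 1. Orthogonality of the increments
  bounds its second moment by that of \<open>Z\<close> at the final time, whatever the events and
  the mesh; this uniformity later controls the exceptional paths.\<close>

lemma stopped_Z:
  assumes h: "0 \<le> h" and B: "\<And>k. k < n \<Longrightarrow> B k \<in> sets (F (real k * h))"
  defines "S \<equiv> \<lambda>\<omega>. \<Sum>k<n. indicator (B k) \<omega> * (Z (real (Suc k) * h) \<omega> - Z (real k * h) \<omega>)"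
  shows "S \<in> borel_measurable (F (real n * h))" and "square_integrable S"
    and "expectation S = 0"
    and "expectation (\<lambda>\<omega>. (S \<omega>)\<^sup>2) \<le> expectation (\<lambda>\<omega>. (Z (real n * h) \<omega>)\<^sup>2)"
proof -
  have "S \<in> borel_measurable (F (real n * h)) \<and> square_integrable S \<and> expectation S = 0 \<and>
    expectation (\<lambda>\<omega>. (S \<omega>)\<^sup>2) \<le> expectation (\<lambda>\<omega>. (Z (real n * h) \<omega>)\<^sup>2)"
    unfolding S_def using B
  proof (induction n)
    case 0
    show ?case by (auto intro: square_integrable_const)
  next
    case (Suc n)
    define s where "s = real n * h"
    define t where "t = real (Suc n) * h"
    have st: "0 \<le> s" "s \<le> t" "0 \<le> t" using h by (auto simp: s_def t_def intro!: mult_right_mono)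
    define S where "S \<omega> = (\<Sum>k<n. indicator (B k) \<omega> * (Z (real (Suc k) * h) \<omega> - Z (real k * h) \<omega>))" for \<omega>
    define D where "D \<omega> = Z t \<omega> - Z s \<omega>" for \<omega>
    define b where "b \<omega> = (indicator (B n) \<omega> :: real)" for \<omega>
    have S: "S \<in> borel_measurable (F s)" "square_integrable S" "expectation S = 0"
      "expectation (\<lambda>\<omega>. (S \<omega>)\<^sup>2) \<le> expectation (\<lambda>\<omega>. (Z s \<omega>)\<^sup>2)"
      using Suc unfolding S_def s_def by auto
    have D: "square_integrable D"
      unfolding D_def by (intro square_integrable_diff square_integrable_Z st)
    have Dm: "D \<in> borel_measurable (F t)"
      unfolding D_def by (intro borel_measurable_diff Z_measurable_F measurable_F_mono[OF Z_measurable_F] st)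
    have bF: "b \<in> borel_measurable (F s)"
      unfolding b_def using Suc.prems[of n] by (auto simp: s_def)
    have bM: "b \<in> borel_measurable M" by (rule measurable_F_M[OF bF st(1)])
    have b2: "square_integrable b"
      by (rule square_integrable_bounded[OF bM, of 1]) (simp add: b_def indicator_def)
    have bD: "square_integrable (\<lambda>\<omega>. b \<omega> * D \<omega>)"
      by (rule square_integrable_bounded_mult[OF bM _ D, of 1]) (simp add: b_def indicator_def)
    have bS: "square_integrable (\<lambda>\<omega>. b \<omega> * S \<omega>)"
      by (rule square_integrable_bounded_mult[OF bM _ S(2), of 1]) (simp add: b_def indicator_def)
    have sum: "(\<Sum>k<Suc n. indicator (B k) \<omega> * (Z (real (Suc k) * h) \<omega> - Z (real k * h) \<omega>)) = S \<omega> + b \<omega> * D \<omega>" for \<omega>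
      by (simp add: S_def b_def D_def s_def t_def)
    have z1: "expectation (\<lambda>\<omega>. b \<omega> * D \<omega>) = 0"
      unfolding D_def by (rule Z_martingale[OF st(1,2) bF b2])
    have z2: "expectation (\<lambda>\<omega>. (b \<omega> * S \<omega>) * D \<omega>) = 0"
      unfolding D_def by (rule Z_martingale[OF st(1,2) borel_measurable_times[OF bF S(1)] bS])
    have z3: "expectation (\<lambda>\<omega>. Z s \<omega> * D \<omega>) = 0"
      unfolding D_def by (rule Z_martingale[OF st(1,2) Z_measurable_F[OF st(1)] square_integrable_Z[OF st(1)]])
    have "expectation (\<lambda>\<omega>. (S \<omega> + b \<omega> * D \<omega>)\<^sup>2)
        = expectation (\<lambda>\<omega>. (S \<omega>)\<^sup>2 + (b \<omega> * D \<omega>)\<^sup>2 + 2 * ((b \<omega> * S \<omega>) * D \<omega>))"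
      by (intro Bochner_Integration.integral_cong) (auto simp: power2_sum)
    also have "\<dots> = expectation (\<lambda>\<omega>. (S \<omega>)\<^sup>2) + expectation (\<lambda>\<omega>. (b \<omega> * D \<omega>)\<^sup>2)"
      using S(2) bD integrable_mult_square_integrable[OF bS D] z2 by (simp add: square_integrable_def)
    also have "expectation (\<lambda>\<omega>. (b \<omega> * D \<omega>)\<^sup>2) \<le> expectation (\<lambda>\<omega>. (D \<omega>)\<^sup>2)"
      using bD D by (intro integral_mono) (auto simp: square_integrable_def b_def indicator_def)
    also have "expectation (\<lambda>\<omega>. (S \<omega>)\<^sup>2) + expectation (\<lambda>\<omega>. (D \<omega>)\<^sup>2)
        \<le> expectation (\<lambda>\<omega>. (Z s \<omega>)\<^sup>2) + expectation (\<lambda>\<omega>. (D \<omega>)\<^sup>2)" using S(4) by simp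
    also have "\<dots> = expectation (\<lambda>\<omega>. (Z s \<omega>)\<^sup>2 + (D \<omega>)\<^sup>2 + 2 * (Z s \<omega> * D \<omega>))"
      using square_integrable_Z[OF st(1)] D integrable_mult_square_integrable[OF square_integrable_Z[OF st(1)] D] z3
      by (simp add: square_integrable_def)
    also have "\<dots> = expectation (\<lambda>\<omega>. (Z t \<omega>)\<^sup>2)"
      by (intro Bochner_Integration.integral_cong) (auto simp: D_def power2_eq_square algebra_simps)
    finally have "expectation (\<lambda>\<omega>. (S \<omega> + b \<omega> * D \<omega>)\<^sup>2) \<le> expectation (\<lambda>\<omega>. (Z t \<omega>)\<^sup>2)" by simp
    moreover have "expectation (\<lambda>\<omega>. S \<omega> + b \<omega> * D \<omega>) = 0"
      using S(3) z1 square_integrable_integrable[OF S(2)] square_integrable_integrable[OF bD] by simp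
    moreover have "(\<lambda>\<omega>. S \<omega> + b \<omega> * D \<omega>) \<in> borel_measurable (F t)"
      by (intro borel_measurable_add borel_measurable_times Dm measurable_F_mono[OF S(1) st(2)]
          measurable_F_mono[OF bF st(2)])
    moreover have "square_integrable (\<lambda>\<omega>. S \<omega> + b \<omega> * D \<omega>)"
      by (intro square_integrable_add S(2) bD)
    ultimately show ?case unfolding sum t_def by blast
  qed
  then show "S \<in> borel_measurable (F (real n * h))" "square_integrable S" "expectation S = 0"
    "expectation (\<lambda>\<omega>. (S \<omega>)\<^sup>2) \<le> expectation (\<lambda>\<omega>. (Z (real n * h) \<omega>)\<^sup>2)"
    by auto
qed

end

section \<open>Dividends along a grid\<close>

text \<open>
  The sum stops at the first grid time at which the surplus is not above the threshold. The chain may jump from 2 to 1 between two grid times; each such jump lowers the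
  threshold and is paid for by the term \<open>\<theta> 2 - \<theta> 1\<close>. A jump from 1 to 2 raises the threshold, and the
  total dividends are then only compared with the threshold before the jump.
\<close>

lemma dividends_le_stopped_sum:
  fixes U D Y :: "real \<Rightarrow> real" and e :: "real \<Rightarrow> nat" and \<theta> :: "nat \<Rightarrow> real"
  assumes theta: "\<theta> 1 \<le> \<theta> 2"
    and e: "\<And>t. 0 \<le> t \<Longrightarrow> e t = 1 \<or> e t = 2"
    and D: "increasing_path D"
    and left: "\<And>t. 0 < t \<Longrightarrow> continuous (at_left t) D"
    and jump: "\<And>t. 0 \<le> t \<Longrightarrow> right_limit D t - D t \<le> max 0 (U t - D t - \<theta> (e t))"
    and null: "emeasure (stieltjes D) {t. Inf (ereal ` {t. 0 \<le> t \<and> U t - D t \<le> \<theta> (e t)}) < ereal t} = 0"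
    and Y: "\<And>t. Y t = U t - D t - \<theta> (e t)"
    and h: "0 < h" and n: "0 < n" and Y0: "Y 0 > 0" and D0: "D 0 = 0"
    and osc: "\<And>s r. 0 \<le> s \<Longrightarrow> s \<le> r \<Longrightarrow> r \<le> s + h \<Longrightarrow> r \<le> real n * h \<Longrightarrow> \<bar>U s - U r\<bar> \<le> \<eta>"
    and cell: "\<And>k s. k < n \<Longrightarrow> real k * h \<le> s \<Longrightarrow> s \<le> real (Suc k) * h \<Longrightarrow> e (real k * h) = 2 \<Longrightarrow>
      e (real (Suc k) * h) = 2 \<Longrightarrow> e s = 2"
  shows "D (real n * h) \<le> U 0 - \<theta> (e 0) + (\<Sum>k<n. of_bool (\<forall>j\<le>k. Y (real j * h) > 0) *
      (U (real (Suc k) * h) - U (real k * h) +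
        (\<theta> 2 - \<theta> 1) * of_bool (e (real k * h) = 2 \<and> e (real (Suc k) * h) = 1))) + \<eta>"
proof -
  interpret increasing_path D by fact
  define d where "d k = U (real (Suc k) * h) - U (real k * h) +
        (\<theta> 2 - \<theta> 1) * of_bool (e (real k * h) = 2 \<and> e (real (Suc k) * h) = 1)" for k
  define B where "B k \<longleftrightarrow> (\<forall>j\<le>k. Y (real j * h) > 0)" for k
  \<comment> \<open>The last cell that the sum counts. Either the grid is exhausted, or the next
    grid time is the first with nonpositive excess; \<open>Y0\<close> makes sure that cell 0 is
    counted.\<close>
  obtain k where k: "k < n" "B k" and stop: "Suc k = n \<or> Y (real (Suc k) * h) \<le> 0"
  proof (cases "\<forall>j<n. Y (real j * h) > 0")
    case True
    then show ?thesis using n by (intro that[of "n - 1"]) (auto simp: B_def)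
  next
    case False
    define l where "l = (LEAST j. Y (real j * h) \<le> 0)"
    obtain j where j: "j < n" "Y (real j * h) \<le> 0" using False by (auto simp: not_less)
    then have l: "Y (real l * h) \<le> 0" "l \<le> j"
      unfolding l_def by (auto intro: LeastI Least_le)
    have "l \<noteq> 0" using l(1) Y0 by (intro notI) simp
    then obtain k where k: "l = Suc k" by (cases l) auto
    have "Y (real j * h) > 0" if "j \<le> k" for j
      using not_less_Least[of j "\<lambda>j. Y (real j * h) \<le> 0"] that k by (auto simp: l_def not_le)
    then show ?thesis using k j l by (intro that[of k]) (auto simp: B_def)
  qed
  have sum: "(\<Sum>i<n. of_bool (B i) * d i) = (\<Sum>i<Suc k. d i)"
  proof -
    have Bi: "B i \<longleftrightarrow> i \<le> k" if "i < n" for i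
    proof
      show "B i" if "i \<le> k" using k(2) that by (auto simp: B_def)
      show "i \<le> k" if "B i"
      proof (rule ccontr)
        assume "\<not> i \<le> k"
        then have "Y (real (Suc k) * h) > 0" "Suc k \<noteq> n"
          using \<open>B i\<close> \<open>i < n\<close> by (auto simp: B_def simp del: of_nat_Suc)
        then show False using stop by auto
      qed
    qed
    have "(\<Sum>i<n. of_bool (B i) * d i) = (\<Sum>i\<in>{..<Suc k}. of_bool (B i) * d i)"
      using k Bi by (intro sum.mono_neutral_right) auto
    also have "\<dots> = (\<Sum>i<Suc k. d i)"
      using k Bi by (intro sum.cong) auto
    finally show ?thesis .
  qed
  \<comment> \<open>The increments of \<open>U\<close> telescope. A change from 2 to 1 is paid for
    exactly, and a change from 1 to 2 only lowers the right-hand side.\<close>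
  have partial: "U 0 - \<theta> (e 0) + (\<Sum>i<j. d i) \<ge> U (real j * h) - \<theta> (e (real j * h))" for j
  proof (induction j)
    case (Suc j)
    have "0 \<le> real j * h" "0 \<le> real (Suc j) * h" using h by simp_all
    then have "\<theta> (e (real j * h)) - \<theta> (e (real (Suc j) * h))
        \<le> (\<theta> 2 - \<theta> 1) * of_bool (e (real j * h) = 2 \<and> e (real (Suc j) * h) = 1)"
      using e[of "real j * h"] e[of "real (Suc j) * h"] theta by (auto simp del: of_nat_Suc)
    then show ?case using Suc unfolding sum.lessThan_Suc d_def[of j] by linarith
  qed simp
  define a b where "a = real k * h" and "b = real (Suc k) * h"
  define K where "K = U 0 - \<theta> (e 0) + (\<Sum>i<Suc k. d i)"
  have ab: "0 \<le> a" "a \<le> b" "b = a + h"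
    using h by (simp_all add: a_def b_def distrib_right)
  have bn: "b \<le> real n * h"
    unfolding b_def using h k by (intro mult_right_mono) auto
  note ab = ab bn
  have K1: "K \<ge> U b - \<theta> (e b)" using partial[of "Suc k"] by (simp add: K_def b_def)
  have K2: "K \<ge> U b - \<theta> (e a) + (\<theta> 2 - \<theta> 1) * of_bool (e a = 2 \<and> e b = 1)"
    using partial[of k] unfolding K_def sum.lessThan_Suc d_def[of k] a_def[symmetric] b_def[symmetric]
    by linarith
  have Ya: "Y a > 0" using k(2) by (simp add: B_def a_def)
  \<comment> \<open>Inside the cell the threshold can be below the one at \<open>a\<close> only if
    the cell starts in 2 and visits 1. By \<open>cell\<close> it then ends in 1, so the jump term of
    this cell pays for the difference.\<close>
  have bound: "U s - \<theta> (e s) \<le> K + \<eta>" if s: "a \<le> s" "s \<le> b" for s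
  proof -
    have "e s = 1 \<or> e s = 2" "e a = 1 \<or> e a = 2" "e b = 1 \<or> e b = 2"
      using e s ab by auto
    moreover have "e a = 2 \<Longrightarrow> e b = 2 \<Longrightarrow> e s = 2"
      using cell[of k s] k s by (simp add: a_def b_def)
    ultimately have "- \<theta> (e s) \<le> - \<theta> (e a) + (\<theta> 2 - \<theta> 1) * of_bool (e a = 2 \<and> e b = 1)"
      using theta by auto
    moreover have "\<bar>U s - U b\<bar> \<le> \<eta>" using s ab by (intro osc) auto
    ultimately show ?thesis using K2 by linarith
  qed
  have "D (real n * h) \<le> K + \<eta>"
  proof (cases "Y b > 0")
    case True
    then have "b = real n * h" using stop by (auto simp: b_def)
    then show ?thesis using True bound[of b] ab by (simp add: Y)
  next
    case False
    define S where "S = {t. 0 \<le> t \<and> U t - D t \<le> \<theta> (e t)}"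
    define t0 where "t0 = Inf S"
    have bS: "b \<in> S" using False ab by (simp add: S_def Y)
    have bdd: "bdd_below S" by (auto simp: S_def intro!: bdd_belowI[of _ 0])
    have t0: "ereal t0 = Inf (ereal ` S)"
      unfolding t0_def using bS bdd by (intro ereal_Inf') auto
    have t0b: "t0 \<le> b" unfolding t0_def by (rule cInf_lower[OF bS bdd])
    have t00: "0 \<le> t0" unfolding t0_def using bS by (intro cInf_greatest) (auto simp: S_def)
    have before: "D s < U s - \<theta> (e s)" if "0 \<le> s" "s < t0" for s
    proof (rule ccontr)
      assume "\<not> D s < U s - \<theta> (e s)"
      then have "s \<in> S" using that by (simp add: S_def)
      then show False using cInf_lower[OF _ bdd] that by (fastforce simp: t0_def)
    qed
    have nullt0: "emeasure (stieltjes D) {t. t0 < t} = 0"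
      using null unfolding S_def[symmetric] t0[symmetric] by simp
    have Dn: "D (real n * h) \<le> right_limit D t0"
    proof (cases "t0 < real n * h")
      case True
      then show ?thesis by (rule constant_after[OF nullt0 t00])
    next
      case False
      then have "t0 = real n * h" using t0b ab by simp
      then show ?thesis using le_right_limit[OF t00] by simp
    qed
    show ?thesis
    proof (cases "t0 < a")
      \<comment> \<open>Bankruptcy before \<open>a\<close> went unnoticed on the grid. Nothing is
        paid after it, so the positive excess at \<open>a\<close> still bounds all
        dividends.\<close>
      case True
      have "D (real n * h) \<le> D a" using Dn right_limit_le[OF t00 True] by simp
      also have "\<dots> \<le> K + \<eta>" using Ya bound[of a] ab by (simp add: Y)
      finally show ?thesis .
    next
      case t0a: False
      have "D t0 \<le> K + \<eta>"
      proof (cases "t0 = a")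
        case True
        then show ?thesis using Ya bound[of a] ab by (simp add: Y)
      next
        case False
        then have at0: "a < t0" using t0a by simp
        \<comment> \<open>The bound holds at times just before \<open>t0\<close>, where the excess
          is positive; left-continuity carries it to \<open>t0\<close> itself.\<close>
        have "(D \<longlongrightarrow> D t0) (at_left t0)"
          using left[of t0] at0 ab by (simp add: continuous_within)
        moreover have "\<forall>\<^sub>F s in at_left t0. D s \<le> K + \<eta>"
          unfolding eventually_at_left[OF at0]
        proof (intro exI[of _ a] conjI allI impI)
          fix s assume s: "a < s" "s < t0"
          then show "D s \<le> K + \<eta>" using before[of s] bound[of s] ab t0b by auto
        qed (rule at0)
        ultimately show ?thesis by (rule tendsto_upperbound) simp
      qed
      moreover have "U t0 - \<theta> (e t0) \<le> K + \<eta>" using bound[of t0] t0a t0b by simp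
      \<comment> \<open>The jump at \<open>t0\<close> either is 0 or brings the dividends to at most
        \<open>U t0 - \<theta> (e t0)\<close>; both values are already bounded.\<close>
      ultimately show ?thesis using Dn jump[OF t00] by (auto simp: max_def split: if_splits)
    qed
  qed
  then show ?thesis unfolding K_def sum[symmetric] by (simp add: d_def B_def)
qed

text \<open>Regimes are right-continuous, so the approximating dyadic point must not lie to the left
  of \<open>s\<close>.\<close>

lemma dyadic_above:
  fixes a b s d :: real
  assumes "a \<le> s" "s < b" "0 < d"
  obtains l j where "j \<le> 2 ^ l" "s \<le> a + real j * ((b - a) / 2 ^ l)" "a + real j * ((b - a) / 2 ^ l) < s + d"
proof -
  have ba: "b - a > 0" using assms by simp
  have "(\<lambda>l. (b - a) / 2 ^ l) \<longlonglongrightarrow> 0"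
    by (rule LIMSEQ_divide_realpow_zero) simp
  then have "\<forall>\<^sub>F l in sequentially. (b - a) / 2 ^ l < d"
    using assms(3) by (rule order_tendstoD)
  then obtain l :: nat where l: "(b - a) / 2 ^ l < d" by (auto simp: eventually_sequentially)
  define \<delta> where "\<delta> = (b - a) / 2 ^ l"
  have \<delta>: "0 < \<delta>" using ba by (simp add: \<delta>_def)
  define j where "j = nat \<lceil>(s - a) / \<delta>\<rceil>"
  have p: "0 \<le> (s - a) / \<delta>" using assms \<delta> by simp
  then have jr: "real j = of_int \<lceil>(s - a) / \<delta>\<rceil>" by (simp add: j_def)
  have 1: "(s - a) / \<delta> \<le> real j" "real j < (s - a) / \<delta> + 1"
    unfolding jr by linarith+
  have "(s - a) / \<delta> \<le> 2 ^ l"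
    using assms ba by (simp add: \<delta>_def field_simps)
  then have "\<lceil>(s - a) / \<delta>\<rceil> \<le> 2 ^ l" by (simp add: ceiling_le_iff)
  then have j: "j \<le> 2 ^ l" by (simp add: j_def nat_le_iff)
  have "s \<le> a + real j * \<delta>" using 1(1) \<delta> by (simp add: pos_divide_le_eq)
  moreover have "a + real j * \<delta> < s + d"
  proof -
    have "real j * \<delta> < ((s - a) / \<delta> + 1) * \<delta>" using 1(2) \<delta> by (rule mult_strict_right_mono)
    also have "\<dots> = s - a + \<delta>" using \<delta> by (simp add: field_simps)
    finally show ?thesis using l by (simp add: \<delta>_def)
  qed
  ultimately show ?thesis using j by (intro that[of j l]) (auto simp: \<delta>_def)
qed

context switching_law
begin

text \<open>
  A return from 2 to 2 through 1 inside one cell is invisible on the grid. Its probability is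
  quadratic in the length of the cell, so that by Borel-Cantelli such returns eventually disappear
  from the dyadic grids.
\<close>

definition excursion :: "real \<Rightarrow> real \<Rightarrow> nat \<Rightarrow> 'a set" where
  "excursion a b N = {\<omega> \<in> space M. \<epsilon> a \<omega> = 2 \<and> \<epsilon> b \<omega> = 2 \<and> (\<exists>j\<le>N. \<epsilon> (a + real j * ((b - a) / real N)) \<omega> = 1)}"

lemma excursion_measurable:
  assumes "0 \<le> a" "a \<le> b"
  shows "excursion a b N \<in> events"
proof -
  have "excursion a b N = (\<Union>j\<in>{..N}. {\<omega> \<in> space M. \<epsilon> a \<omega> = 2 \<and> \<epsilon> b \<omega> = 2} \<inter>
      {\<omega> \<in> space M. \<epsilon> (a + real j * ((b - a) / real N)) \<omega> = 1})"
    by (auto simp: excursion_def)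
  also have "\<dots> \<in> events"
    using assms by (intro sets.finite_UN sets.Int jump_event_M chain_event_M) auto
  finally show ?thesis .
qed

text \<open>The first visit to 1 on the subgrid singles out one step from 2 to 1. The Markov
  property bounds this step by its length \<open>\<delta>\<close> and the return to 2 by
  \<open>b - a\<close>, each times a rate; the \<open>N\<close> steps then add up to
  \<open>b - a\<close> once more.\<close>

lemma excursion_prob:
  assumes ab: "0 \<le> a" "a \<le> b" and N: "0 < N"
  shows "prob (excursion a b N) \<le> q 1 1 * q 2 2 * (b - a)\<^sup>2"
proof -
  define \<delta> where "\<delta> = (b - a) / real N"
  define t where "t j = a + real j * \<delta>" for j
  have \<delta>: "0 \<le> \<delta>" using ab by (simp add: \<delta>_def)
  have t0: "t 0 = a" by (simp add: t_def)
  have tN: "t N = b" using N by (simp add: t_def \<delta>_def)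
  have tmono: "t i \<le> t j" if "i \<le> j" for i j
    unfolding t_def using that \<delta> by (simp add: mult_right_mono)
  have tpos: "0 \<le> t j" for j using tmono[of 0 j] ab t0 by simp
  define A where "A j = {\<omega> \<in> space M. \<epsilon> (t j) \<omega> = 2 \<and> \<epsilon> (t (Suc j)) \<omega> = 1} \<inter>
      {\<omega> \<in> space M. \<epsilon> b \<omega> = 2}" for j
  have sub: "excursion a b N \<subseteq> (\<Union>j<N. A j)"
  proof
    fix \<omega> assume "\<omega> \<in> excursion a b N"
    then have \<omega>: "\<omega> \<in> space M" "\<epsilon> a \<omega> = 2" "\<epsilon> b \<omega> = 2" and ex: "\<exists>j\<le>N. \<epsilon> (t j) \<omega> = 1"
      by (auto simp: excursion_def t_def \<delta>_def)
    define l where "l = (LEAST j. \<epsilon> (t j) \<omega> = 1)"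
    obtain j where j: "j \<le> N" "\<epsilon> (t j) \<omega> = 1" using ex by blast
    then have l: "\<epsilon> (t l) \<omega> = 1" "l \<le> j" unfolding l_def by (auto intro: LeastI Least_le)
    have "l \<noteq> 0" using l(1) \<omega> t0 by (intro notI) simp
    then obtain k where k: "l = Suc k" by (cases l) auto
    have "\<epsilon> (t k) \<omega> \<noteq> 1" using not_less_Least[of k "\<lambda>j. \<epsilon> (t j) \<omega> = 1"] k by (auto simp: l_def)
    then have "\<epsilon> (t k) \<omega> = 2" using \<epsilon>_cases[OF tpos \<omega>(1)] by blast
    then show "\<omega> \<in> (\<Union>j<N. A j)" using k l j \<omega> by (intro UN_I[of k]) (auto simp: A_def)
  qed
  have AM: "A j \<in> events" for j
    unfolding A_def using tpos ab by (intro sets.Int jump_event_M chain_event_M) auto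
  have PA: "prob (A j) \<le> q 1 1 * q 2 2 * (b - a) * \<delta>" if j: "j < N" for j
  proof -
    define u v where "u = t j" and "v = t (Suc j)"
    have uv: "0 \<le> u" "u \<le> v" "v \<le> b" "v - u = \<delta>" "b - v \<le> b - a" "0 \<le> v"
      using tpos tmono[of j "Suc j"] tmono[of "Suc j" N] tmono[of 0 "Suc j"] t0 tN j
      by (auto simp: u_def v_def t_def algebra_simps)
    have E: "{\<omega> \<in> space M. \<epsilon> u \<omega> = 2} \<in> sets (F v)"
      using chain_event[OF uv(1)] sets_F_mono[OF uv(2)] by blast
    have sp: "space M \<in> sets (F u)" using sets.top[of "F u"] by simp
    have "A j = {\<omega> \<in> space M. \<epsilon> u \<omega> = 2} \<inter> {\<omega> \<in> space M. \<epsilon> v \<omega> = 1 \<and> \<epsilon> b \<omega> = 2}"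
      by (auto simp: A_def u_def v_def)
    then have "prob (A j) \<le> - q 1 1 * (b - v) * prob ({\<omega> \<in> space M. \<epsilon> u \<omega> = 2} \<inter> {\<omega> \<in> space M. \<epsilon> v \<omega> = 1})"
      using jump_prob_le[OF uv(6,3) E, of 1 2] by simp
    also have "{\<omega> \<in> space M. \<epsilon> u \<omega> = 2} \<inter> {\<omega> \<in> space M. \<epsilon> v \<omega> = 1}
        = space M \<inter> {\<omega> \<in> space M. \<epsilon> u \<omega> = 2 \<and> \<epsilon> v \<omega> = 1}" by auto
    also have "- q 1 1 * (b - v) * prob \<dots> \<le> - q 1 1 * (b - v) * (- q 2 2 * (v - u) *
        prob (space M \<inter> {\<omega> \<in> space M. \<epsilon> u \<omega> = 2}))"
      using rate_neg[of 1] uv by (intro mult_left_mono jump_prob_le sp) (auto simp: mult_nonpos_nonneg)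
    also have "\<dots> \<le> - q 1 1 * (b - v) * (- q 2 2 * (v - u) * 1)"
      using rate_neg[of 1] rate_neg[of 2] uv
      by (intro mult_left_mono prob_le_1) (auto simp: mult_nonpos_nonneg)
    also have "\<dots> = (b - v) * (q 1 1 * q 2 2 * \<delta>)" using uv by simp
    also have "\<dots> \<le> (b - a) * (q 1 1 * q 2 2 * \<delta>)"
      using rate_neg[of 1] rate_neg[of 2] uv \<delta>
      by (intro mult_right_mono) (auto simp: mult_nonpos_nonpos)
    finally show ?thesis by (simp add: mult_ac)
  qed
  have "prob (excursion a b N) \<le> prob (\<Union>j<N. A j)"
    using sub AM by (intro finite_measure_mono) auto
  also have "\<dots> \<le> (\<Sum>j<N. prob (A j))"
    using AM by (intro measure_UNION_le) auto
  also have "\<dots> \<le> (\<Sum>j<N. q 1 1 * q 2 2 * (b - a) * \<delta>)"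
    by (intro sum_mono PA) simp
  also have "\<dots> = q 1 1 * q 2 2 * (b - a)\<^sup>2"
    using N by (simp add: \<delta>_def power2_eq_square)
  finally show ?thesis .
qed

definition cell_excursion :: "real \<Rightarrow> real \<Rightarrow> 'a set" where
  "cell_excursion a b = (\<Union>l. excursion a b (2 ^ l))"

lemma cell_excursion_measurable:
  "0 \<le> a \<Longrightarrow> a \<le> b \<Longrightarrow> cell_excursion a b \<in> events"
  unfolding cell_excursion_def using excursion_measurable by auto

text \<open>Dyadic subdivisions are nested, so the events increase, and the bound does not depend on
  the number of steps.\<close>

lemma cell_excursion_prob:
  assumes ab: "0 \<le> a" "a \<le> b"
  shows "prob (cell_excursion a b) \<le> q 1 1 * q 2 2 * (b - a)\<^sup>2"
proof (rule LIMSEQ_le_const2)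
  have "incseq (\<lambda>l. excursion a b (2 ^ l))"
  proof (rule incseq_SucI, rule subsetI)
    fix l \<omega> assume "\<omega> \<in> excursion a b (2 ^ l)"
    then obtain j where \<omega>: "\<omega> \<in> space M" "\<epsilon> a \<omega> = 2" "\<epsilon> b \<omega> = 2"
      and j: "j \<le> 2 ^ l" "\<epsilon> (a + real j * ((b - a) / real (2 ^ l))) \<omega> = 1"
      by (auto simp: excursion_def)
    have "a + real (2 * j) * ((b - a) / real (2 ^ Suc l)) = a + real j * ((b - a) / real (2 ^ l))"
      by simp
    then have "\<exists>j\<le>2 ^ Suc l. \<epsilon> (a + real j * ((b - a) / real (2 ^ Suc l))) \<omega> = 1"
      using j by (intro exI[of _ "2 * j"]) simp
    then show "\<omega> \<in> excursion a b (2 ^ Suc l)" using \<omega> by (simp add: excursion_def)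
  qed
  then show "(\<lambda>l. prob (excursion a b (2 ^ l))) \<longlonglongrightarrow> prob (cell_excursion a b)"
    unfolding cell_excursion_def using excursion_measurable[OF ab]
    by (intro finite_Lim_measure_incseq) auto
  show "\<exists>N. \<forall>l\<ge>N. prob (excursion a b (2 ^ l)) \<le> q 1 1 * q 2 2 * (b - a)\<^sup>2"
    using excursion_prob[OF ab] by auto
qed

text \<open>By right-continuity a visit to 1 lasts for a positive time, during which some dyadic
  point of the cell falls.\<close>

lemma not_cell_excursion:
  assumes \<omega>: "\<omega> \<in> regular" "\<omega> \<notin> cell_excursion a b" and as: "0 \<le> a" "a \<le> s" "s \<le> b"
    and e: "\<epsilon> a \<omega> = 2" "\<epsilon> b \<omega> = 2"
  shows "\<epsilon> s \<omega> = 2"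
proof (rule ccontr)
  assume ne: "\<epsilon> s \<omega> \<noteq> 2"
  have s0: "0 \<le> s" using as by simp
  have s1: "\<epsilon> s \<omega> = 1" using \<epsilon>_cases[OF s0 regular_space[OF \<omega>(1)]] ne by blast
  have sb: "s < b" using ne e as by (cases "s = b") auto
  obtain d where d: "d > 0" "\<And>r. s \<le> r \<Longrightarrow> r < s + d \<Longrightarrow> \<epsilon> r \<omega> = \<epsilon> s \<omega>"
    using regular_right_constant[OF \<omega>(1) s0] by blast
  obtain l j where "j \<le> 2 ^ l" "s \<le> a + real j * ((b - a) / 2 ^ l)" "a + real j * ((b - a) / 2 ^ l) < s + d"
    using dyadic_above[OF as(2) sb d(1)] by blast
  then have "\<exists>j\<le>2 ^ l. \<epsilon> (a + real j * ((b - a) / real (2 ^ l))) \<omega> = 1"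
    using d(2)[of "a + real j * ((b - a) / 2 ^ l)"] s1 by (intro exI[of _ j]) auto
  then have "\<omega> \<in> excursion a b (2 ^ l)"
    using e regular_space[OF \<omega>(1)] by (simp add: excursion_def)
  then show False using \<omega>(2) by (auto simp: cell_excursion_def)
qed

definition grid_excursion :: "real \<Rightarrow> nat \<Rightarrow> 'a set" where
  "grid_excursion T m = (\<Union>k<2 ^ m. cell_excursion (real k * (T / 2 ^ m)) (real (Suc k) * (T / 2 ^ m)))"

lemma grid_excursion_measurable:
  assumes T: "0 \<le> T"
  shows "grid_excursion T m \<in> events"
proof -
  have "0 \<le> real k * (T / 2 ^ m)" "real k * (T / 2 ^ m) \<le> real (Suc k) * (T / 2 ^ m)" for k
    using T by (auto intro!: mult_right_mono divide_right_mono)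
  then show ?thesis unfolding grid_excursion_def using cell_excursion_measurable by blast
qed

text \<open>There are \<open>2 ^ m\<close> cells, each with a probability of order
  \<open>(T / 2 ^ m)^2\<close>; the sum is geometric in \<open>m\<close>.\<close>

lemma AE_eventually_no_grid_excursion:
  assumes T: "0 \<le> T"
  shows "AE \<omega> in M. \<forall>\<^sub>F m in sequentially. \<omega> \<notin> grid_excursion T m"
proof -
  have P: "prob (grid_excursion T m) \<le> q 1 1 * q 2 2 * T\<^sup>2 * (1 / 2) ^ m" for m
  proof -
    define h where "h = T / 2 ^ m"
    have h: "0 \<le> h" using T by (simp add: h_def)
    have st: "0 \<le> real k * h" "real k * h \<le> real (Suc k) * h" for k
      using h by (auto intro!: mult_right_mono)
    have "prob (grid_excursion T m) \<le> (\<Sum>k<2 ^ m. prob (cell_excursion (real k * h) (real (Suc k) * h)))"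
      unfolding grid_excursion_def h_def[symmetric]
      using cell_excursion_measurable[OF st] by (intro measure_UNION_le) auto
    also have "\<dots> \<le> (\<Sum>k<2 ^ m. q 1 1 * q 2 2 * (real (Suc k) * h - real k * h)\<^sup>2)"
      by (intro sum_mono cell_excursion_prob st)
    also have "\<dots> = 2 ^ m * (q 1 1 * q 2 2 * h\<^sup>2)"
      by (simp add: algebra_simps)
    also have "\<dots> = q 1 1 * q 2 2 * T\<^sup>2 * (1 / 2) ^ m"
      by (simp add: h_def power2_eq_square power_one_over field_simps)
    finally show ?thesis .
  qed
  have "summable (\<lambda>m. q 1 1 * q 2 2 * T\<^sup>2 * (1 / 2 :: real) ^ m)"
    by (intro summable_mult summable_geometric) simp
  then have "summable (\<lambda>m. prob (grid_excursion T m))"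
    by (rule summable_comparison_test'[of _ 0]) (use P in simp)
  then have "AE \<omega> in M. \<forall>\<^sub>F m in sequentially. \<omega> \<in> space M - grid_excursion T m"
    using grid_excursion_measurable[OF T] by (intro borel_cantelli_AE1) (auto simp: emeasure_eq_measure)
  then show ?thesis by eventually_elim (auto elim: eventually_mono)
qed

end

section \<open>The upper bound\<close>

context switching_diffusion
begin

definition free_surplus :: "(nat \<Rightarrow> real) \<Rightarrow> real \<Rightarrow> real \<Rightarrow> 'a \<Rightarrow> real" where
  "free_surplus \<mu> x t \<omega> = x + drift \<mu> t \<omega> + Z t \<omega>"

lemma free_surplus_measurable_F: "0 \<le> t \<Longrightarrow> free_surplus \<mu> x t \<in> borel_measurable (F t)"
  unfolding free_surplus_def
  by (intro borel_measurable_add borel_measurable_const drift_measurable_F Z_measurable_F)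

lemma AE_free_surplus_0: "AE \<omega> in M. free_surplus \<mu> x 0 \<omega> = x"
  using AE_Z_0 by eventually_elim (simp add: free_surplus_def)

lemma drift_bound:
  assumes \<omega>: "\<omega> \<in> regular" and t: "0 \<le> t"
  shows "\<bar>drift \<mu> t \<omega>\<bar> \<le> (\<bar>\<mu> 1\<bar> + \<bar>\<mu> 2\<bar>) * t"
  using drift_Lipschitz[OF \<omega> order_refl t, of \<mu> "\<bar>\<mu> 1\<bar> + \<bar>\<mu> 2\<bar>"] by simp

lemma AE_free_surplus_continuous: "AE \<omega> in M. continuous_on {0..} (\<lambda>t. free_surplus \<mu> x t \<omega>)"
  using AE_Z_continuous AE_regular
proof eventually_elim
  fix \<omega> assume Z: "continuous_on {0..} (\<lambda>t. Z t \<omega>)" and \<omega>: "\<omega> \<in> regular"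
  define C where "C = \<bar>\<mu> 1\<bar> + \<bar>\<mu> 2\<bar> + 1"
  have C: "\<bar>\<mu> 1\<bar> \<le> C" "\<bar>\<mu> 2\<bar> \<le> C" "0 \<le> C" by (auto simp: C_def)
  have L: "\<bar>drift \<mu> t \<omega> - drift \<mu> s \<omega>\<bar> \<le> C * \<bar>t - s\<bar>" if "0 \<le> s" "0 \<le> t" for s t
    using drift_Lipschitz[OF \<omega> _ _ C(1,2), of s t] drift_Lipschitz[OF \<omega> _ _ C(1,2), of t s] that
    by (cases "s \<le> t") (auto simp: abs_minus_commute)
  have "C-lipschitz_on {0..} (\<lambda>t. drift \<mu> t \<omega>)"
    using L C by (intro lipschitz_onI) (auto simp: dist_real_def)
  then have "continuous_on {0..} (\<lambda>t. drift \<mu> t \<omega>)" by (rule lipschitz_on_continuous_on)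
  then show "continuous_on {0..} (\<lambda>t. free_surplus \<mu> x t \<omega>)"
    unfolding free_surplus_def by (intro continuous_intros Z)
qed

lemma integrable_drift: "0 \<le> t \<Longrightarrow> integrable M (drift \<mu> t)"
  using AE_regular drift_bound[of _ t \<mu>] measurable_F_M[OF drift_measurable_F, of t \<mu>]
  by (intro integrable_const_bound[of _ "(\<bar>\<mu> 1\<bar> + \<bar>\<mu> 2\<bar>) * t"]) (auto elim: AE_mp)

lemma integrable_Z: "0 \<le> t \<Longrightarrow> integrable M (Z t)"
  by (intro square_integrable_integrable square_integrable_Z)

lemma integrable_free_surplus: "0 \<le> t \<Longrightarrow> integrable M (free_surplus \<mu> x t)"
  unfolding free_surplus_def
  by (intro Bochner_Integration.integrable_add integrable_drift integrable_Z) auto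

text \<open>The one-cell expansion on an event of the past. The error does not shrink with
  \<open>B\<close>, but it is quadratic in the length of the cell.\<close>

lemma drift_increment_event:
  assumes st: "0 \<le> s" "s \<le> t" and B: "B \<in> sets (F s)"
  shows "\<bar>expectation (\<lambda>\<omega>. indicator B \<omega> * (drift \<mu> t \<omega> - drift \<mu> s \<omega>)) - (t - s) *
      (\<mu> 1 * prob (B \<inter> {\<omega> \<in> space M. \<epsilon> s \<omega> = 1}) + \<mu> 2 * prob (B \<inter> {\<omega> \<in> space M. \<epsilon> s \<omega> = 2}))\<bar>
    \<le> \<bar>\<mu> 1 - \<mu> 2\<bar> * total_rate * (t - s)\<^sup>2"
proof -
  have t: "0 \<le> t" using st by simp
  have BM: "B \<in> events" using B sets_F_subset[OF st(1)] by blast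
  let ?B = "\<lambda>i. B \<inter> {\<omega> \<in> space M. \<epsilon> s \<omega> = i}"
  have Bi: "?B i \<in> events" for i using BM chain_event_M[OF st(1)] by auto
  have ind: "indicator B \<omega> * \<mu> (\<epsilon> s \<omega>) = \<mu> 1 * indicator (?B 1) \<omega> + \<mu> 2 * indicator (?B 2) \<omega>"
    if "\<omega> \<in> space M" for \<omega>
    using \<epsilon>_cases[OF st(1) that] that by (auto simp: indicator_def)
  have i\<mu>: "integrable M (\<lambda>\<omega>. indicator B \<omega> * \<mu> (\<epsilon> s \<omega>))"
    using Bi by (subst Bochner_Integration.integrable_cong[OF refl ind])
      (auto intro!: Bochner_Integration.integrable_add integrable_mult_right simp: emeasure_eq_measure)
  have "expectation (\<lambda>\<omega>. indicator B \<omega> * \<mu> (\<epsilon> s \<omega>))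
      = expectation (\<lambda>\<omega>. \<mu> 1 * indicator (?B 1) \<omega> + \<mu> 2 * indicator (?B 2) \<omega>)"
    by (intro Bochner_Integration.integral_cong refl ind)
  also have "\<dots> = \<mu> 1 * prob (?B 1) + \<mu> 2 * prob (?B 2)"
  proof -
    have "integrable M (indicator (?B i) :: 'a \<Rightarrow> real)" for i
      using Bi by (intro integrable_real_indicator) (auto simp: emeasure_eq_measure)
    then show ?thesis using Bi
      by (subst Bochner_Integration.integral_add)
        (auto simp: sets.Int_space_eq2 simp del: Int_iff)
  qed
  finally have E\<mu>: "expectation (\<lambda>\<omega>. indicator B \<omega> * \<mu> (\<epsilon> s \<omega>)) = \<mu> 1 * prob (?B 1) + \<mu> 2 * prob (?B 2)" .
  have id: "integrable M (\<lambda>\<omega>. indicator B \<omega> * (drift \<mu> t \<omega> - drift \<mu> s \<omega>))"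
    by (intro integrable_indicator_mult BM Bochner_Integration.integrable_diff integrable_drift st t)
  have "expectation (\<lambda>\<omega>. indicator B \<omega> * (drift \<mu> t \<omega> - drift \<mu> s \<omega>)) - (t - s) *
      (\<mu> 1 * prob (?B 1) + \<mu> 2 * prob (?B 2))
    = expectation (\<lambda>\<omega>. indicator B \<omega> * (drift \<mu> t \<omega> - drift \<mu> s \<omega>) - (t - s) * (indicator B \<omega> * \<mu> (\<epsilon> s \<omega>)))"
    using id i\<mu> E\<mu> by simp
  then have "\<bar>expectation (\<lambda>\<omega>. indicator B \<omega> * (drift \<mu> t \<omega> - drift \<mu> s \<omega>)) - (t - s) *
      (\<mu> 1 * prob (?B 1) + \<mu> 2 * prob (?B 2))\<bar> \<le> expectation (\<lambda>\<omega>. \<bar>indicator B \<omega> * (drift \<mu> t \<omega> - drift \<mu> s \<omega>) - (t - s) * (indicator B \<omega> * \<mu> (\<epsilon> s \<omega>))\<bar>)"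
    using integral_abs_bound by metis
  also have "\<dots> \<le> expectation (\<lambda>\<omega>. \<bar>drift \<mu> t \<omega> - drift \<mu> s \<omega> - (t - s) * \<mu> (\<epsilon> s \<omega>)\<bar>)"
  proof (rule integral_mono)
    show "integrable M (\<lambda>\<omega>. \<bar>indicator B \<omega> * (drift \<mu> t \<omega> - drift \<mu> s \<omega>) - (t - s) * (indicator B \<omega> * \<mu> (\<epsilon> s \<omega>))\<bar>)"
      by (intro integrable_abs Bochner_Integration.integrable_diff integrable_mult_right id i\<mu>)
    show "integrable M (\<lambda>\<omega>. \<bar>drift \<mu> t \<omega> - drift \<mu> s \<omega> - (t - s) * \<mu> (\<epsilon> s \<omega>)\<bar>)"
      by (rule drift_increment_approx(1)[OF st])
  qed (auto simp: indicator_def)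
  also have "\<dots> \<le> \<bar>\<mu> 1 - \<mu> 2\<bar> * total_rate * (t - s)\<^sup>2"
    by (rule drift_increment_approx(2)[OF st])
  finally show ?thesis .
qed

text \<open>The stochastic integral contributes nothing in expectation, so the one-cell expansions
  of the drift can be summed. The statement is two-sided because it serves both for bounding the
  dividends and for showing that waiting pays.\<close>

lemma stopped_free_surplus:
  fixes \<mu> :: "nat \<Rightarrow> real" and x :: real
  assumes h: "0 \<le> h" and B: "\<And>k. k < n \<Longrightarrow> B k \<in> sets (F (real k * h))"
  defines "S \<equiv> \<lambda>\<omega>. \<Sum>k<n. indicator (B k) \<omega> *
      (free_surplus \<mu> x (real (Suc k) * h) \<omega> - free_surplus \<mu> x (real k * h) \<omega>)"
  shows "integrable M S"
    and "\<bar>expectation S - (\<Sum>k<n. h * (\<mu> 1 * prob (B k \<inter> {\<omega> \<in> space M. \<epsilon> (real k * h) \<omega> = 1}) +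
        \<mu> 2 * prob (B k \<inter> {\<omega> \<in> space M. \<epsilon> (real k * h) \<omega> = 2})))\<bar>
      \<le> real n * (\<bar>\<mu> 1 - \<mu> 2\<bar> * total_rate * h\<^sup>2)"
proof -
  have st: "0 \<le> real k * h" "real k * h \<le> real (Suc k) * h" "0 \<le> real (Suc k) * h" "real (Suc k) * h - real k * h = h" for k
    using h by (auto intro!: mult_right_mono simp: algebra_simps)
  have BM: "B k \<in> events" if "k < n" for k using B[OF that] sets_F_subset[OF st(1)] by blast
  let ?d = "\<lambda>k \<omega>. indicator (B k) \<omega> * (drift \<mu> (real (Suc k) * h) \<omega> - drift \<mu> (real k * h) \<omega>)"
  let ?z = "\<lambda>k \<omega>. indicator (B k) \<omega> * (Z (real (Suc k) * h) \<omega> - Z (real k * h) \<omega>)"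
  have S: "S = (\<lambda>\<omega>. (\<Sum>k<n. ?d k \<omega>) + (\<Sum>k<n. ?z k \<omega>))"
    unfolding S_def free_surplus_def sum.distrib[symmetric]
    by (intro ext sum.cong refl) (simp add: algebra_simps)
  have id: "integrable M (?d k)" if "k < n" for k
    by (intro integrable_indicator_mult BM[OF that] Bochner_Integration.integrable_diff integrable_drift st)
  have isd: "integrable M (\<lambda>\<omega>. \<Sum>k<n. ?d k \<omega>)" by (intro Bochner_Integration.integrable_sum id) simp
  note sz = stopped_Z[of h n B, OF h B]
  have iz: "integrable M (\<lambda>\<omega>. \<Sum>k<n. ?z k \<omega>)"
    by (rule square_integrable_integrable[OF sz(2)]) auto
  show "integrable M S" unfolding S using isd iz by (rule Bochner_Integration.integrable_add)
  have "expectation (\<lambda>\<omega>. \<Sum>k<n. ?d k \<omega>) = (\<Sum>k<n. expectation (?d k))"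
    by (intro Bochner_Integration.integral_sum id) simp
  moreover have "expectation (\<lambda>\<omega>. \<Sum>k<n. ?z k \<omega>) = 0" by (rule sz(3)) auto
  ultimately have "expectation S = (\<Sum>k<n. expectation (?d k))"
    unfolding S Bochner_Integration.integral_add[OF isd iz] by simp
  then have "\<bar>expectation S - (\<Sum>k<n. h * (\<mu> 1 * prob (B k \<inter> {\<omega> \<in> space M. \<epsilon> (real k * h) \<omega> = 1}) +
        \<mu> 2 * prob (B k \<inter> {\<omega> \<in> space M. \<epsilon> (real k * h) \<omega> = 2})))\<bar>
    \<le> (\<Sum>k<n. \<bar>expectation (?d k) - h * (\<mu> 1 * prob (B k \<inter> {\<omega> \<in> space M. \<epsilon> (real k * h) \<omega> = 1}) +
        \<mu> 2 * prob (B k \<inter> {\<omega> \<in> space M. \<epsilon> (real k * h) \<omega> = 2}))\<bar>)"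
    by (simp only: sum_subtractf[symmetric] sum_abs)
  also have "\<dots> \<le> (\<Sum>k<n. \<bar>\<mu> 1 - \<mu> 2\<bar> * total_rate * h\<^sup>2)"
    using drift_increment_event[OF st(1,2) B] unfolding st(4) by (intro sum_mono) auto
  also have "\<dots> = real n * (\<bar>\<mu> 1 - \<mu> 2\<bar> * total_rate * h\<^sup>2)" by simp
  finally show "\<bar>expectation S - (\<Sum>k<n. h * (\<mu> 1 * prob (B k \<inter> {\<omega> \<in> space M. \<epsilon> (real k * h) \<omega> = 1}) +
        \<mu> 2 * prob (B k \<inter> {\<omega> \<in> space M. \<epsilon> (real k * h) \<omega> = 2})))\<bar>
      \<le> real n * (\<bar>\<mu> 1 - \<mu> 2\<bar> * total_rate * h\<^sup>2)" .
qed

end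

locale dividend_strategy = switching_diffusion M W \<epsilon> q \<sigma> Z
  for M :: "'a measure" and W \<epsilon> q \<sigma> Z +
  fixes \<mu> \<theta> :: "nat \<Rightarrow> real" and x :: real and i :: nat and D :: "real \<Rightarrow> 'a \<Rightarrow> real"
  assumes start: "AE \<omega> in M. \<epsilon> 0 \<omega> = i"
    and adapted: "0 \<le> t \<Longrightarrow> D t \<in> borel_measurable (F t)"
    and zero: "\<omega> \<in> space M \<Longrightarrow> D 0 \<omega> = 0"
    and nonneg: "\<omega> \<in> space M \<Longrightarrow> 0 \<le> t \<Longrightarrow> 0 \<le> D t \<omega>"
    and increasing: "\<omega> \<in> space M \<Longrightarrow> increasing_path (\<lambda>t. D t \<omega>)"
    and left_continuous: "\<omega> \<in> space M \<Longrightarrow> 0 < t \<Longrightarrow> continuous (at_left t) (\<lambda>s. D s \<omega>)"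
    and jumps: "AE \<omega> in M. \<forall>t\<ge>0. right_limit (\<lambda>s. D s \<omega>) t - D t \<omega>
      \<le> max 0 (free_surplus \<mu> x t \<omega> - D t \<omega> - \<theta> (\<epsilon> t \<omega>))"
    and stopped: "AE \<omega> in M. emeasure (stieltjes (\<lambda>s. D s \<omega>))
      {t. Inf (ereal ` {t. 0 \<le> t \<and> free_surplus \<mu> x t \<omega> - D t \<omega> \<le> \<theta> (\<epsilon> t \<omega>)}) < ereal t} = 0"
begin

definition excess :: "real \<Rightarrow> 'a \<Rightarrow> real" where
  "excess t \<omega> = free_surplus \<mu> x t \<omega> - D t \<omega> - \<theta> (\<epsilon> t \<omega>)"

definition alive :: "real \<Rightarrow> nat \<Rightarrow> 'a set" where
  "alive h k = {\<omega> \<in> space M. \<forall>j\<le>k. excess (real j * h) \<omega> > 0}"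

text \<open>The pathwise bound on the dividends as a random variable, with the almost sure initial
  values \<open>x\<close> and \<open>i\<close> inserted.\<close>

definition stopped_sum :: "real \<Rightarrow> nat \<Rightarrow> 'a \<Rightarrow> real" where
  "stopped_sum h n \<omega> = x - \<theta> i + (\<Sum>k<n. indicator (alive h k) \<omega> *
    (free_surplus \<mu> x (real (Suc k) * h) \<omega> - free_surplus \<mu> x (real k * h) \<omega> +
      (\<theta> 2 - \<theta> 1) * of_bool (\<epsilon> (real k * h) \<omega> = 2 \<and> \<epsilon> (real (Suc k) * h) \<omega> = 1)))"

lemma D_measurable: "0 \<le> t \<Longrightarrow> D t \<in> borel_measurable M"
  using measurable_F_M[OF adapted] by blast

lemma excess_measurable_F: "0 \<le> t \<Longrightarrow> excess t \<in> borel_measurable (F t)"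
  unfolding excess_def
  by (intro borel_measurable_diff free_surplus_measurable_F adapted chain_function_measurable_F)

lemma alive_F: "0 \<le> h \<Longrightarrow> alive h k \<in> sets (F (real k * h))"
  unfolding alive_def by (rule grid_above_measurable_F[OF excess_measurable_F])

lemma alive_M: "0 \<le> h \<Longrightarrow> alive h k \<in> events"
  using alive_F[of h k] sets_F_subset[of "real k * h"] by auto

lemma stopped_sum_split:
  "stopped_sum h n \<omega> = x - \<theta> i +
    (\<Sum>k<n. indicator (alive h k) \<omega> *
      (free_surplus \<mu> x (real (Suc k) * h) \<omega> - free_surplus \<mu> x (real k * h) \<omega>)) +
    (\<Sum>k<n. (\<theta> 2 - \<theta> 1) * (indicator (alive h k) \<omega> *
      of_bool (\<epsilon> (real k * h) \<omega> = 2 \<and> \<epsilon> (real (Suc k) * h) \<omega> = 1)))"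
  unfolding stopped_sum_def by (simp add: distrib_left sum.distrib mult_ac)

text \<open>In regime 2 the compensated jumps raise the drift to
  \<open>\<mu> 2 + (\<theta> 2 - \<theta> 1) * (- q 2 2)\<close>, which \<open>mu2\<close> makes
  nonpositive; in regime 1 it is \<open>\<mu> 1\<close>. Only the discretization error of the drift
  is left.\<close>

lemma expectation_stopped_sum:
  assumes theta: "\<theta> 1 \<le> \<theta> 2" and mu1: "\<mu> 1 \<le> 0" and mu2: "\<mu> 2 \<le> (\<theta> 1 - \<theta> 2) * (- q 2 2)"
    and h: "0 \<le> h"
  shows "integrable M (stopped_sum h n)"
    and "expectation (stopped_sum h n) \<le> x - \<theta> i + real n * (\<bar>\<mu> 1 - \<mu> 2\<bar> * total_rate * h\<^sup>2)"
proof -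
  have st: "0 \<le> real k * h" "real k * h \<le> real (Suc k) * h" "0 \<le> real (Suc k) * h" "real (Suc k) * h - real k * h = h" for k
    using h by (auto intro!: mult_right_mono simp: algebra_simps)
  define J where "J k = alive h k \<inter> {\<omega> \<in> space M. \<epsilon> (real k * h) \<omega> = 2 \<and> \<epsilon> (real (Suc k) * h) \<omega> = 1}" for k
  define p where "p k j = prob (alive h k \<inter> {\<omega> \<in> space M. \<epsilon> (real k * h) \<omega> = j})" for k j
  have JM: "J k \<in> events" for k
    unfolding J_def using alive_M[OF h] jump_event_M[OF st(1) st(3)] by auto
  have iJ: "integrable M (indicator (J k) :: 'a \<Rightarrow> real)" for k
    using JM by (intro integrable_real_indicator) (auto simp: emeasure_eq_measure)
  have ind: "indicator (alive h k) \<omega> * of_bool (\<epsilon> (real k * h) \<omega> = 2 \<and> \<epsilon> (real (Suc k) * h) \<omega> = 1)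
    = (indicator (J k) \<omega> :: real)" for k \<omega>
    by (auto simp: J_def alive_def indicator_def)
  note S = stopped_free_surplus[of h n "alive h" \<mu> x, OF h alive_F[OF h]]
  let ?S = "\<lambda>\<omega>. \<Sum>k<n. indicator (alive h k) \<omega> *
      (free_surplus \<mu> x (real (Suc k) * h) \<omega> - free_surplus \<mu> x (real k * h) \<omega>)"
  have eq: "stopped_sum h n = (\<lambda>\<omega>. x - \<theta> i + ?S \<omega> + (\<Sum>k<n. (\<theta> 2 - \<theta> 1) * indicator (J k) \<omega>))"
    unfolding stopped_sum_split ind ..
  have iJs: "integrable M (\<lambda>\<omega>. \<Sum>k<n. (\<theta> 2 - \<theta> 1) * indicator (J k) \<omega> :: real)"
    by (intro Bochner_Integration.integrable_sum integrable_mult_right iJ)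
  show "integrable M (stopped_sum h n)"
    unfolding eq using S(1) iJs by (intro Bochner_Integration.integrable_add) auto
  have "expectation (\<lambda>\<omega>. \<Sum>k<n. (\<theta> 2 - \<theta> 1) * indicator (J k) \<omega>)
      = (\<Sum>k<n. expectation (\<lambda>\<omega>. (\<theta> 2 - \<theta> 1) * indicator (J k) \<omega>))"
    by (intro Bochner_Integration.integral_sum integrable_mult_right iJ)
  also have "\<dots> = (\<Sum>k<n. (\<theta> 2 - \<theta> 1) * prob (J k))"
    using JM by (simp add: sets.Int_space_eq2)
  finally have EJ: "expectation (\<lambda>\<omega>. \<Sum>k<n. (\<theta> 2 - \<theta> 1) * indicator (J k) \<omega>)
      = (\<Sum>k<n. (\<theta> 2 - \<theta> 1) * prob (J k))" .
  have iSx: "integrable M (\<lambda>\<omega>. x - \<theta> i + ?S \<omega>)"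
    using S(1) by (intro Bochner_Integration.integrable_add) auto
  have "expectation (\<lambda>\<omega>. x - \<theta> i + ?S \<omega>) = x - \<theta> i + expectation ?S"
    by (subst Bochner_Integration.integral_add) (use S(1) in \<open>auto simp: prob_space\<close>)
  then have "expectation (stopped_sum h n) = x - \<theta> i + expectation ?S + (\<Sum>k<n. (\<theta> 2 - \<theta> 1) * prob (J k))"
    unfolding eq Bochner_Integration.integral_add[OF iSx iJs] EJ by simp
  also have "\<dots> \<le> x - \<theta> i + ((\<Sum>k<n. h * (\<mu> 1 * p k 1 + \<mu> 2 * p k 2)) + real n * (\<bar>\<mu> 1 - \<mu> 2\<bar> * total_rate * h\<^sup>2))
      + (\<Sum>k<n. (\<theta> 2 - \<theta> 1) * (- q 2 2 * h * p k 2))"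
  proof -
    have "expectation ?S \<le> (\<Sum>k<n. h * (\<mu> 1 * p k 1 + \<mu> 2 * p k 2)) + real n * (\<bar>\<mu> 1 - \<mu> 2\<bar> * total_rate * h\<^sup>2)"
      using S(2) unfolding p_def by linarith
    moreover have "prob (J k) \<le> - q 2 2 * h * p k 2" for k
      using jump_prob_le[OF st(1,2) alive_F[OF h], of 2 1 k] unfolding J_def p_def st(4) by simp
    then have "(\<Sum>k<n. (\<theta> 2 - \<theta> 1) * prob (J k)) \<le> (\<Sum>k<n. (\<theta> 2 - \<theta> 1) * (- q 2 2 * h * p k 2))"
      using theta by (intro sum_mono mult_left_mono) auto
    ultimately show ?thesis by linarith
  qed
  also have "\<dots> = x - \<theta> i + real n * (\<bar>\<mu> 1 - \<mu> 2\<bar> * total_rate * h\<^sup>2)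
      + (\<Sum>k<n. h * (\<mu> 1 * p k 1 + (\<mu> 2 - (\<theta> 1 - \<theta> 2) * (- q 2 2)) * p k 2))"
    by (simp add: sum.distrib[symmetric] algebra_simps)
  also have "(\<Sum>k<n. h * (\<mu> 1 * p k 1 + (\<mu> 2 - (\<theta> 1 - \<theta> 2) * (- q 2 2)) * p k 2)) \<le> 0"
  proof (rule sum_nonpos)
    fix k
    have "\<mu> 1 * p k 1 \<le> 0" using mu1 by (intro mult_nonpos_nonneg) (auto simp: p_def)
    moreover have "(\<mu> 2 - (\<theta> 1 - \<theta> 2) * (- q 2 2)) * p k 2 \<le> 0"
      using mu2 by (intro mult_nonpos_nonneg) (auto simp: p_def)
    ultimately show "h * (\<mu> 1 * p k 1 + (\<mu> 2 - (\<theta> 1 - \<theta> 2) * (- q 2 2)) * p k 2) \<le> 0"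
      using h by (intro mult_nonneg_nonpos) auto
  qed
  finally show "expectation (stopped_sum h n) \<le> x - \<theta> i + real n * (\<bar>\<mu> 1 - \<mu> 2\<bar> * total_rate * h\<^sup>2)"
    by simp
qed

text \<open>For a fixed path a fine mesh meets both requirements of the pathwise bound: excursions
  inside cells have disappeared, and uniform continuity on \<open>[0, T]\<close> makes the
  oscillation at most \<open>\<eta>\<close>. How fine it must be depends on the path.\<close>

lemma AE_dividends_le_stopped_sum:
  assumes theta: "\<theta> 1 \<le> \<theta> 2" and x: "\<theta> i < x" and T: "0 < T" and \<eta>: "0 < \<eta>"
  shows "AE \<omega> in M. \<forall>\<^sub>F m in sequentially. D T \<omega> \<le> stopped_sum (T / 2 ^ m) (2 ^ m) \<omega> + \<eta>"
  using AE_eventually_no_grid_excursion[OF less_imp_le[OF T]] AE_free_surplus_continuous[of \<mu> x]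
    AE_free_surplus_0[of \<mu> x] AE_regular start jumps stopped
proof eventually_elim
  fix \<omega>
  assume noex: "\<forall>\<^sub>F m in sequentially. \<omega> \<notin> grid_excursion T m"
    and cont: "continuous_on {0..} (\<lambda>t. free_surplus \<mu> x t \<omega>)"
    and U0: "free_surplus \<mu> x 0 \<omega> = x" and \<omega>: "\<omega> \<in> regular" and \<epsilon>0: "\<epsilon> 0 \<omega> = i"
    and jump: "\<forall>t\<ge>0. right_limit (\<lambda>s. D s \<omega>) t - D t \<omega>
      \<le> max 0 (free_surplus \<mu> x t \<omega> - D t \<omega> - \<theta> (\<epsilon> t \<omega>))"
    and null: "emeasure (stieltjes (\<lambda>s. D s \<omega>))
      {t. Inf (ereal ` {t. 0 \<le> t \<and> free_surplus \<mu> x t \<omega> - D t \<omega> \<le> \<theta> (\<epsilon> t \<omega>)}) < ereal t} = 0"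
  have sp: "\<omega> \<in> space M" by (rule regular_space[OF \<omega>])
  have "uniformly_continuous_on {0..T} (\<lambda>t. free_surplus \<mu> x t \<omega>)"
    by (intro compact_uniformly_continuous continuous_on_subset[OF cont]) auto
  then obtain d where d: "d > 0" "\<And>s r. s \<in> {0..T} \<Longrightarrow> r \<in> {0..T} \<Longrightarrow> \<bar>r - s\<bar> < d \<Longrightarrow>
      \<bar>free_surplus \<mu> x r \<omega> - free_surplus \<mu> x s \<omega>\<bar> < \<eta>"
    using \<eta> unfolding uniformly_continuous_on_def dist_real_def by metis
  have "(\<lambda>m. T / 2 ^ m) \<longlonglongrightarrow> 0"
    by (rule LIMSEQ_divide_realpow_zero) simp
  then have small: "\<forall>\<^sub>F m in sequentially. T / 2 ^ m < d"
    using d(1) by (rule order_tendstoD)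
  from noex small
  show "\<forall>\<^sub>F m in sequentially. D T \<omega> \<le> stopped_sum (T / 2 ^ m) (2 ^ m) \<omega> + \<eta>"
  proof eventually_elim
    fix m :: nat assume noex: "\<omega> \<notin> grid_excursion T m" and small: "T / 2 ^ m < d"
    define h where "h = T / 2 ^ m"
    define n :: nat where "n = 2 ^ m"
    have h: "0 < h" using T by (simp add: h_def)
    have nh: "real n * h = T" by (simp add: n_def h_def)
    have "D (real n * h) \<omega> \<le> free_surplus \<mu> x 0 \<omega> - \<theta> (\<epsilon> 0 \<omega>) +
      (\<Sum>k<n. of_bool (\<forall>j\<le>k. excess (real j * h) \<omega> > 0) *
        (free_surplus \<mu> x (real (Suc k) * h) \<omega> - free_surplus \<mu> x (real k * h) \<omega> +
        (\<theta> 2 - \<theta> 1) * of_bool (\<epsilon> (real k * h) \<omega> = 2 \<and> \<epsilon> (real (Suc k) * h) \<omega> = 1))) + \<eta>"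
    proof (rule dividends_le_stopped_sum[of \<theta> "\<lambda>t. \<epsilon> t \<omega>" "\<lambda>t. D t \<omega>" "\<lambda>t. free_surplus \<mu> x t \<omega>"
          "\<lambda>t. excess t \<omega>" h n \<eta>, OF theta _ increasing[OF sp] left_continuous[OF sp] _ null])
      show "\<epsilon> t \<omega> = 1 \<or> \<epsilon> t \<omega> = 2" if "0 \<le> t" for t using \<epsilon>_cases[OF that sp] .
      show "right_limit (\<lambda>t. D t \<omega>) t - D t \<omega> \<le> max 0 (free_surplus \<mu> x t \<omega> - D t \<omega> - \<theta> (\<epsilon> t \<omega>))"
        if "0 \<le> t" for t using jump that by blast
      show "excess t \<omega> = free_surplus \<mu> x t \<omega> - D t \<omega> - \<theta> (\<epsilon> t \<omega>)" for t
        by (rule excess_def)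
      show "0 < h" by fact
      show "0 < n" by (simp add: n_def)
      show "0 < excess 0 \<omega>" using x by (simp add: excess_def U0 \<epsilon>0 zero[OF sp])
      show "D 0 \<omega> = 0" by (rule zero[OF sp])
      show "\<bar>free_surplus \<mu> x s \<omega> - free_surplus \<mu> x r \<omega>\<bar> \<le> \<eta>"
        if "0 \<le> s" "s \<le> r" "r \<le> s + h" "r \<le> real n * h" for s r
        using d(2)[of r s] that small unfolding nh h_def[symmetric] by auto
      show "\<epsilon> s \<omega> = 2" if "k < n" "real k * h \<le> s" "s \<le> real (Suc k) * h" "\<epsilon> (real k * h) \<omega> = 2"
        "\<epsilon> (real (Suc k) * h) \<omega> = 2" for k s
      proof (rule not_cell_excursion[OF \<omega> _ _ that(2,3,4,5)])
        show "0 \<le> real k * h" using h by simp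
        show "\<omega> \<notin> cell_excursion (real k * h) (real (Suc k) * h)"
          using noex that(1) unfolding grid_excursion_def h_def n_def by auto
      qed
    qed
    also have "\<dots> = stopped_sum h n \<omega> + \<eta>"
      unfolding stopped_sum_def using sp by (simp add: U0 \<epsilon>0 alive_def indicator_def of_bool_def)
    finally show "D T \<omega> \<le> stopped_sum (T / 2 ^ m) (2 ^ m) \<omega> + \<eta>"
      unfolding nh by (simp add: h_def n_def)
  qed
qed

end

section \<open>Passage to vanishing mesh and infinite horizon\<close>

context dividend_strategy
begin

text \<open>Needed on paths for which the mesh is still too coarse: there the stopped sum bounds
  nothing, and its possible negative values have to be limited. The drift part has a deterministic
  bound, the martingale part one in second moment.\<close>

lemma AE_stopped_sum_lower:
  assumes theta: "\<theta> 1 \<le> \<theta> 2" and x: "\<theta> i < x" and h: "0 \<le> h"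
  shows "AE \<omega> in M. 0 \<le> stopped_sum h n \<omega> + (\<bar>\<mu> 1\<bar> + \<bar>\<mu> 2\<bar>) * (real n * h) +
    \<bar>\<Sum>k<n. indicator (alive h k) \<omega> * (Z (real (Suc k) * h) \<omega> - Z (real k * h) \<omega>)\<bar>"
  using AE_regular
proof eventually_elim
  fix \<omega> assume \<omega>: "\<omega> \<in> regular"
  define C where "C = \<bar>\<mu> 1\<bar> + \<bar>\<mu> 2\<bar>"
  define A :: "nat \<Rightarrow> real" where "A k = indicator (alive h k) \<omega>" for k
  have A: "0 \<le> A k" "A k \<le> 1" for k by (auto simp: A_def indicator_def)
  let ?S = "\<Sum>k<n. A k * (Z (real (Suc k) * h) \<omega> - Z (real k * h) \<omega>)"
  let ?R = "\<Sum>k<n. A k * (drift \<mu> (real (Suc k) * h) \<omega> - drift \<mu> (real k * h) \<omega>)"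
  let ?J = "\<Sum>k<n. (\<theta> 2 - \<theta> 1) * (A k * of_bool (\<epsilon> (real k * h) \<omega> = 2 \<and> \<epsilon> (real (Suc k) * h) \<omega> = 1))"
  have "stopped_sum h n \<omega> = x - \<theta> i + (?R + ?S) + ?J"
    unfolding stopped_sum_split A_def[symmetric] sum.distrib[symmetric] free_surplus_def
    by (simp add: algebra_simps)
  moreover have "0 \<le> ?J" using theta A by (intro sum_nonneg mult_nonneg_nonneg) auto
  moreover have "\<bar>?R\<bar> \<le> C * (real n * h)"
  proof -
    have "\<bar>?R\<bar> \<le> (\<Sum>k<n. \<bar>A k * (drift \<mu> (real (Suc k) * h) \<omega> - drift \<mu> (real k * h) \<omega>)\<bar>)"
      by (rule sum_abs)
    also have "\<dots> \<le> (\<Sum>k<n. C * h)"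
    proof (rule sum_mono)
      fix k
      have st: "0 \<le> real k * h" "real k * h \<le> real (Suc k) * h" "real (Suc k) * h - real k * h = h"
        using h by (auto intro!: mult_right_mono simp: algebra_simps)
      have "\<bar>drift \<mu> (real (Suc k) * h) \<omega> - drift \<mu> (real k * h) \<omega>\<bar> \<le> C * h"
        using drift_Lipschitz[OF \<omega> st(1,2), of \<mu> C] unfolding st(3) by (simp add: C_def)
      then have "A k * \<bar>drift \<mu> (real (Suc k) * h) \<omega> - drift \<mu> (real k * h) \<omega>\<bar> \<le> 1 * (C * h)"
        using A by (intro mult_mono) auto
      then show "\<bar>A k * (drift \<mu> (real (Suc k) * h) \<omega> - drift \<mu> (real k * h) \<omega>)\<bar> \<le> C * h"
        using A by (simp add: abs_mult)
    qed
    finally show ?thesis by (simp add: mult_ac)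
  qed
  ultimately show "0 \<le> stopped_sum h n \<omega> + (\<bar>\<mu> 1\<bar> + \<bar>\<mu> 2\<bar>) * (real n * h) +
    \<bar>\<Sum>k<n. indicator (alive h k) \<omega> * (Z (real (Suc k) * h) \<omega> - Z (real k * h) \<omega>)\<bar>"
    unfolding C_def[symmetric] A_def[symmetric] using x by linarith
qed

text \<open>On the event \<open>E m\<close> where the pathwise bound fails, the truncated dividends
  are at most \<open>c\<close>, and the lower bound on the stopped sum costs at most
  \<open>C\<close> plus the size of the martingale part. As \<open>m\<close> grows the probability
  of \<open>E m\<close> tends to 0, leaving the errors \<open>\<eta>\<close> and
  \<open>V / K\<close>.\<close>

lemma expectation_min_dividends_le:
  assumes theta: "\<theta> 1 \<le> \<theta> 2" and mu1: "\<mu> 1 \<le> 0" and mu2: "\<mu> 2 \<le> (\<theta> 1 - \<theta> 2) * (- q 2 2)"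
    and x: "\<theta> i < x" and T: "0 < T" and c: "0 \<le> c"
  shows "expectation (\<lambda>\<omega>. min (D T \<omega>) c) \<le> x - \<theta> i"
proof (rule field_le_epsilon)
  fix e :: real assume e: "0 < e"
  define V where "V = expectation (\<lambda>\<omega>. (Z T \<omega>)\<^sup>2)"
  \<comment> \<open>Half of \<open>e\<close> pays for the oscillation within cells, the other half
    for \<open>V / K\<close>; \<open>V + 1\<close> keeps \<open>K\<close> positive when
    \<open>V = 0\<close>.\<close>
  define \<eta> K where "\<eta> = e / 2" and "K = 2 * (V + 1) / e"
  have V: "0 \<le> V" by (simp add: V_def)
  have \<eta>: "0 < \<eta>" and K: "0 < K" using e V by (auto simp: \<eta>_def K_def)
  have VK: "V / K \<le> e / 2" using e V by (simp add: K_def field_simps)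
  define C where "C = (\<bar>\<mu> 1\<bar> + \<bar>\<mu> 2\<bar>) * T"
  have C: "0 \<le> C" using T by (simp add: C_def)
  define h where "h m = T / 2 ^ m" for m :: nat
  have h: "0 \<le> h m" "real (2 ^ m) * h m = T" for m using T by (auto simp: h_def)
  define G where "G m = stopped_sum (h m) (2 ^ m)" for m
  define S where "S m \<omega> = (\<Sum>k<2 ^ m. indicator (alive (h m) k) \<omega> *
      (Z (real (Suc k) * h m) \<omega> - Z (real k * h m) \<omega>))" for m \<omega>
  define E where "E m = {\<omega> \<in> space M. G m \<omega> + \<eta> < D T \<omega>}" for m
  have DM: "D T \<in> borel_measurable M" using T by (intro D_measurable) simp
  have Gi: "integrable M (G m)" for m
    unfolding G_def by (rule expectation_stopped_sum(1)[OF theta mu1 mu2 h(1)])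
  have EM: "E m \<in> events" for m
    unfolding E_def using DM borel_measurable_integrable[OF Gi[of m]] by measurable
  have S2: "square_integrable (S m)" and SV: "expectation (\<lambda>\<omega>. (S m \<omega>)\<^sup>2) \<le> V" for m
    using stopped_Z(2,4)[of "h m" "2 ^ m" "alive (h m)", OF h(1) alive_F[OF h(1)]]
    unfolding h(2) by (simp_all add: S_def[abs_def] V_def)
  have iE: "integrable M (indicator (E m) :: 'a \<Rightarrow> real)" for m
    using EM by (intro integrable_real_indicator) (auto simp: emeasure_eq_measure)
  have PE: "(\<lambda>m. prob (E m)) \<longlonglongrightarrow> 0"
  proof -
    have "(\<lambda>m. expectation (indicator (E m) :: 'a \<Rightarrow> real)) \<longlonglongrightarrow> expectation (\<lambda>_. 0 :: real)"
    proof (rule integral_dominated_convergence[where w = "\<lambda>_. 1"])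
      show "AE \<omega> in M. (\<lambda>m. indicator (E m) \<omega> :: real) \<longlonglongrightarrow> 0"
        using AE_dividends_le_stopped_sum[OF theta x T \<eta>]
      proof eventually_elim
        fix \<omega> assume "\<forall>\<^sub>F m in sequentially. D T \<omega> \<le> stopped_sum (T / 2 ^ m) (2 ^ m) \<omega> + \<eta>"
        then have "\<forall>\<^sub>F m in sequentially. (indicator (E m) \<omega> :: real) = 0"
          by eventually_elim (auto simp: E_def G_def h_def)
        then show "(\<lambda>m. indicator (E m) \<omega> :: real) \<longlonglongrightarrow> 0" by (rule tendsto_eventually)
      qed
    qed (use EM in auto)
    then show ?thesis using EM by (simp add: sets.Int_space_eq2)
  qed
  let ?b = "\<lambda>m. x - \<theta> i + real (2 ^ m) * (\<bar>\<mu> 1 - \<mu> 2\<bar> * total_rate * (h m)\<^sup>2) + \<eta> + (c + C + K) * prob (E m) + V / K"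
  have le: "expectation (\<lambda>\<omega>. min (D T \<omega>) c) \<le> ?b m" for m
  proof -
    \<comment> \<open>Outside \<open>E m\<close> the first summand is enough. On \<open>E m\<close>
      the other two compensate for a negative stopped sum, through
      \<open>\<bar>S\<bar> \<le> S^2 / K + K\<close>.\<close>
    let ?g = "\<lambda>\<omega>. (G m \<omega> + \<eta>) + (c + C + K) * indicator (E m) \<omega> + (S m \<omega>)\<^sup>2 / K"
    have i1: "integrable M (\<lambda>\<omega>. G m \<omega> + \<eta>)" by (intro Bochner_Integration.integrable_add Gi) simp
    have i2: "integrable M (\<lambda>\<omega>. (c + C + K) * indicator (E m) \<omega>)" by (intro integrable_mult_right iE)
    have i3: "integrable M (\<lambda>\<omega>. (S m \<omega>)\<^sup>2 / K)"
      using square_integrable_square[OF S2] by (intro integrable_divide) auto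
    have i12: "integrable M (\<lambda>\<omega>. (G m \<omega> + \<eta>) + (c + C + K) * indicator (E m) \<omega>)"
      using i1 i2 by (rule Bochner_Integration.integrable_add)
    have "expectation (\<lambda>\<omega>. min (D T \<omega>) c) \<le> expectation ?g"
    proof (rule integral_mono_AE)
      show "integrable M (\<lambda>\<omega>. min (D T \<omega>) c)"
      proof (rule integrable_const_bound[of _ c])
        show "AE \<omega> in M. norm (min (D T \<omega>) c) \<le> c"
          using AE_space by eventually_elim (use nonneg T c in auto)
      qed (use DM in measurable)
      show "integrable M ?g" using i12 i3 by (rule Bochner_Integration.integrable_add)
      show "AE \<omega> in M. min (D T \<omega>) c \<le> ?g \<omega>"
        using AE_stopped_sum_lower[OF theta x h(1)[of m], of "2 ^ m"] AE_space
      proof eventually_elim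
        fix \<omega> assume low: "0 \<le> stopped_sum (h m) (2 ^ m) \<omega> + (\<bar>\<mu> 1\<bar> + \<bar>\<mu> 2\<bar>) * (real (2 ^ m) * h m) +
          \<bar>\<Sum>k<2 ^ m. indicator (alive (h m) k) \<omega> * (Z (real (Suc k) * h m) \<omega> - Z (real k * h m) \<omega>)\<bar>"
          and sp: "\<omega> \<in> space M"
        have low': "0 \<le> G m \<omega> + C + \<bar>S m \<omega>\<bar>"
          using low unfolding h(2) by (simp add: G_def S_def C_def)
        have sq: "\<bar>S m \<omega>\<bar> \<le> (S m \<omega>)\<^sup>2 / K + K"
        proof -
          have "0 \<le> (\<bar>S m \<omega>\<bar> - K)\<^sup>2" by simp
          then have "2 * K * \<bar>S m \<omega>\<bar> \<le> (S m \<omega>)\<^sup>2 + K\<^sup>2"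
            by (simp add: power2_diff algebra_simps)
          moreover have "0 \<le> K * \<bar>S m \<omega>\<bar>" using K by simp
          ultimately have "K * \<bar>S m \<omega>\<bar> \<le> (S m \<omega>)\<^sup>2 + K\<^sup>2" by linarith
          then show ?thesis using K by (simp add: field_simps power2_eq_square)
        qed
        have sq0: "0 \<le> (S m \<omega>)\<^sup>2 / K" using K by simp
        show "min (D T \<omega>) c \<le> ?g \<omega>"
        proof (cases "\<omega> \<in> E m")
          case True
          then show ?thesis using low' sq \<eta> by simp
        next
          case False
          then have "D T \<omega> \<le> G m \<omega> + \<eta>" using sp by (simp add: E_def)
          then show ?thesis using False sq0 by simp
        qed
      qed
    qed
    also have "\<dots> = expectation (G m) + \<eta> + (c + C + K) * prob (E m) + expectation (\<lambda>\<omega>. (S m \<omega>)\<^sup>2) / K"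
      unfolding Bochner_Integration.integral_add[OF i12 i3] Bochner_Integration.integral_add[OF i1 i2]
      using Gi EM by (simp add: prob_space sets.Int_space_eq2)
    also have "\<dots> \<le> ?b m"
      using expectation_stopped_sum(2)[OF theta mu1 mu2 h(1)[of m], of "2 ^ m"] divide_right_mono[OF SV[of m], of K] K
      unfolding G_def by linarith
    finally show ?thesis .
  qed
  have "?b \<longlonglongrightarrow> x - \<theta> i + 0 + \<eta> + (c + C + K) * 0 + V / K"
  proof (intro tendsto_add tendsto_const tendsto_mult PE)
    have "(\<lambda>m. \<bar>\<mu> 1 - \<mu> 2\<bar> * total_rate * T\<^sup>2 / 2 ^ m) \<longlonglongrightarrow> 0"
      by (rule LIMSEQ_divide_realpow_zero) simp
    moreover have "real (2 ^ m) * (\<bar>\<mu> 1 - \<mu> 2\<bar> * total_rate * (h m)\<^sup>2) = \<bar>\<mu> 1 - \<mu> 2\<bar> * total_rate * T\<^sup>2 / 2 ^ m" for m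
      by (simp add: h_def power2_eq_square field_simps)
    ultimately show "(\<lambda>m. real (2 ^ m) * (\<bar>\<mu> 1 - \<mu> 2\<bar> * total_rate * (h m)\<^sup>2)) \<longlonglongrightarrow> 0" by simp
  qed
  then have "expectation (\<lambda>\<omega>. min (D T \<omega>) c) \<le> x - \<theta> i + 0 + \<eta> + (c + C + K) * 0 + V / K"
    using le by (intro LIMSEQ_le_const) auto
  then show "expectation (\<lambda>\<omega>. min (D T \<omega>) c) \<le> x - \<theta> i + e" using VK unfolding \<eta>_def by linarith
qed

text \<open>Monotone convergence removes the truncation, which stood in for the integrability of
  \<open>D T\<close> that is only established here.\<close>

lemma nn_integral_dividends_le:
  assumes theta: "\<theta> 1 \<le> \<theta> 2" and mu1: "\<mu> 1 \<le> 0" and mu2: "\<mu> 2 \<le> (\<theta> 1 - \<theta> 2) * (- q 2 2)"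
    and x: "\<theta> i < x" and T: "0 \<le> T"
  shows "(\<integral>\<^sup>+\<omega>. ennreal (D T \<omega>) \<partial>M) \<le> ennreal (x - \<theta> i)"
proof (cases "T = 0")
  case True
  then have "(\<integral>\<^sup>+\<omega>. ennreal (D T \<omega>) \<partial>M) = (\<integral>\<^sup>+\<omega>. 0 \<partial>M)"
    using zero by (intro nn_integral_cong) simp
  then show ?thesis by simp
next
  case False
  then have T: "0 < T" using T by simp
  have DM: "D T \<in> borel_measurable M" using T by (intro D_measurable) simp
  have "(\<integral>\<^sup>+\<omega>. ennreal (D T \<omega>) \<partial>M) = (\<integral>\<^sup>+\<omega>. (SUP n::nat. ennreal (min (D T \<omega>) (real n))) \<partial>M)"
  proof (rule nn_integral_cong)
    fix \<omega>
    obtain n :: nat where n: "D T \<omega> \<le> real n" using real_arch_simple by blast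
    show "ennreal (D T \<omega>) = (SUP n::nat. ennreal (min (D T \<omega>) (real n)))"
    proof (rule antisym)
      show "ennreal (D T \<omega>) \<le> (SUP n::nat. ennreal (min (D T \<omega>) (real n)))"
        using n by (intro SUP_upper2[of n]) (auto simp: min_absorb1)
      show "(SUP n::nat. ennreal (min (D T \<omega>) (real n))) \<le> ennreal (D T \<omega>)"
        by (intro SUP_least ennreal_leI) simp
    qed
  qed
  also have "\<dots> = (SUP n::nat. \<integral>\<^sup>+\<omega>. ennreal (min (D T \<omega>) (real n)) \<partial>M)"
    using DM by (intro nn_integral_monotone_convergence_SUP)
      (auto simp: incseq_def le_fun_def intro!: ennreal_leI min.mono)
  also have "\<dots> \<le> ennreal (x - \<theta> i)"
  proof (rule SUP_least)
    fix n :: nat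
    have int: "integrable M (\<lambda>\<omega>. min (D T \<omega>) (real n))"
    proof (rule integrable_const_bound[of _ "real n"])
      show "AE \<omega> in M. norm (min (D T \<omega>) (real n)) \<le> real n"
        using AE_space by eventually_elim (use nonneg T in auto)
    qed (use DM in measurable)
    have "AE \<omega> in M. 0 \<le> min (D T \<omega>) (real n)"
      using AE_space by eventually_elim (use nonneg T in auto)
    then have "(\<integral>\<^sup>+\<omega>. ennreal (min (D T \<omega>) (real n)) \<partial>M) = ennreal (expectation (\<lambda>\<omega>. min (D T \<omega>) (real n)))"
      by (rule nn_integral_eq_integral[OF int])
    also have "\<dots> \<le> ennreal (x - \<theta> i)"
      by (intro ennreal_leI expectation_min_dividends_le assms T) simp
    finally show "(\<integral>\<^sup>+\<omega>. ennreal (min (D T \<omega>) (real n)) \<partial>M) \<le> ennreal (x - \<theta> i)" .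
  qed
  finally show ?thesis .
qed

text \<open>Above the threshold this is monotone convergence in time. At or below it the right-hand
  side is 0: bankruptcy occurs at time 0, the jump there is limited to 0, and nothing is paid
  later.\<close>

lemma nn_integral_stieltjes_le:
  assumes theta: "\<theta> 1 \<le> \<theta> 2" and mu1: "\<mu> 1 \<le> 0" and mu2: "\<mu> 2 \<le> (\<theta> 1 - \<theta> 2) * (- q 2 2)"
  shows "(\<integral>\<^sup>+\<omega>. emeasure (stieltjes (\<lambda>s. D s \<omega>)) {0..} \<partial>M) \<le> ennreal (x - \<theta> i)"
proof (cases "\<theta> i < x")
  case True
  have "(\<integral>\<^sup>+\<omega>. emeasure (stieltjes (\<lambda>s. D s \<omega>)) {0..} \<partial>M) \<le> (\<integral>\<^sup>+\<omega>. (SUP n::nat. ennreal (D (real n) \<omega>)) \<partial>M)"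
    by (intro nn_integral_mono increasing_path.emeasure_stieltjes_nonneg increasing zero)
  also have "\<dots> = (SUP n::nat. \<integral>\<^sup>+\<omega>. ennreal (D (real n) \<omega>) \<partial>M)"
  proof (rule nn_integral_monotone_convergence_SUP_AE)
    show "AE \<omega> in M. ennreal (D (real n) \<omega>) \<le> ennreal (D (real (Suc n)) \<omega>)" for n
      using AE_space
    proof eventually_elim
      fix \<omega> assume "\<omega> \<in> space M"
      then have "mono_on {0..} (\<lambda>t. D t \<omega>)" using increasing by (simp add: increasing_path_def)
      then show "ennreal (D (real n) \<omega>) \<le> ennreal (D (real (Suc n)) \<omega>)"
        by (intro ennreal_leI) (auto simp: mono_on_def)
    qed
    show "(\<lambda>\<omega>. ennreal (D (real n) \<omega>)) \<in> borel_measurable M" for n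
      using D_measurable[of "real n"] by simp
  qed
  also have "\<dots> \<le> ennreal (x - \<theta> i)"
    by (intro SUP_least nn_integral_dividends_le assms True) simp
  finally show ?thesis .
next
  case False
  have "AE \<omega> in M. emeasure (stieltjes (\<lambda>s. D s \<omega>)) {0..} = 0"
    using AE_free_surplus_0[of \<mu> x] start jumps stopped AE_space
  proof eventually_elim
    fix \<omega>
    assume U0: "free_surplus \<mu> x 0 \<omega> = x" and \<epsilon>0: "\<epsilon> 0 \<omega> = i"
      and jump: "\<forall>t\<ge>0. right_limit (\<lambda>s. D s \<omega>) t - D t \<omega>
        \<le> max 0 (free_surplus \<mu> x t \<omega> - D t \<omega> - \<theta> (\<epsilon> t \<omega>))"
      and null: "emeasure (stieltjes (\<lambda>s. D s \<omega>))
        {t. Inf (ereal ` {t. 0 \<le> t \<and> free_surplus \<mu> x t \<omega> - D t \<omega> \<le> \<theta> (\<epsilon> t \<omega>)}) < ereal t} = 0"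
      and sp: "\<omega> \<in> space M"
    interpret path: increasing_path "\<lambda>t. D t \<omega>" by (rule increasing[OF sp])
    have "Inf (ereal ` {t. 0 \<le> t \<and> free_surplus \<mu> x t \<omega> - D t \<omega> \<le> \<theta> (\<epsilon> t \<omega>)}) \<le> ereal 0"
      using False by (intro Inf_lower imageI) (simp add: U0 \<epsilon>0 zero[OF sp])
    then have sub: "{t. 0 < t} \<subseteq> {t. Inf (ereal ` {t. 0 \<le> t \<and> free_surplus \<mu> x t \<omega> - D t \<omega> \<le> \<theta> (\<epsilon> t \<omega>)}) < ereal t}"
      by (auto intro: le_less_trans)
    have m: "{t. Inf (ereal ` {t. 0 \<le> t \<and> free_surplus \<mu> x t \<omega> - D t \<omega> \<le> \<theta> (\<epsilon> t \<omega>)}) < ereal t} \<in> sets borel"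
      by measurable
    have "emeasure (stieltjes (\<lambda>s. D s \<omega>)) {t. 0 < t} \<le> 0"
      unfolding null[symmetric] using sub m by (intro emeasure_mono) auto
    then have null0: "emeasure (stieltjes (\<lambda>s. D s \<omega>)) {t. 0 < t} = 0" by simp
    have F0: "path.right_version 0 - path.right_version (- 1) \<le> 0"
      using jump[rule_format, of 0] False by (simp add: path.right_version_def U0 \<epsilon>0 zero[OF sp])
    have "emeasure (stieltjes (\<lambda>s. D s \<omega>)) {0..}
        \<le> emeasure (stieltjes (\<lambda>s. D s \<omega>)) ({-1<..0} \<union> {t. 0 < t})"
      by (intro emeasure_mono) auto
    also have "\<dots> \<le> emeasure (stieltjes (\<lambda>s. D s \<omega>)) {-1<..0} + emeasure (stieltjes (\<lambda>s. D s \<omega>)) {t. 0 < t}"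
      by (intro emeasure_subadditive) auto
    also have "\<dots> = 0"
      using F0 by (simp add: null0 path.emeasure_stieltjes_Ioc ennreal_neg)
    finally show "emeasure (stieltjes (\<lambda>s. D s \<omega>)) {0..} = 0" by simp
  qed
  then have "(\<integral>\<^sup>+\<omega>. emeasure (stieltjes (\<lambda>s. D s \<omega>)) {0..} \<partial>M) = (\<integral>\<^sup>+\<omega>. 0 \<partial>M)"
    by (rule nn_integral_cong_AE)
  then show ?thesis by simp
qed

end

section \<open>Waiting above the threshold\<close>

text \<open>The sum freezes \<open>y\<close> at the first index whose value is at most
  \<open>\<eta>\<close>. Index \<open>n\<close> itself is not tested, in accordance with survival
  being required only before the payment.\<close>

lemma stopped_telescope:
  fixes y :: "nat \<Rightarrow> real" and \<eta> :: real
  defines "s \<equiv> \<lambda>n. y 0 + (\<Sum>k<n. of_bool (\<forall>j\<le>k. y j > \<eta>) * (y (Suc k) - y k))"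
  shows "(\<forall>j<n. y j > \<eta>) \<Longrightarrow> s n = y n" and "\<not> (\<forall>j<n. y j > \<eta>) \<Longrightarrow> s n \<le> \<eta>"
proof -
  have "((\<forall>j<n. y j > \<eta>) \<longrightarrow> s n = y n) \<and> (\<not> (\<forall>j<n. y j > \<eta>) \<longrightarrow> s n \<le> \<eta>)"
  proof (induction n)
    case 0
    show ?case by (simp add: s_def)
  next
    case (Suc n)
    have s: "s (Suc n) = s n + of_bool (\<forall>j\<le>n. y j > \<eta>) * (y (Suc n) - y n)"
      unfolding s_def sum.lessThan_Suc by simp
    have "(\<forall>j<Suc n. y j > \<eta>) \<longleftrightarrow> (\<forall>j\<le>n. y j > \<eta>)" "(\<forall>j\<le>n. y j > \<eta>) \<longleftrightarrow> (\<forall>j<n. y j > \<eta>) \<and> y n > \<eta>"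
      by (auto simp: less_Suc_eq_le le_less)
    then show ?case using Suc unfolding s by auto
  qed
  then show "(\<forall>j<n. y j > \<eta>) \<Longrightarrow> s n = y n" "\<not> (\<forall>j<n. y j > \<eta>) \<Longrightarrow> s n \<le> \<eta>" by auto
qed

locale waiting_strategy = switching_diffusion M W \<epsilon> q \<sigma> Z
  for M :: "'a measure" and W \<epsilon> q \<sigma> Z +
  fixes \<mu> \<theta> :: "nat \<Rightarrow> real" and x :: real
  assumes start: "AE \<omega> in M. \<epsilon> 0 \<omega> = 2"
    and theta: "\<theta> 1 < \<theta> 2"
    and above: "\<theta> 2 < x"
begin

definition excess :: "real \<Rightarrow> 'a \<Rightarrow> real" where
  "excess t \<omega> = free_surplus \<mu> x t \<omega> - \<theta> (\<epsilon> t \<omega>)"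

text \<open>
  Dyadic times suffice by right-continuity. The uniform lower bound makes the event measurable at
  time \<open>h\<close>.
\<close>

definition survival :: "real \<Rightarrow> 'a set" where
  "survival h = {\<omega> \<in> space M. \<exists>j::nat. \<forall>n k::nat. k < 2 ^ n \<longrightarrow>
    1 / real (Suc j) \<le> excess (real k * (h / 2 ^ n)) \<omega>}"

text \<open>Survival tests times before \<open>h\<close> only, so the excess at \<open>h\<close> may
  be negative, for instance after a jump of the threshold at \<open>h\<close>; hence the positive
  part.\<close>

definition terminal_payment :: "real \<Rightarrow> 'a \<Rightarrow> real" where
  "terminal_payment h \<omega> = indicator (survival h) \<omega> * max 0 (excess h \<omega>)"

text \<open>Stated for the surplus, independently of the regime: as \<open>\<theta> 2\<close> is the
  higher threshold, staying within half of the initial distance keeps the excess above the other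
  half in both regimes.\<close>

definition near_start :: "real \<Rightarrow> 'a set" where
  "near_start h = {\<omega> \<in> space M. \<forall>n k::nat. k \<le> 2 ^ n \<longrightarrow>
    \<bar>free_surplus \<mu> x (real k * (h / 2 ^ n)) \<omega> - x\<bar> < (x - \<theta> 2) / 2}"

lemma excess_measurable_F: "0 \<le> t \<Longrightarrow> excess t \<in> borel_measurable (F t)"
  unfolding excess_def
  by (intro borel_measurable_diff free_surplus_measurable_F chain_function_measurable_F)

lemma integrable_excess: "0 \<le> t \<Longrightarrow> integrable M (excess t)"
proof -
  assume t: "0 \<le> t"
  have "integrable M (\<lambda>\<omega>. \<theta> (\<epsilon> t \<omega>))"
  proof (rule integrable_const_bound[of _ "\<bar>\<theta> 1\<bar> + \<bar>\<theta> 2\<bar>"])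
    show "AE \<omega> in M. norm (\<theta> (\<epsilon> t \<omega>)) \<le> \<bar>\<theta> 1\<bar> + \<bar>\<theta> 2\<bar>"
      using AE_space
    proof eventually_elim
      fix \<omega> assume "\<omega> \<in> space M"
      then show "norm (\<theta> (\<epsilon> t \<omega>)) \<le> \<bar>\<theta> 1\<bar> + \<bar>\<theta> 2\<bar>" using \<epsilon>_cases[OF t, of \<omega>] by auto
    qed
  qed (use measurable_F_M[OF chain_function_measurable_F[OF t] t, of \<theta>] in simp)
  then show ?thesis
    unfolding excess_def by (intro Bochner_Integration.integrable_diff integrable_free_surplus t)
qed

lemma survival_F:
  assumes h: "0 \<le> h" shows "survival h \<in> sets (F h)"
proof -
  have ev: "{\<omega> \<in> space (F h). k < 2 ^ n \<longrightarrow> 1 / real (Suc j) \<le> excess (real k * (h / 2 ^ n)) \<omega>} \<in> sets (F h)"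
    for n k j :: nat
  proof (cases "k < 2 ^ n")
    case True
    then have "real k \<le> 2 ^ n" by (metis less_imp_le of_nat_le_iff of_nat_numeral of_nat_power)
    then have "real k * (h / 2 ^ n) \<le> 2 ^ n * (h / 2 ^ n)" using h by (intro mult_right_mono) auto
    then have "excess (real k * (h / 2 ^ n)) \<in> borel_measurable (F h)"
      using h by (intro measurable_F_mono[OF excess_measurable_F]) auto
    then have "{\<omega> \<in> space (F h). 1 / real (Suc j) \<le> excess (real k * (h / 2 ^ n)) \<omega>} \<in> sets (F h)"
      by measurable
    then show ?thesis using True by simp
  qed (use sets.top[of "F h"] in simp)
  define S where "S j n k = {\<omega> \<in> space (F h). k < 2 ^ n \<longrightarrow>
    1 / real (Suc j) \<le> excess (real k * (h / 2 ^ n)) \<omega>}" for j n k :: nat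
  have S: "S j n k \<in> sets (F h)" for j n k unfolding S_def by (rule ev)
  have "(\<Inter>k. S j n k) \<in> sets (F h)" for j n
    using S by (intro sets.countable_INT) auto
  then have "(\<Inter>n. \<Inter>k. S j n k) \<in> sets (F h)" for j
    by (intro sets.countable_INT) auto
  then have "(\<Union>j. \<Inter>n. \<Inter>k. S j n k) \<in> sets (F h)"
    by (intro sets.countable_UN) auto
  moreover have "survival h = (\<Union>j. \<Inter>n. \<Inter>k. S j n k)"
    by (auto simp: survival_def S_def)
  ultimately show ?thesis by simp
qed

lemma survival_M: "0 \<le> h \<Longrightarrow> survival h \<in> events"
  using survival_F sets_F_subset by blast

lemma near_start_M:
  assumes h: "0 \<le> h" shows "near_start h \<in> events"
proof -
  have ev: "{\<omega> \<in> space M. k \<le> 2 ^ n \<longrightarrow> \<bar>free_surplus \<mu> x (real k * (h / 2 ^ n)) \<omega> - x\<bar> < (x - \<theta> 2) / 2} \<in> events"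
    for n k :: nat
  proof -
    have [measurable]: "free_surplus \<mu> x (real k * (h / 2 ^ n)) \<in> borel_measurable M"
      using h by (intro measurable_F_M[OF free_surplus_measurable_F]) auto
    show ?thesis by measurable
  qed
  define S where "S n k = {\<omega> \<in> space M. k \<le> 2 ^ n \<longrightarrow>
    \<bar>free_surplus \<mu> x (real k * (h / 2 ^ n)) \<omega> - x\<bar> < (x - \<theta> 2) / 2}" for n k :: nat
  have S: "S n k \<in> events" for n k unfolding S_def by (rule ev)
  have "(\<Inter>k. S n k) \<in> events" for n
    using S by (intro sets.countable_INT) auto
  then have "(\<Inter>n. \<Inter>k. S n k) \<in> events"
    by (intro sets.countable_INT) auto
  moreover have "near_start h = (\<Inter>n. \<Inter>k. S n k)"
    by (auto simp: near_start_def S_def)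
  ultimately show ?thesis by simp
qed

lemma terminal_payment_nonneg: "0 \<le> terminal_payment h \<omega>"
  by (simp add: terminal_payment_def)

lemma terminal_payment_measurable_F: "0 \<le> h \<Longrightarrow> terminal_payment h \<in> borel_measurable (F h)"
  unfolding terminal_payment_def using survival_F[of h] excess_measurable_F[of h] by simp

lemma integrable_terminal_payment:
  assumes h: "0 \<le> h" shows "integrable M (terminal_payment h)"
  unfolding terminal_payment_def
  by (intro integrable_indicator_mult survival_M Bochner_Integration.integrable_max
    integrable_excess h integrable_const)

text \<open>At a dyadic time shortly after \<open>t\<close> the regime is still that of
  \<open>t\<close> and the excess is at least \<open>1 / (j + 1)\<close>. Continuity changes the
  surplus by less than this margin, so positivity at \<open>t\<close> is strict.\<close>

lemma AE_survival_excess_pos: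
  assumes h: "0 < h"
  shows "AE \<omega> in M. \<omega> \<in> survival h \<longrightarrow> (\<forall>t. 0 \<le> t \<and> t < h \<longrightarrow> 0 < excess t \<omega>)"
  using AE_regular AE_free_surplus_continuous[of \<mu> x]
proof eventually_elim
  fix \<omega> assume \<omega>: "\<omega> \<in> regular" and cont: "continuous_on {0..} (\<lambda>t. free_surplus \<mu> x t \<omega>)"
  show "\<omega> \<in> survival h \<longrightarrow> (\<forall>t. 0 \<le> t \<and> t < h \<longrightarrow> 0 < excess t \<omega>)"
  proof (intro impI allI, elim conjE)
    fix t assume "\<omega> \<in> survival h" and t: "0 \<le> t" "t < h"
    then obtain j where j: "\<And>n k::nat. k < 2 ^ n \<Longrightarrow> 1 / real (Suc j) \<le> excess (real k * (h / 2 ^ n)) \<omega>"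
      unfolding survival_def by blast
    obtain d where d: "d > 0" "\<And>r. t \<le> r \<Longrightarrow> r < t + d \<Longrightarrow> \<epsilon> r \<omega> = \<epsilon> t \<omega>"
      using regular_right_constant[OF \<omega> t(1)] by blast
    have "\<exists>d'>0. \<forall>r\<in>{0..}. dist r t < d' \<longrightarrow>
        dist (free_surplus \<mu> x r \<omega>) (free_surplus \<mu> x t \<omega>) < 1 / real (Suc j)"
      using cont[unfolded continuous_on_iff, rule_format, of t "1 / real (Suc j)"] t by simp
    then obtain d' where d': "d' > 0" "\<And>r. 0 \<le> r \<Longrightarrow> \<bar>r - t\<bar> < d' \<Longrightarrow>
        \<bar>free_surplus \<mu> x r \<omega> - free_surplus \<mu> x t \<omega>\<bar> < 1 / real (Suc j)"
      by (auto simp: dist_real_def)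
    \<comment> \<open>The bound \<open>h - t\<close> keeps the dyadic time strictly before
      \<open>h\<close>, where survival tests it.\<close>
    define m where "m = min (min d d') (h - t)"
    have m: "0 < m" "m \<le> d" "m \<le> d'" "m \<le> h - t" using d(1) d'(1) t by (auto simp: m_def)
    obtain l k where k: "k \<le> 2 ^ l" "t \<le> 0 + real k * ((h - 0) / 2 ^ l)" "0 + real k * ((h - 0) / 2 ^ l) < t + m"
      using dyadic_above[OF t m(1)] by blast
    define r where "r = real k * (h / 2 ^ l)"
    have r: "t \<le> r" "r < t + m" using k by (auto simp: r_def)
    have "k < 2 ^ l"
    proof (rule ccontr)
      assume "\<not> k < 2 ^ l"
      then have "k = 2 ^ l" using k(1) by simp
      then have "r = h" by (simp add: r_def)
      then show False using r m by simp
    qed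
    from j[OF this] have "1 / real (Suc j) \<le> free_surplus \<mu> x r \<omega> - \<theta> (\<epsilon> t \<omega>)"
      using d(2)[of r] r m unfolding excess_def r_def[symmetric] by simp
    then show "0 < excess t \<omega>" using d'(2)[of r] r m t unfolding excess_def by auto
  qed
qed

lemma prob_near_start: "(\<lambda>m. prob (near_start (1 / real (Suc m)))) \<longlonglongrightarrow> 1"
proof -
  have M: "near_start (1 / real (Suc m)) \<in> events" for m by (rule near_start_M) simp
  have "(\<lambda>m. expectation (indicator (near_start (1 / real (Suc m))) :: 'a \<Rightarrow> real)) \<longlonglongrightarrow> expectation (\<lambda>_. 1 :: real)"
  proof (rule integral_dominated_convergence[where w = "\<lambda>_. 1"])
    show "AE \<omega> in M. (\<lambda>m. indicator (near_start (1 / real (Suc m))) \<omega> :: real) \<longlonglongrightarrow> 1"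
      using AE_free_surplus_continuous[of \<mu> x] AE_free_surplus_0[of \<mu> x] AE_space
    proof eventually_elim
      fix \<omega> assume cont: "continuous_on {0..} (\<lambda>t. free_surplus \<mu> x t \<omega>)"
        and U0: "free_surplus \<mu> x 0 \<omega> = x" and sp: "\<omega> \<in> space M"
      have "\<exists>d>0. \<forall>r\<in>{0..}. dist r 0 < d \<longrightarrow> dist (free_surplus \<mu> x r \<omega>) (free_surplus \<mu> x 0 \<omega>) < (x - \<theta> 2) / 2"
        using cont[unfolded continuous_on_iff, rule_format, of 0 "(x - \<theta> 2) / 2"] above by simp
      then obtain d where d: "d > 0" "\<And>r. 0 \<le> r \<Longrightarrow> r < d \<Longrightarrow> \<bar>free_surplus \<mu> x r \<omega> - x\<bar> < (x - \<theta> 2) / 2"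
        using U0 by (auto simp: dist_real_def)
      have "(\<lambda>m. 1 / real (Suc m)) \<longlonglongrightarrow> 0" by (rule LIMSEQ_Suc[OF lim_1_over_n])
      then have "\<forall>\<^sub>F m in sequentially. 1 / real (Suc m) < d" using d(1) by (rule order_tendstoD)
      then have "\<forall>\<^sub>F m in sequentially. (indicator (near_start (1 / real (Suc m))) \<omega> :: real) = 1"
      proof eventually_elim
        fix m assume m: "1 / real (Suc m) < d"
        have "\<bar>free_surplus \<mu> x (real k * (1 / real (Suc m) / 2 ^ n)) \<omega> - x\<bar> < (x - \<theta> 2) / 2" if "k \<le> 2 ^ n" for n k :: nat
        proof (rule d(2))
          have "real k \<le> 2 ^ n" using that by (metis of_nat_le_iff of_nat_numeral of_nat_power)
          then have "real k * (1 / real (Suc m) / 2 ^ n) \<le> 2 ^ n * (1 / real (Suc m) / 2 ^ n)"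
            by (intro mult_right_mono) auto
          then show "real k * (1 / real (Suc m) / 2 ^ n) < d" using m by simp
        qed simp
        then show "(indicator (near_start (1 / real (Suc m))) \<omega> :: real) = 1"
          using sp by (simp add: near_start_def)
      qed
      then show "(\<lambda>m. indicator (near_start (1 / real (Suc m))) \<omega> :: real) \<longlonglongrightarrow> 1"
        by (rule tendsto_eventually)
    qed
  qed (use M in auto)
  then show ?thesis using M by (simp add: sets.Int_space_eq2 prob_space)
qed

definition alive :: "real \<Rightarrow> real \<Rightarrow> nat \<Rightarrow> 'a set" where
  "alive \<eta> g k = {\<omega> \<in> space M. \<forall>j\<le>k. \<eta> < excess (real j * g) \<omega>}"

lemma alive_F: "0 \<le> g \<Longrightarrow> alive \<eta> g k \<in> sets (F (real k * g))"
  unfolding alive_def by (rule grid_above_measurable_F[OF excess_measurable_F])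

lemma alive_M: "0 \<le> g \<Longrightarrow> alive \<eta> g k \<in> events"
  using alive_F[of g \<eta> k] sets_F_subset[of "real k * g"] by auto

definition stopped_excess :: "real \<Rightarrow> real \<Rightarrow> nat \<Rightarrow> 'a \<Rightarrow> real" where
  "stopped_excess \<eta> g n \<omega> = excess 0 \<omega> +
    (\<Sum>k<n. indicator (alive \<eta> g k) \<omega> * (excess (real (Suc k) * g) \<omega> - excess (real k * g) \<omega>))"

lemma prob_regime_1:
  assumes "0 \<le> t"
  shows "prob {\<omega> \<in> space M. \<epsilon> t \<omega> = 1} \<le> total_rate * t"
proof -
  have "prob {\<omega> \<in> space M. \<epsilon> t \<omega> = 1} \<le> prob {\<omega> \<in> space M. \<epsilon> t \<omega> \<noteq> \<epsilon> 0 \<omega>}"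
  proof (rule finite_measure_mono_AE)
    show "AE \<omega> in M. \<omega> \<in> {\<omega> \<in> space M. \<epsilon> t \<omega> = 1} \<longrightarrow> \<omega> \<in> {\<omega> \<in> space M. \<epsilon> t \<omega> \<noteq> \<epsilon> 0 \<omega>}"
      using start by eventually_elim auto
    have "{\<omega> \<in> space M. \<epsilon> t \<omega> \<noteq> \<epsilon> 0 \<omega>} = {\<omega> \<in> space M. \<epsilon> 0 \<omega> = 1 \<and> \<epsilon> t \<omega> = 2} \<union>
        {\<omega> \<in> space M. \<epsilon> 0 \<omega> = 2 \<and> \<epsilon> t \<omega> = 1}"
      using \<epsilon>_cases[OF order_refl] \<epsilon>_cases[OF assms] by fastforce
    then show "{\<omega> \<in> space M. \<epsilon> t \<omega> \<noteq> \<epsilon> 0 \<omega>} \<in> events"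
      using jump_event_M[OF order_refl assms] by simp
  qed
  also have "\<dots> \<le> total_rate * (t - 0)"
    using assms by (intro prob_change_le) auto
  finally show ?thesis by simp
qed

text \<open>A rise of the threshold reduces the excess and is bounded by the most probable case; a
  fall increases it and is bounded by what is guaranteed. Hence an upper and a lower jump
  bound.\<close>

lemma threshold_increment:
  assumes g: "0 \<le> g" and B: "B \<in> sets (F s)" and s: "0 \<le> s"
  shows "integrable M (\<lambda>\<omega>. indicator B \<omega> * (\<theta> (\<epsilon> (s + g) \<omega>) - \<theta> (\<epsilon> s \<omega>)))"
    and "expectation (\<lambda>\<omega>. indicator B \<omega> * (\<theta> (\<epsilon> (s + g) \<omega>) - \<theta> (\<epsilon> s \<omega>)))
      \<le> (\<theta> 2 - \<theta> 1) * (- q 1 1 * g * prob (B \<inter> {\<omega> \<in> space M. \<epsilon> s \<omega> = 1})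
        - - q 2 2 * (g - total_rate * g\<^sup>2) * prob (B \<inter> {\<omega> \<in> space M. \<epsilon> s \<omega> = 2}))"
proof -
  have st: "s \<le> s + g" "0 \<le> s + g" using g s by auto
  have BM: "B \<in> events" using B sets_F_subset[OF s] by blast
  let ?J = "\<lambda>i j. B \<inter> {\<omega> \<in> space M. \<epsilon> s \<omega> = i \<and> \<epsilon> (s + g) \<omega> = j}"
  have JM: "?J i j \<in> events" for i j using BM jump_event_M[OF s st(2)] by auto
  have iJ: "integrable M (indicator (?J i j) :: 'a \<Rightarrow> real)" for i j
    using JM by (intro integrable_real_indicator) (auto simp: emeasure_eq_measure)
  have eq: "indicator B \<omega> * (\<theta> (\<epsilon> (s + g) \<omega>) - \<theta> (\<epsilon> s \<omega>))
      = (\<theta> 2 - \<theta> 1) * (indicator (?J 1 2) \<omega> - indicator (?J 2 1) \<omega>)" if "\<omega> \<in> space M" for \<omega>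
    using \<epsilon>_cases[OF s that] \<epsilon>_cases[OF st(2) that] that by (auto simp: indicator_def)
  have iJJ: "integrable M (\<lambda>\<omega>. (\<theta> 2 - \<theta> 1) * (indicator (?J 1 2) \<omega> - indicator (?J 2 1) \<omega>))"
    by (intro integrable_mult_right Bochner_Integration.integrable_diff iJ)
  show "integrable M (\<lambda>\<omega>. indicator B \<omega> * (\<theta> (\<epsilon> (s + g) \<omega>) - \<theta> (\<epsilon> s \<omega>)))"
    using iJJ by (subst Bochner_Integration.integrable_cong[OF refl eq])
  have "expectation (\<lambda>\<omega>. indicator B \<omega> * (\<theta> (\<epsilon> (s + g) \<omega>) - \<theta> (\<epsilon> s \<omega>)))
      = expectation (\<lambda>\<omega>. (\<theta> 2 - \<theta> 1) * (indicator (?J 1 2) \<omega> - indicator (?J 2 1) \<omega>))"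
    by (intro Bochner_Integration.integral_cong refl eq)
  also have "\<dots> = (\<theta> 2 - \<theta> 1) * expectation (\<lambda>\<omega>. indicator (?J 1 2) \<omega> - indicator (?J 2 1) \<omega>)"
    by (rule integral_mult_right_zero)
  also have "expectation (\<lambda>\<omega>. indicator (?J 1 2) \<omega> - indicator (?J 2 1) \<omega> :: real) = prob (?J 1 2) - prob (?J 2 1)"
    unfolding Bochner_Integration.integral_diff[OF iJ iJ] using JM by (simp add: sets.Int_space_eq2)
  also have "(\<theta> 2 - \<theta> 1) * (prob (?J 1 2) - prob (?J 2 1)) \<le> (\<theta> 2 - \<theta> 1) * (- q 1 1 * g * prob (B \<inter> {\<omega> \<in> space M. \<epsilon> s \<omega> = 1})
        - - q 2 2 * (g - total_rate * g\<^sup>2) * prob (B \<inter> {\<omega> \<in> space M. \<epsilon> s \<omega> = 2}))"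
    using jump_prob_le[OF s st(1) B, of 1 2] jump_prob_ge[OF s st(1) B, of 2 1] theta
    by (intro mult_left_mono diff_mono) auto
  finally show "expectation (\<lambda>\<omega>. indicator B \<omega> * (\<theta> (\<epsilon> (s + g) \<omega>) - \<theta> (\<epsilon> s \<omega>)))
      \<le> (\<theta> 2 - \<theta> 1) * (- q 1 1 * g * prob (B \<inter> {\<omega> \<in> space M. \<epsilon> s \<omega> = 1})
        - - q 2 2 * (g - total_rate * g\<^sup>2) * prob (B \<inter> {\<omega> \<in> space M. \<epsilon> s \<omega> = 2}))" .
qed

text \<open>The drift of the excess in regime 2, that is, the amount by which the condition of the
  theorem is violated.\<close>

definition gain_rate :: real where
  "gain_rate = \<mu> 2 - (\<theta> 1 - \<theta> 2) * (- q 2 2)"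

text \<open>In regime 1 the excess drifts down at a rate of at most
  \<open>\<bar>\<mu> 1\<bar> + (\<theta> 2 - \<theta> 1) * (- q 1 1)\<close> and the credited
  \<open>gain_rate\<close> is missed. Up to time \<open>h\<close> that regime has probability at
  most \<open>total_rate * h\<close>, so the total loss is quadratic in \<open>h\<close>.\<close>

definition loss_rate :: real where
  "loss_rate = (gain_rate + \<bar>\<mu> 1\<bar> + (\<theta> 2 - \<theta> 1) * (- q 1 1)) * total_rate"

text \<open>The second-order errors per cell: from the expansion of the drift and from the lower
  jump bound.\<close>

definition mesh_constant :: real where
  "mesh_constant = \<bar>\<mu> 1 - \<mu> 2\<bar> * total_rate + (\<theta> 2 - \<theta> 1) * (- q 2 2) * total_rate"

text \<open>A cell is counted at least on \<open>near_start\<close>, in whichever regime, and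
  \<open>gain_rate\<close> is credited for it; the cells spent in regime 1 are then corrected
  through \<open>loss_rate\<close>. The mesh error carries an extra factor \<open>g\<close> and
  vanishes while \<open>h\<close> stays fixed.\<close>

lemma expectation_stopped_excess:
  fixes n :: nat
  assumes c: "0 < gain_rate" and h: "0 < h" and \<eta>: "\<eta> \<le> (x - \<theta> 2) / 2"
  defines "g \<equiv> h / 2 ^ n" and "N \<equiv> 2 ^ n"
  shows "integrable M (stopped_excess \<eta> g N)"
    and "expectation (stopped_excess \<eta> g N) \<ge>
      x - \<theta> 2 + h * gain_rate * prob (near_start h) - loss_rate * h\<^sup>2 - mesh_constant * h * g"
proof -
  have g: "0 \<le> g" "0 < g" using h by (auto simp: g_def)
  have Ng: "real N * g = h" by (simp add: N_def g_def)
  have st: "0 \<le> real k * g" "0 \<le> real (Suc k) * g" "real (Suc k) * g = real k * g + g" for k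
    using g by (auto simp: algebra_simps)
  define p where "p k j = prob (alive \<eta> g k \<inter> {\<omega> \<in> space M. \<epsilon> (real k * g) \<omega> = j})" for k j
  have p0: "0 \<le> p k j" for k j by (simp add: p_def)
  let ?U = "\<lambda>\<omega>. \<Sum>k<N. indicator (alive \<eta> g k) \<omega> *
      (free_surplus \<mu> x (real (Suc k) * g) \<omega> - free_surplus \<mu> x (real k * g) \<omega>)"
  let ?t = "\<lambda>k \<omega>. indicator (alive \<eta> g k) \<omega> * (\<theta> (\<epsilon> (real k * g + g) \<omega>) - \<theta> (\<epsilon> (real k * g) \<omega>))"
  have eq: "stopped_excess \<eta> g N = (\<lambda>\<omega>. excess 0 \<omega> + ?U \<omega> - (\<Sum>k<N. ?t k \<omega>))"
    unfolding stopped_excess_def add_diff_eq[symmetric] sum_subtractf[symmetric]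
    by (intro ext arg_cong2[where f = "(+)"] sum.cong refl) (simp add: excess_def st(3) algebra_simps)
  note U = stopped_free_surplus[of g N "alive \<eta> g" \<mu> x, OF g(1) alive_F[OF g(1)]]
  have it: "integrable M (?t k)" for k
    by (rule threshold_increment(1)[OF g(1) alive_F[OF g(1)] st(1)])
  have its: "integrable M (\<lambda>\<omega>. \<Sum>k<N. ?t k \<omega>)" by (intro Bochner_Integration.integrable_sum it)
  have i0: "integrable M (excess 0)" by (rule integrable_excess) simp
  have iU: "integrable M (\<lambda>\<omega>. excess 0 \<omega> + ?U \<omega>)" using i0 U(1) by (rule Bochner_Integration.integrable_add)
  show "integrable M (stopped_excess \<eta> g N)"
    unfolding eq using iU its by (rule Bochner_Integration.integrable_diff)
  have E0: "expectation (excess 0) = x - \<theta> 2"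
  proof -
    have "AE \<omega> in M. excess 0 \<omega> = x - \<theta> 2"
      using AE_free_surplus_0[of \<mu> x] start by eventually_elim (simp add: excess_def)
    then have "expectation (excess 0) = expectation (\<lambda>_. x - \<theta> 2)"
      using measurable_F_M[OF excess_measurable_F] by (intro integral_cong_AE) auto
    then show ?thesis by (simp add: prob_space)
  qed
  have Et: "expectation (\<lambda>\<omega>. \<Sum>k<N. ?t k \<omega>) = (\<Sum>k<N. expectation (?t k))"
    by (intro Bochner_Integration.integral_sum it)
  have "expectation (stopped_excess \<eta> g N) = x - \<theta> 2 + expectation ?U - (\<Sum>k<N. expectation (?t k))"
    unfolding eq Bochner_Integration.integral_diff[OF iU its] Bochner_Integration.integral_add[OF i0 U(1)] E0 Et ..
  also have "\<dots> \<ge> x - \<theta> 2 + ((\<Sum>k<N. g * (\<mu> 1 * p k 1 + \<mu> 2 * p k 2)) - real N * (\<bar>\<mu> 1 - \<mu> 2\<bar> * total_rate * g\<^sup>2))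
      - (\<Sum>k<N. (\<theta> 2 - \<theta> 1) * (- q 1 1 * g * p k 1 - - q 2 2 * (g - total_rate * g\<^sup>2) * p k 2))"
  proof -
    have "expectation ?U \<ge> (\<Sum>k<N. g * (\<mu> 1 * p k 1 + \<mu> 2 * p k 2)) - real N * (\<bar>\<mu> 1 - \<mu> 2\<bar> * total_rate * g\<^sup>2)"
      using U(2) unfolding p_def by linarith
    moreover have "(\<Sum>k<N. expectation (?t k)) \<le>
        (\<Sum>k<N. (\<theta> 2 - \<theta> 1) * (- q 1 1 * g * p k 1 - - q 2 2 * (g - total_rate * g\<^sup>2) * p k 2))"
      unfolding p_def by (intro sum_mono threshold_increment(2)[OF g(1) alive_F[OF g(1)] st(1)])
    ultimately show ?thesis by linarith
  qed
  finally have E1: "expectation (stopped_excess \<eta> g N) \<ge> x - \<theta> 2 - real N * (\<bar>\<mu> 1 - \<mu> 2\<bar> * total_rate * g\<^sup>2)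
      + (\<Sum>k<N. g * (\<mu> 1 * p k 1 + \<mu> 2 * p k 2) -
          (\<theta> 2 - \<theta> 1) * (- q 1 1 * g * p k 1 - - q 2 2 * (g - total_rate * g\<^sup>2) * p k 2))"
    by (simp add: sum_subtractf)
  have "(\<Sum>k<N. g * (\<mu> 1 * p k 1 + \<mu> 2 * p k 2) -
          (\<theta> 2 - \<theta> 1) * (- q 1 1 * g * p k 1 - - q 2 2 * (g - total_rate * g\<^sup>2) * p k 2))
      \<ge> (\<Sum>k<N. g * (gain_rate * prob (near_start h) - loss_rate * h) - (\<theta> 2 - \<theta> 1) * (- q 2 2) * total_rate * g\<^sup>2)"
  proof (rule sum_mono)
    fix k assume "k \<in> {..<N}"
    then have k: "k < N" by simp
    have sub: "near_start h \<subseteq> alive \<eta> g k"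
    proof
      fix \<omega> assume \<omega>: "\<omega> \<in> near_start h"
      then have sp: "\<omega> \<in> space M" by (simp add: near_start_def)
      have "\<eta> < excess (real j * g) \<omega>" if "j \<le> k" for j
      proof -
        have "j \<le> 2 ^ n" using that k by (simp add: N_def)
        then have "\<bar>free_surplus \<mu> x (real j * g) \<omega> - x\<bar> < (x - \<theta> 2) / 2"
          using \<omega> by (simp add: near_start_def g_def)
        moreover have "\<theta> (\<epsilon> (real j * g) \<omega>) \<le> \<theta> 2" using \<epsilon>_cases[OF st(1) sp, of j] theta by auto
        ultimately show ?thesis using \<eta> by (simp add: excess_def abs_if field_simps split: if_splits)
      qed
      then show "\<omega> \<in> alive \<eta> g k" using sp by (simp add: alive_def)
    qed
    have BM: "alive \<eta> g k \<in> events" by (rule alive_M[OF g(1)])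
    have "prob (near_start h) \<le> prob (alive \<eta> g k)" by (rule finite_measure_mono[OF sub BM])
    also have "prob (alive \<eta> g k) = p k 1 + p k 2"
    proof -
      have "alive \<eta> g k = (alive \<eta> g k \<inter> {\<omega> \<in> space M. \<epsilon> (real k * g) \<omega> = 1}) \<union>
          (alive \<eta> g k \<inter> {\<omega> \<in> space M. \<epsilon> (real k * g) \<omega> = 2})"
        using \<epsilon>_cases[OF st(1)] by (auto simp: alive_def)
      moreover have "prob ((alive \<eta> g k \<inter> {\<omega> \<in> space M. \<epsilon> (real k * g) \<omega> = 1}) \<union>
          (alive \<eta> g k \<inter> {\<omega> \<in> space M. \<epsilon> (real k * g) \<omega> = 2})) = p k 1 + p k 2"
        unfolding p_def using BM chain_event_M[OF st(1)] by (intro finite_measure_Union) auto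
      ultimately show ?thesis by simp
    qed
    finally have P: "prob (near_start h) \<le> p k 1 + p k 2" .
    have p1: "p k 1 \<le> total_rate * h"
    proof -
      have "p k 1 \<le> prob {\<omega> \<in> space M. \<epsilon> (real k * g) \<omega> = 1}"
        unfolding p_def using chain_event_M[OF st(1)] by (intro finite_measure_mono) auto
      also have "\<dots> \<le> total_rate * (real k * g)" by (rule prob_regime_1[OF st(1)])
      also have "\<dots> \<le> total_rate * h"
        unfolding Ng[symmetric] using total_rate_pos k g by (intro mult_left_mono mult_right_mono) auto
      finally show ?thesis .
    qed
    define b where "b = (\<theta> 2 - \<theta> 1) * (- q 2 2) * total_rate"
    define L where "L = gain_rate + \<bar>\<mu> 1\<bar> + (\<theta> 2 - \<theta> 1) * (- q 1 1)"
    have b: "0 \<le> b" unfolding b_def using theta rate_neg[of 2] total_rate_pos by (intro mult_nonneg_nonneg) auto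
    have L: "0 \<le> L" unfolding L_def using theta rate_neg[of 1] c by (intro add_nonneg_nonneg mult_nonneg_nonneg) auto
    \<comment> \<open>Regime 1 is first credited with \<open>gain_rate\<close> as well, so that the
      sum \<open>p k 1 + p k 2\<close>, bounded below by \<open>near_start\<close>, appears;
      \<open>L * p k 1\<close> takes the credit back.\<close>
    have "g * (\<mu> 1 * p k 1 + \<mu> 2 * p k 2) -
          (\<theta> 2 - \<theta> 1) * (- q 1 1 * g * p k 1 - - q 2 2 * (g - total_rate * g\<^sup>2) * p k 2)
      = g * (gain_rate * (p k 1 + p k 2) - L * p k 1) + g * (\<mu> 1 + \<bar>\<mu> 1\<bar>) * p k 1 - b * g\<^sup>2 * p k 2"
      by (simp add: gain_rate_def L_def b_def algebra_simps)
    also have "\<dots> \<ge> g * (gain_rate * prob (near_start h) - L * (total_rate * h)) + 0 - b * g\<^sup>2 * 1"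
    proof (intro diff_mono add_mono mult_left_mono)
      show "0 \<le> g * (\<mu> 1 + \<bar>\<mu> 1\<bar>) * p k 1" using g p0 by (intro mult_nonneg_nonneg) auto
      show "p k 2 \<le> 1" by (simp add: p_def)
    qed (use P p1 L b c g in auto)
    finally show "g * (gain_rate * prob (near_start h) - loss_rate * h) - (\<theta> 2 - \<theta> 1) * (- q 2 2) * total_rate * g\<^sup>2
      \<le> g * (\<mu> 1 * p k 1 + \<mu> 2 * p k 2) -
          (\<theta> 2 - \<theta> 1) * (- q 1 1 * g * p k 1 - - q 2 2 * (g - total_rate * g\<^sup>2) * p k 2)"
      by (simp add: b_def L_def loss_rate_def mult_ac)
  qed
  also have "(\<Sum>k<N. g * (gain_rate * prob (near_start h) - loss_rate * h) - (\<theta> 2 - \<theta> 1) * (- q 2 2) * total_rate * g\<^sup>2)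
      = (real N * g) * (gain_rate * prob (near_start h) - loss_rate * h)
        - (real N * g) * ((\<theta> 2 - \<theta> 1) * (- q 2 2) * total_rate * g)"
    by (simp add: power2_eq_square algebra_simps)
  finally have E2: "(\<Sum>k<N. g * (\<mu> 1 * p k 1 + \<mu> 2 * p k 2) -
          (\<theta> 2 - \<theta> 1) * (- q 1 1 * g * p k 1 - - q 2 2 * (g - total_rate * g\<^sup>2) * p k 2))
     \<ge> h * (gain_rate * prob (near_start h) - loss_rate * h) - h * ((\<theta> 2 - \<theta> 1) * (- q 2 2) * total_rate * g)"
    unfolding Ng .
  have "real N * (\<bar>\<mu> 1 - \<mu> 2\<bar> * total_rate * g\<^sup>2) = (real N * g) * (\<bar>\<mu> 1 - \<mu> 2\<bar> * total_rate * g)"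
    by (simp add: power2_eq_square)
  then have E3: "real N * (\<bar>\<mu> 1 - \<mu> 2\<bar> * total_rate * g\<^sup>2) = h * (\<bar>\<mu> 1 - \<mu> 2\<bar> * total_rate * g)"
    unfolding Ng .
  have "x - \<theta> 2 + h * gain_rate * prob (near_start h) - loss_rate * h\<^sup>2 - mesh_constant * h * g
    = x - \<theta> 2 - h * (\<bar>\<mu> 1 - \<mu> 2\<bar> * total_rate * g) + (h * (gain_rate * prob (near_start h) - loss_rate * h)
      - h * ((\<theta> 2 - \<theta> 1) * (- q 2 2) * total_rate * g))"
    by (simp add: mesh_constant_def power2_eq_square algebra_simps)
  also have "\<dots> \<le> expectation (stopped_excess \<eta> g N)" using E1 E2 unfolding E3 by linarith
  finally show "expectation (stopped_excess \<eta> g N) \<ge>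
      x - \<theta> 2 + h * gain_rate * prob (near_start h) - loss_rate * h\<^sup>2 - mesh_constant * h * g" .
qed

text \<open>A path stopped on the grid has stopped excess at most \<open>\<eta>\<close>; a path that
  stays above \<open>\<eta>\<close> on the grid has stopped excess \<open>excess h\<close>, which
  exceeds the payment only if survival fails or the value is negative. The correction for failed
  survival vanishes with the mesh, and \<open>\<eta>\<close> goes to 0 last.\<close>

lemma expectation_terminal_payment:
  assumes c: "0 < gain_rate" and h: "0 < h"
  shows "expectation (terminal_payment h) \<ge> x - \<theta> 2 + h * gain_rate * prob (near_start h) - loss_rate * h\<^sup>2"
proof -
  let ?r = "x - \<theta> 2 + h * gain_rate * prob (near_start h) - loss_rate * h\<^sup>2"
  have main: "?r - \<eta> \<le> expectation (terminal_payment h)" if \<eta>: "0 < \<eta>" "\<eta> \<le> (x - \<theta> 2) / 2" for \<eta>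
  proof -
    \<comment> \<open>Paths that look alive on the grid although survival fails. The index
      \<open>2 ^ n - 1\<close> is the last grid time before \<open>h\<close>.\<close>
    define Q where "Q n = alive \<eta> (h / 2 ^ n) (2 ^ n - 1) - survival h" for n :: nat
    have QM: "Q n \<in> events" for n
      unfolding Q_def using alive_M[of "h / 2 ^ n"] survival_M[of h] h by auto
    have ih: "integrable M (excess h)" using integrable_excess[of h] h by simp
    have iQ: "integrable M (\<lambda>\<omega>. indicator (Q n) \<omega> * \<bar>excess h \<omega>\<bar>)" for n
      by (intro integrable_indicator_mult QM integrable_abs ih)
    have lim: "(\<lambda>n. expectation (\<lambda>\<omega>. indicator (Q n) \<omega> * \<bar>excess h \<omega>\<bar>)) \<longlonglongrightarrow> expectation (\<lambda>_. 0 :: real)"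
    proof (rule integral_dominated_convergence[where w = "\<lambda>\<omega>. \<bar>excess h \<omega>\<bar>"])
      show "integrable M (\<lambda>\<omega>. \<bar>excess h \<omega>\<bar>)" using ih by (rule integrable_abs)
      show "(\<lambda>\<omega>. indicator (Q n) \<omega> * \<bar>excess h \<omega>\<bar>) \<in> borel_measurable M" for n
        using iQ by (rule borel_measurable_integrable)
      show "AE \<omega> in M. norm (indicator (Q n) \<omega> * \<bar>excess h \<omega>\<bar>) \<le> \<bar>excess h \<omega>\<bar>" for n
        by (intro always_eventually) (auto simp: indicator_def)
      show "AE \<omega> in M. (\<lambda>n. indicator (Q n) \<omega> * \<bar>excess h \<omega>\<bar>) \<longlonglongrightarrow> 0"
        using AE_space
      proof eventually_elim
        fix \<omega> assume sp: "\<omega> \<in> space M"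
        have "\<forall>\<^sub>F n in sequentially. indicator (Q n) \<omega> * \<bar>excess h \<omega>\<bar> = 0"
        proof (cases "\<omega> \<in> survival h")
          case True
          then show ?thesis by (simp add: Q_def)
        next
          case False
          \<comment> \<open>Without survival every margin is violated somewhere, in particular one
            below \<open>\<eta>\<close>. The dyadic time of the violation belongs to all finer
            grids, so from then on the path is outside \<open>Q n\<close>.\<close>
          obtain j :: nat where j: "inverse (real (Suc j)) < \<eta>" using reals_Archimedean[OF \<eta>(1)] by blast
          have "\<not> (\<forall>n k::nat. k < 2 ^ n \<longrightarrow> 1 / real (Suc j) \<le> excess (real k * (h / 2 ^ n)) \<omega>)"
            using False sp unfolding survival_def by blast
          then obtain l k :: nat where k: "k < 2 ^ l" "excess (real k * (h / 2 ^ l)) \<omega> < 1 / real (Suc j)"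
            unfolding not_all not_imp not_le by blast
          have "\<omega> \<notin> Q n" if n: "l \<le> n" for n
          proof -
            have pw: "(2::nat) ^ n = 2 ^ l * 2 ^ (n - l)" using n by (simp add: power_add[symmetric])
            have "k * 2 ^ (n - l) < 2 ^ n" using k(1) unfolding pw by simp
            then have "k * 2 ^ (n - l) \<le> 2 ^ n - 1" by simp
            moreover have "real (k * 2 ^ (n - l)) * (h / 2 ^ n) = real k * (h / 2 ^ l)"
            proof -
              have "(2::real) ^ n = 2 ^ l * 2 ^ (n - l)" using n by (simp add: power_add[symmetric])
              then show ?thesis by simp
            qed
            then have "\<not> \<eta> < excess (real (k * 2 ^ (n - l)) * (h / 2 ^ n)) \<omega>"
              using k(2) j by (simp add: inverse_eq_divide)
            ultimately show ?thesis unfolding Q_def alive_def by blast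
          qed
          then have "\<forall>\<^sub>F n in sequentially. \<omega> \<notin> Q n"
            unfolding eventually_sequentially by blast
          then show ?thesis by eventually_elim simp
        qed
        then show "(\<lambda>n. indicator (Q n) \<omega> * \<bar>excess h \<omega>\<bar>) \<longlonglongrightarrow> 0" by (rule tendsto_eventually)
      qed
    qed simp
    have le: "?r - mesh_constant * h * (h / 2 ^ n) - \<eta> - expectation (\<lambda>\<omega>. indicator (Q n) \<omega> * \<bar>excess h \<omega>\<bar>)
      \<le> expectation (terminal_payment h)" for n
    proof -
      define g where "g = h / 2 ^ n"
      define N :: nat where "N = 2 ^ n"
      have Ng: "real N * g = h" by (simp add: N_def g_def)
      note X = expectation_stopped_excess[OF c h \<eta>(2), of n, folded g_def N_def]
      have iX: "integrable M (\<lambda>\<omega>. stopped_excess \<eta> g N \<omega> - \<eta>)"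
        by (intro Bochner_Integration.integrable_diff X(1)) simp
      have "expectation (\<lambda>\<omega>. stopped_excess \<eta> g N \<omega> - \<eta> - indicator (Q n) \<omega> * \<bar>excess h \<omega>\<bar>)
        \<le> expectation (terminal_payment h)"
      proof (rule integral_mono)
        show "integrable M (\<lambda>\<omega>. stopped_excess \<eta> g N \<omega> - \<eta> - indicator (Q n) \<omega> * \<bar>excess h \<omega>\<bar>)"
          using iX iQ by (rule Bochner_Integration.integrable_diff)
        show "integrable M (terminal_payment h)" using h by (intro integrable_terminal_payment) simp
        fix \<omega> assume sp: "\<omega> \<in> space M"
        have X: "stopped_excess \<eta> g N \<omega> = excess (real 0 * g) \<omega> + (\<Sum>k<N. of_bool (\<forall>j\<le>k. excess (real j * g) \<omega> > \<eta>) *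
            (excess (real (Suc k) * g) \<omega> - excess (real k * g) \<omega>))"
          using sp by (simp add: stopped_excess_def alive_def indicator_def of_bool_def)
        note T = stopped_telescope[of N \<eta> "\<lambda>k. excess (real k * g) \<omega>", folded X]
        show "stopped_excess \<eta> g N \<omega> - \<eta> - indicator (Q n) \<omega> * \<bar>excess h \<omega>\<bar> \<le> terminal_payment h \<omega>"
        proof (cases "\<forall>j<N. excess (real j * g) \<omega> > \<eta>")
          case True
          have X': "stopped_excess \<eta> g N \<omega> = excess h \<omega>" using T(1)[OF True] unfolding Ng .
          show ?thesis
          proof (cases "\<omega> \<in> survival h")
            case True
            then show ?thesis using X' \<eta> by (simp add: terminal_payment_def Q_def)
          next
            case False
            have "\<omega> \<in> alive \<eta> g (N - 1)"
            proof -
              have "j < N" if "j \<le> N - 1" for j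
              proof -
                have "0 < N" by (simp add: N_def)
                then show ?thesis using that by simp
              qed
              then show ?thesis using True sp by (simp add: alive_def)
            qed
            then have "\<omega> \<in> Q n" using False by (simp add: Q_def g_def N_def)
            then show ?thesis using X' \<eta> False by (simp add: terminal_payment_def)
          qed
        next
          case False
          have "0 \<le> indicator (Q n) \<omega> * \<bar>excess h \<omega>\<bar>" by simp
          then show ?thesis using T(2)[OF False] terminal_payment_nonneg[of h \<omega>] by linarith
        qed
      qed
      also have "expectation (\<lambda>\<omega>. stopped_excess \<eta> g N \<omega> - \<eta> - indicator (Q n) \<omega> * \<bar>excess h \<omega>\<bar>)
          = expectation (stopped_excess \<eta> g N) - \<eta> - expectation (\<lambda>\<omega>. indicator (Q n) \<omega> * \<bar>excess h \<omega>\<bar>)"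
        unfolding Bochner_Integration.integral_diff[OF iX iQ] using X(1) by (simp add: prob_space)
      finally show ?thesis using X(2) by (simp add: g_def)
    qed
    have "(\<lambda>n. mesh_constant * h * (h / 2 ^ n)) \<longlonglongrightarrow> mesh_constant * h * 0"
      by (intro tendsto_mult tendsto_const LIMSEQ_divide_realpow_zero) simp
    then have "(\<lambda>n. ?r - mesh_constant * h * (h / 2 ^ n) - \<eta> - expectation (\<lambda>\<omega>. indicator (Q n) \<omega> * \<bar>excess h \<omega>\<bar>))
        \<longlonglongrightarrow> ?r - mesh_constant * h * 0 - \<eta> - expectation (\<lambda>_. 0 :: real)"
      by (intro tendsto_diff tendsto_const lim)
    then have "?r - mesh_constant * h * 0 - \<eta> - expectation (\<lambda>_. 0 :: real) \<le> expectation (terminal_payment h)"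
      using le by (intro LIMSEQ_le_const2) auto
    then show ?thesis by simp
  qed
  show ?thesis
  proof (rule field_le_epsilon)
    fix e :: real assume e: "0 < e"
    define \<eta> where "\<eta> = min e ((x - \<theta> 2) / 2)"
    have "0 < \<eta>" using e above by (simp add: \<eta>_def)
    moreover have "\<eta> \<le> (x - \<theta> 2) / 2" unfolding \<eta>_def by (rule min.cobounded2)
    moreover have "\<eta> \<le> e" unfolding \<eta>_def by (rule min.cobounded1)
    ultimately show "?r \<le> expectation (terminal_payment h) + e" using main[of \<eta>] by linarith
  qed
qed

text \<open>To first order, waiting for \<open>h\<close> gains \<open>gain_rate * h\<close>, while
  discounting costs \<open>\<rho> * (x - \<theta> 2) * h\<close>; the choice of \<open>x\<close>
  makes the cost half of the gain. A small \<open>h\<close> also makes the loss and the doubt about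
  \<open>near_start\<close> negligible.\<close>

lemma discounted_payment_exceeds:
  assumes c: "0 < gain_rate" and \<rho>: "0 < \<rho>" and x: "x - \<theta> 2 = gain_rate / (2 * \<rho>)"
  shows "\<exists>h>0. x - \<theta> 2 < exp (- \<rho> * h) * expectation (terminal_payment h)"
proof -
  define h where "h m = 1 / real (Suc m)" for m
  define \<beta> where "\<beta> m = gain_rate * prob (near_start (h m)) - loss_rate * h m" for m
  have h0: "h \<longlonglongrightarrow> 0" unfolding h_def by (rule LIMSEQ_Suc[OF lim_1_over_n])
  have P: "(\<lambda>m. prob (near_start (h m))) \<longlonglongrightarrow> 1" unfolding h_def by (rule prob_near_start)
  have "\<beta> \<longlonglongrightarrow> gain_rate * 1 - loss_rate * 0"
    unfolding \<beta>_def by (intro tendsto_diff tendsto_mult tendsto_const P h0)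
  then have \<beta>: "\<beta> \<longlonglongrightarrow> gain_rate" by simp
  have "(\<lambda>m. \<beta> m - \<rho> * (x - \<theta> 2) - \<rho> * h m * \<beta> m) \<longlonglongrightarrow> gain_rate - \<rho> * (x - \<theta> 2) - \<rho> * 0 * gain_rate"
    by (intro tendsto_diff tendsto_mult tendsto_const \<beta> h0)
  moreover have "gain_rate - \<rho> * (x - \<theta> 2) - \<rho> * 0 * gain_rate = gain_rate / 2"
    using \<rho> by (simp add: x)
  ultimately have "(\<lambda>m. \<beta> m - \<rho> * (x - \<theta> 2) - \<rho> * h m * \<beta> m) \<longlonglongrightarrow> gain_rate / 2" by simp
  then have "\<forall>\<^sub>F m in sequentially. 0 < \<beta> m - \<rho> * (x - \<theta> 2) - \<rho> * h m * \<beta> m"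
    by (rule order_tendstoD(1)) (use c in simp)
  moreover have "\<forall>\<^sub>F m in sequentially. 0 < \<beta> m"
    by (rule order_tendstoD(1)[OF \<beta> c])
  ultimately have "\<forall>\<^sub>F m in sequentially. 0 < \<beta> m \<and> 0 < \<beta> m - \<rho> * (x - \<theta> 2) - \<rho> * h m * \<beta> m"
    by eventually_elim simp
  then obtain m where m: "0 < \<beta> m" "0 < \<beta> m - \<rho> * (x - \<theta> 2) - \<rho> * h m * \<beta> m"
    by (auto simp: eventually_sequentially)
  have hm: "0 < h m" by (simp add: h_def)
  let ?A = "x - \<theta> 2 + h m * \<beta> m"
  have A: "0 \<le> ?A" using above hm m by simp
  \<comment> \<open>By \<open>1 - \<rho> * h \<le> exp (- \<rho> * h)\<close> it suffices that
    \<open>(1 - \<rho> * h) * (x - \<theta> 2 + h * \<beta>)\<close> exceeds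
    \<open>x - \<theta> 2\<close>; the difference of the two, divided by \<open>h\<close>, is the
    bracket.\<close>
  have "x - \<theta> 2 < x - \<theta> 2 + h m * (\<beta> m - \<rho> * (x - \<theta> 2) - \<rho> * h m * \<beta> m)"
    using hm m by simp
  also have "\<dots> = (1 - \<rho> * h m) * ?A" by (simp add: algebra_simps)
  also have "\<dots> \<le> exp (- \<rho> * h m) * ?A"
    using exp_ge_add_one_self[of "- \<rho> * h m"] A by (intro mult_right_mono) auto
  also have "\<dots> \<le> exp (- \<rho> * h m) * expectation (terminal_payment (h m))"
    using expectation_terminal_payment[OF c hm]
    by (intro mult_left_mono) (auto simp: \<beta>_def power2_eq_square algebra_simps)
  finally show ?thesis using hm by blast
qed

end

section \<open>The dividend problem\<close>

context dividend_model
begin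

section \<open>Transfer to the dividend model\<close>

lemma switching_diffusion: "i \<in> {1, 2} \<Longrightarrow> switching_diffusion (P i) W \<epsilon> q \<sigma> Z"
proof -
  assume i: "i \<in> {1, 2}"
  have "q k k < 0" if "k \<in> {1, 2}" for k
    using rate_pos[OF that] by (simp add: exit_rate_def)
  moreover have "q k 1 + q k 2 = 0" if "k \<in> {1, 2}" for k
    using rate_sum[OF that] by simp
  ultimately have "switching_law (P i) W \<epsilon> q"
    using prob[OF i] complete[OF i] brownian[OF i] chain[OF i] indep[OF i]
    by (intro switching_law.intro switching_law_axioms.intro)
  then show ?thesis
    using ito[OF i] by (intro switching_diffusion.intro switching_diffusion_axioms.intro)
qed

lemma surplus_eq:
  fixes i :: nat
  assumes "i \<in> {1, 2}"
  shows "surplus x D t \<omega> = switching_diffusion.free_surplus \<epsilon> Z \<mu> x t \<omega> - D t \<omega>"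
proof -
  interpret switching_diffusion "P i" W \<epsilon> q \<sigma> Z by (rule switching_diffusion[OF assms])
  show ?thesis by (simp add: surplus_def free_surplus_def drift_def)
qed

lemma dividend_strategy:
  assumes i: "i \<in> {1, 2}" and D: "D \<in> admissible x i"
  shows "dividend_strategy (P i) W \<epsilon> q \<sigma> Z \<mu> \<theta> x i D"
proof -
  interpret switching_diffusion "P i" W \<epsilon> q \<sigma> Z by (rule switching_diffusion[OF i])
  note s = surplus_eq[OF i]
  show ?thesis
  proof (intro dividend_strategy.intro dividend_strategy_axioms.intro switching_diffusion[OF i] start[OF i])
    show "D t \<in> borel_measurable (F t)" if "0 \<le> t" for t
      using D that by (simp add: admissible_def)
    fix \<omega> assume \<omega>: "\<omega> \<in> space (P i)"
    show "D 0 \<omega> = 0" using D \<omega> by (simp add: admissible_def)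
    show "0 \<le> D t \<omega>" if "0 \<le> t" for t using D \<omega> that by (simp add: admissible_def)
    show "increasing_path (\<lambda>t. D t \<omega>)"
      using D \<omega> by (intro increasing_path.intro) (auto simp: admissible_def)
    show "continuous (at_left t) (\<lambda>s. D s \<omega>)" if "0 < t" for t
      using D \<omega> that by (simp add: admissible_def)
  next
    have AE: "AE \<omega> in P i.
        (\<forall>t\<ge>0. right_limit (\<lambda>s. D s \<omega>) t - D t \<omega> \<le> max 0 (surplus x D t \<omega> - \<theta> (\<epsilon> t \<omega>))) \<and>
        emeasure (stieltjes (\<lambda>s. D s \<omega>)) {t. bankruptcy_time x D \<omega> < ereal t} = 0"
      using D by (simp add: admissible_def)
    show "AE \<omega> in P i. \<forall>t\<ge>0. right_limit (\<lambda>s. D s \<omega>) t - D t \<omega>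
        \<le> max 0 (free_surplus \<mu> x t \<omega> - D t \<omega> - \<theta> (\<epsilon> t \<omega>))"
      using AE by eventually_elim (simp add: s)
    show "AE \<omega> in P i. emeasure (stieltjes (\<lambda>s. D s \<omega>))
        {t. Inf (ereal ` {t. 0 \<le> t \<and> free_surplus \<mu> x t \<omega> - D t \<omega> \<le> \<theta> (\<epsilon> t \<omega>)}) < ereal t} = 0"
      using AE by eventually_elim (simp add: s bankruptcy_time_def)
  qed
qed

lemma bankruptcy_time_nonneg: "0 \<le> bankruptcy_time x D \<omega>"
  unfolding bankruptcy_time_def by (intro Inf_greatest) auto

lemma payoff_le:
  assumes theta: "\<theta> 1 \<le> \<theta> 2" and mu1: "\<mu> 1 \<le> 0" and mu2: "\<mu> 2 \<le> (\<theta> 1 - \<theta> 2) * exit_rate q 2"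
    and i: "i \<in> {1, 2}" and D: "D \<in> admissible x i"
  shows "payoff x i D \<le> ennreal (x - \<theta> i)"
proof -
  interpret dividend_strategy "P i" W \<epsilon> q \<sigma> Z \<mu> \<theta> x i D by (rule dividend_strategy[OF i D])
  have "payoff x i D \<le> (\<integral>\<^sup>+\<omega>. emeasure (stieltjes (\<lambda>s. D s \<omega>)) {0..} \<partial>P i)"
    unfolding payoff_def
  proof (rule nn_integral_mono)
    fix \<omega>
    have "(\<integral>\<^sup>+t\<in>{t. 0 \<le> t \<and> ereal t \<le> bankruptcy_time x D \<omega>}. ennreal (exp (- \<rho> * t)) \<partial>stieltjes (\<lambda>s. D s \<omega>))
      \<le> (\<integral>\<^sup>+t. indicator {0..} t \<partial>stieltjes (\<lambda>s. D s \<omega>))"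
      using rho_pos by (intro nn_integral_mono) (auto simp: indicator_def intro!: ennreal_le_1[THEN iffD2])
    also have "\<dots> = emeasure (stieltjes (\<lambda>s. D s \<omega>)) {0..}"
      by (rule nn_integral_indicator) (simp add: stieltjes_def)
    finally show "(\<integral>\<^sup>+t\<in>{t. 0 \<le> t \<and> ereal t \<le> bankruptcy_time x D \<omega>}. ennreal (exp (- \<rho> * t)) \<partial>stieltjes (\<lambda>s. D s \<omega>))
      \<le> emeasure (stieltjes (\<lambda>s. D s \<omega>)) {0..}" .
  qed
  also have "\<dots> \<le> ennreal (x - \<theta> i)"
    by (rule nn_integral_stieltjes_le) (use theta mu1 mu2 in \<open>simp_all add: exit_rate_def\<close>)
  finally show ?thesis .
qed

text \<open>Serves both the immediate payment, with \<open>h = 0\<close>, and the payment after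
  waiting. By left-continuity \<open>D\<close> is still 0 at \<open>h\<close>, so the payment is
  compared with the surplus without dividends; bankruptcy matters only on paths on which something
  is paid.\<close>

lemma single_payment_admissible:
  assumes i: "i \<in> {1, 2}" and h: "0 \<le> h"
    and c: "c \<in> borel_measurable (augmented_filtration (P i) W {1, 2} \<epsilon> h)" "\<And>\<omega>. 0 \<le> c \<omega>"
  defines "D \<equiv> \<lambda>t \<omega>. if t \<le> h then 0 else c \<omega>"
  assumes le: "AE \<omega> in P i. c \<omega> \<le> max 0 (surplus x (\<lambda>_ _. 0) h \<omega> - \<theta> (\<epsilon> h \<omega>))"
    and alive: "AE \<omega> in P i. 0 < c \<omega> \<longrightarrow> ereal h \<le> bankruptcy_time x D \<omega>"
  shows "D \<in> admissible x i"
    and "payoff x i D \<ge> (\<integral>\<^sup>+\<omega>. ennreal (exp (- \<rho> * h)) * ennreal (c \<omega>) \<partial>P i)"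
proof -
  interpret switching_diffusion "P i" W \<epsilon> q \<sigma> Z by (rule switching_diffusion[OF i])
  have path: "(\<lambda>t. D t \<omega>) = (\<lambda>t. if t \<le> h then 0 else c \<omega>)" for \<omega> by (simp add: D_def)
  have jump: "right_limit (\<lambda>s. D s \<omega>) t - D t \<omega> = (if t = h then c \<omega> else 0)" for t \<omega>
    unfolding path right_limit_step by (auto simp: D_def)
  have sets: "{t. bankruptcy_time x D \<omega> < ereal t} \<in> sets borel" for \<omega>
    by measurable
  have late: "emeasure (stieltjes (\<lambda>s. D s \<omega>)) {t. h < t} = 0" for \<omega>
    unfolding path by (rule emeasure_stieltjes_step(2)[OF c(2) h])
  show "D \<in> admissible x i"
    unfolding admissible_def
  proof (intro CollectI conjI ballI allI impI)
    show "D t \<in> borel_measurable (F t)" if "0 \<le> t" for t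
    proof (cases "t \<le> h")
      case False
      then have "c \<in> borel_measurable (F t)" using measurable_F_mono[OF c(1), of t] by simp
      then show ?thesis using False by (simp add: D_def)
    qed (simp add: D_def)
    fix \<omega>
    interpret path: increasing_path "\<lambda>t. D t \<omega>" unfolding path by (rule increasing_path_step[OF c(2)])
    show "D 0 \<omega> = 0" using h by (simp add: D_def)
    show "0 \<le> D t \<omega>" for t using c by (simp add: D_def)
    show "mono_on {0..} (\<lambda>t. D t \<omega>)" by (rule path.mono)
    show "\<exists>l. ((\<lambda>s. D s \<omega>) \<longlongrightarrow> l) (at_right t)" if "0 \<le> t" for t by (rule path.right_limits[OF that])
    show "continuous (at_left t) (\<lambda>s. D s \<omega>)" if "0 < t" for t
    proof (cases "t \<le> h")
      case True
      then have "\<forall>\<^sub>F s in at_left t. D s \<omega> = D t \<omega>"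
        by (auto simp: D_def eventually_at_filter intro!: always_eventually)
      then show ?thesis by (simp add: continuous_within tendsto_eventually)
    next
      case False
      then have ht: "h < t" by simp
      have "\<forall>\<^sub>F s in at_left t. D s \<omega> = D t \<omega>"
        unfolding eventually_at_left[OF ht] using ht by (auto simp: D_def intro!: exI[of _ h])
      then show ?thesis by (simp add: continuous_within tendsto_eventually)
    qed
  next
    show "AE \<omega> in P i.
        (\<forall>t\<ge>0. right_limit (\<lambda>s. D s \<omega>) t - D t \<omega> \<le> max 0 (surplus x D t \<omega> - \<theta> (\<epsilon> t \<omega>))) \<and>
        emeasure (stieltjes (\<lambda>s. D s \<omega>)) {t. bankruptcy_time x D \<omega> < ereal t} = 0"
      using le alive
    proof eventually_elim
      fix \<omega> assume le: "c \<omega> \<le> max 0 (surplus x (\<lambda>_ _. 0) h \<omega> - \<theta> (\<epsilon> h \<omega>))"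
        and alive: "0 < c \<omega> \<longrightarrow> ereal h \<le> bankruptcy_time x D \<omega>"
      have "surplus x D h \<omega> = surplus x (\<lambda>_ _. 0) h \<omega>" by (simp add: surplus_def D_def)
      then have 1: "\<forall>t\<ge>0. right_limit (\<lambda>s. D s \<omega>) t - D t \<omega> \<le> max 0 (surplus x D t \<omega> - \<theta> (\<epsilon> t \<omega>))"
        using le unfolding jump by auto
      have "emeasure (stieltjes (\<lambda>s. D s \<omega>)) {t. bankruptcy_time x D \<omega> < ereal t} \<le> 0"
      proof (cases "0 < c \<omega>")
        case True
        then have "{t. bankruptcy_time x D \<omega> < ereal t} \<subseteq> {t. h < t}"
          using alive by (auto dest: le_less_trans)
        then have "emeasure (stieltjes (\<lambda>s. D s \<omega>)) {t. bankruptcy_time x D \<omega> < ereal t}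
          \<le> emeasure (stieltjes (\<lambda>s. D s \<omega>)) {t. h < t}"
          by (intro emeasure_mono) (auto simp: stieltjes_def)
        then show ?thesis using late by simp
      next
        case False
        then have "c \<omega> = 0" using c(2)[of \<omega>] by simp
        \<comment> \<open>Without payment the bankruptcy time is arbitrary. The zero path is read as
          a step of size 0 at time 0, which leaves no mass at any positive time.\<close>
        then have D0: "(\<lambda>t. D t \<omega>) = (\<lambda>t. if t \<le> 0 then 0 else 0)" by (auto simp: D_def)
        have "{t. bankruptcy_time x D \<omega> < ereal t} \<subseteq> {t. 0 < t}"
          using bankruptcy_time_nonneg[of x D \<omega>] by (auto dest: le_less_trans)
        then have "emeasure (stieltjes (\<lambda>s. D s \<omega>)) {t. bankruptcy_time x D \<omega> < ereal t}
          \<le> emeasure (stieltjes (\<lambda>s. D s \<omega>)) {t. 0 < t}"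
          by (intro emeasure_mono) (auto simp: stieltjes_def)
        also have "\<dots> = 0" unfolding D0 by (rule emeasure_stieltjes_step(2)) auto
        finally show ?thesis .
      qed
      with 1 show "(\<forall>t\<ge>0. right_limit (\<lambda>s. D s \<omega>) t - D t \<omega> \<le> max 0 (surplus x D t \<omega> - \<theta> (\<epsilon> t \<omega>))) \<and>
        emeasure (stieltjes (\<lambda>s. D s \<omega>)) {t. bankruptcy_time x D \<omega> < ereal t} = 0" by simp
    qed
  qed
  show "payoff x i D \<ge> (\<integral>\<^sup>+\<omega>. ennreal (exp (- \<rho> * h)) * ennreal (c \<omega>) \<partial>P i)"
    unfolding payoff_def
  proof (rule nn_integral_mono_AE)
    show "AE \<omega> in P i. ennreal (exp (- \<rho> * h)) * ennreal (c \<omega>)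
      \<le> (\<integral>\<^sup>+t\<in>{t. 0 \<le> t \<and> ereal t \<le> bankruptcy_time x D \<omega>}. ennreal (exp (- \<rho> * t)) \<partial>stieltjes (\<lambda>s. D s \<omega>))"
      using alive
    proof eventually_elim
      fix \<omega> assume alive: "0 < c \<omega> \<longrightarrow> ereal h \<le> bankruptcy_time x D \<omega>"
      show "ennreal (exp (- \<rho> * h)) * ennreal (c \<omega>)
        \<le> (\<integral>\<^sup>+t\<in>{t. 0 \<le> t \<and> ereal t \<le> bankruptcy_time x D \<omega>}. ennreal (exp (- \<rho> * t)) \<partial>stieltjes (\<lambda>s. D s \<omega>))"
      proof (cases "0 < c \<omega>")
        case True
        have "ennreal (exp (- \<rho> * h)) * ennreal (c \<omega>)
            = (\<integral>\<^sup>+t. ennreal (exp (- \<rho> * h)) * indicator {h} t \<partial>stieltjes (\<lambda>s. D s \<omega>))"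
          using emeasure_stieltjes_step(1)[OF c(2)[of \<omega>] h] unfolding path
          by (subst nn_integral_cmult_indicator) (auto simp: stieltjes_def)
        also have "\<dots> \<le> (\<integral>\<^sup>+t\<in>{t. 0 \<le> t \<and> ereal t \<le> bankruptcy_time x D \<omega>}. ennreal (exp (- \<rho> * t))
            \<partial>stieltjes (\<lambda>s. D s \<omega>))"
          using h alive True by (intro nn_integral_mono) (auto simp: indicator_def)
        finally show ?thesis .
      qed (use c(2)[of \<omega>] in \<open>simp add: ennreal_neg\<close>)
    qed
  qed
qed

text \<open>Bankruptcy cannot precede a payment at time 0, so admissibility only requires the
  payment to be bounded by the initial excess.\<close>

lemma pay_all_immediately_admissible:
  assumes i: "i \<in> {1, 2}"
  shows "pay_all_immediately \<theta> x i \<in> admissible x i"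
    and "payoff x i (pay_all_immediately \<theta> x i) \<ge> ennreal (x - \<theta> i)"
proof -
  interpret switching_diffusion "P i" W \<epsilon> q \<sigma> Z by (rule switching_diffusion[OF i])
  have D: "pay_all_immediately \<theta> x i = (\<lambda>t \<omega>. if t \<le> 0 then 0 else max 0 (x - \<theta> i))"
    by (simp add: fun_eq_iff pay_all_immediately_def)
  have le: "AE \<omega> in P i. max 0 (x - \<theta> i) \<le> max 0 (surplus x (\<lambda>_ _. 0) 0 \<omega> - \<theta> (\<epsilon> 0 \<omega>))"
    using AE_free_surplus_0[of \<mu> x] start[OF i] by eventually_elim (simp add: surplus_eq[OF i])
  have alive: "AE \<omega> in P i. 0 < max 0 (x - \<theta> i) \<longrightarrow>
      ereal 0 \<le> bankruptcy_time x (\<lambda>t \<omega>. if t \<le> 0 then 0 else max 0 (x - \<theta> i)) \<omega>"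
    using bankruptcy_time_nonneg by (simp add: zero_ereal_def)
  note S = single_payment_admissible[OF i order_refl _ _ le alive]
  show "pay_all_immediately \<theta> x i \<in> admissible x i"
    unfolding D by (rule S(1)) simp_all
  have "ennreal (x - \<theta> i) = (\<integral>\<^sup>+\<omega>. ennreal (exp (- \<rho> * 0)) * ennreal (max 0 (x - \<theta> i)) \<partial>P i)"
    by (simp add: emeasure_space_1 ennreal_max_0)
  also have "\<dots> \<le> payoff x i (pay_all_immediately \<theta> x i)"
    unfolding D by (rule S(2)) simp_all
  finally show "payoff x i (pay_all_immediately \<theta> x i) \<ge> ennreal (x - \<theta> i)" .
qed

text \<open>\<open>ennreal\<close> sends negative numbers to 0, which is the case distinction of the
  candidate in regime 2.\<close>

lemma ennreal_candidate: "i \<in> {1, 2} \<Longrightarrow> ennreal (candidate \<theta> x i) = ennreal (x - \<theta> i)"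
  by (auto simp: candidate_def ennreal_neg)

lemma value_and_optimality:
  assumes theta: "\<theta> 1 \<le> \<theta> 2" and mu1: "\<mu> 1 \<le> 0" and mu2: "\<mu> 2 \<le> (\<theta> 1 - \<theta> 2) * exit_rate q 2"
    and i: "i \<in> {1, 2}"
  shows "value_function x i = ennreal (candidate \<theta> x i)"
    and "optimal x i (pay_all_immediately \<theta> x i)"
proof -
  note pay = pay_all_immediately_admissible[OF i, of x]
  have "payoff x i (pay_all_immediately \<theta> x i) \<le> value_function x i"
    unfolding value_function_def by (rule SUP_upper[OF pay(1)])
  moreover have "value_function x i \<le> ennreal (x - \<theta> i)"
    unfolding value_function_def by (intro SUP_least payoff_le assms)
  ultimately have "payoff x i (pay_all_immediately \<theta> x i) = value_function x i"
    "value_function x i = ennreal (x - \<theta> i)"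
    using pay(2) by (auto intro: antisym order_trans)
  then show "value_function x i = ennreal (candidate \<theta> x i)" "optimal x i (pay_all_immediately \<theta> x i)"
    using pay(1) ennreal_candidate[OF i] by (auto simp: optimal_def)
qed

lemma waiting_is_better:
  assumes theta: "\<theta> 1 < \<theta> 2" and mu2: "(\<theta> 1 - \<theta> 2) * exit_rate q 2 < \<mu> 2"
  shows "\<exists>x>\<theta> 2. ennreal (x - \<theta> 2) < value_function x 2"
proof -
  define c where "c = \<mu> 2 - (\<theta> 1 - \<theta> 2) * exit_rate q 2"
  \<comment> \<open>At this height discounting costs
    \<open>\<rho> * (x - \<theta> 2) = c / 2\<close> per unit of time, against a gain of
    \<open>c\<close>.\<close>
  define x where "x = \<theta> 2 + c / (2 * \<rho>)"
  have c: "0 < c" using mu2 by (simp add: c_def)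
  then have x: "\<theta> 2 < x" using rho_pos by (simp add: x_def)
  have two: "2 \<in> {1, 2::nat}" by simp
  interpret waiting_strategy "P 2" W \<epsilon> q \<sigma> Z \<mu> \<theta> x
    by (intro waiting_strategy.intro waiting_strategy_axioms.intro switching_diffusion start theta x) simp_all
  have g: "gain_rate = c" by (simp add: gain_rate_def c_def exit_rate_def)
  obtain h where h: "0 < h" and gain: "x - \<theta> 2 < exp (- \<rho> * h) * expectation (terminal_payment h)"
    using discounted_payment_exceeds[of \<rho>] c rho_pos unfolding g by (auto simp: x_def)
  have h0: "0 \<le> h" using h by simp
  let ?D = "\<lambda>t \<omega>. if t \<le> h then 0 else terminal_payment h \<omega>"
  have le: "AE \<omega> in P 2. terminal_payment h \<omega> \<le> max 0 (surplus x (\<lambda>_ _. 0) h \<omega> - \<theta> (\<epsilon> h \<omega>))"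
    by (intro always_eventually) (auto simp: terminal_payment_def surplus_eq[OF two] excess_def indicator_def)
  have alive: "AE \<omega> in P 2. 0 < terminal_payment h \<omega> \<longrightarrow> ereal h \<le> bankruptcy_time x ?D \<omega>"
    using AE_survival_excess_pos[OF h]
  proof eventually_elim
    fix \<omega> assume pos: "\<omega> \<in> survival h \<longrightarrow> (\<forall>t. 0 \<le> t \<and> t < h \<longrightarrow> 0 < excess t \<omega>)"
    show "0 < terminal_payment h \<omega> \<longrightarrow> ereal h \<le> bankruptcy_time x ?D \<omega>"
    proof
      assume "0 < terminal_payment h \<omega>"
      then have "\<omega> \<in> survival h" by (cases "\<omega> \<in> survival h") (auto simp: terminal_payment_def)
      then have pos: "0 < excess t \<omega>" if "0 \<le> t" "t < h" for t using pos that by blast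
      \<comment> \<open>Before \<open>h\<close> nothing has been paid, so the surplus minus the
        threshold is the excess, which is positive on \<open>survival h\<close>.\<close>
      have "h \<le> t" if "0 \<le> t" "surplus x ?D t \<omega> \<le> \<theta> (\<epsilon> t \<omega>)" for t
      proof (rule ccontr)
        assume "\<not> h \<le> t"
        then show False using pos[of t] that by (simp add: surplus_eq[OF two] excess_def)
      qed
      then show "ereal h \<le> bankruptcy_time x ?D \<omega>"
        unfolding bankruptcy_time_def by (intro Inf_greatest) auto
    qed
  qed
  note S = single_payment_admissible[OF two h0 terminal_payment_measurable_F[OF h0] terminal_payment_nonneg le alive]
  have "ennreal (x - \<theta> 2) < ennreal (exp (- \<rho> * h) * expectation (terminal_payment h))"
    using gain x by (intro ennreal_lessI) auto
  also have "\<dots> = ennreal (exp (- \<rho> * h)) * ennreal (expectation (terminal_payment h))"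
    by (rule ennreal_mult') simp
  also have "ennreal (expectation (terminal_payment h)) = (\<integral>\<^sup>+\<omega>. ennreal (terminal_payment h \<omega>) \<partial>P 2)"
    by (intro nn_integral_eq_integral[symmetric] integrable_terminal_payment h0) (simp add: terminal_payment_nonneg)
  also have "ennreal (exp (- \<rho> * h)) * \<dots> = (\<integral>\<^sup>+\<omega>. ennreal (exp (- \<rho> * h)) * ennreal (terminal_payment h \<omega>) \<partial>P 2)"
    using borel_measurable_integrable[OF integrable_terminal_payment[OF h0]]
    by (intro nn_integral_cmult[symmetric]) simp
  also have "\<dots> \<le> payoff x 2 ?D" by (rule S(2))
  also have "\<dots> \<le> value_function x 2"
    unfolding value_function_def by (rule SUP_upper[OF S(1)])
  finally show ?thesis using x by blast
qed

end

theorem theorem4p1: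
  fixes P :: "nat \<Rightarrow> 'a measure"
    and W :: "real \<Rightarrow> 'a \<Rightarrow> real"
    and \<epsilon> :: "real \<Rightarrow> 'a \<Rightarrow> nat"
    and Z :: "real \<Rightarrow> 'a \<Rightarrow> real"
    and q :: "nat \<Rightarrow> nat \<Rightarrow> real"
    and \<mu> \<sigma> \<theta> :: "nat \<Rightarrow> real"
    and \<rho> :: real
  assumes model: "dividend_model P W \<epsilon> Z q \<sigma> \<rho>"
    and theta: "\<theta> 1 < \<theta> 2"
    and mu1: "\<mu> 1 \<le> 0"
  shows "((\<forall>x \<ge> \<theta> 1. \<forall>i \<in> {1, 2}.
             dividend_model.value_function P W \<epsilon> Z \<mu> \<theta> \<rho> x i = ennreal (candidate \<theta> x i))
           \<longleftrightarrow> \<mu> 2 \<le> (\<theta> 1 - \<theta> 2) * exit_rate q 2) \<and>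
         (\<mu> 2 \<le> (\<theta> 1 - \<theta> 2) * exit_rate q 2 \<longrightarrow>
           (\<forall>x \<ge> \<theta> 1. \<forall>i \<in> {1, 2}.
             dividend_model.optimal P W \<epsilon> Z \<mu> \<theta> \<rho> x i (pay_all_immediately \<theta> x i)))"
proof -
  interpret dividend_model P W \<epsilon> Z q \<mu> \<sigma> \<theta> \<rho> by (rule model)
  have "\<mu> 2 \<le> (\<theta> 1 - \<theta> 2) * exit_rate q 2"
    if V: "\<forall>x \<ge> \<theta> 1. \<forall>i \<in> {1, 2}. value_function x i = ennreal (candidate \<theta> x i)"
  proof (rule ccontr)
    assume "\<not> \<mu> 2 \<le> (\<theta> 1 - \<theta> 2) * exit_rate q 2"
    then obtain x where x: "\<theta> 2 < x" "ennreal (x - \<theta> 2) < value_function x 2"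
      using waiting_is_better[OF theta] by auto
    have "value_function x 2 = ennreal (x - \<theta> 2)"
      using V[rule_format, of x 2] ennreal_candidate[of 2 x] x(1) theta by simp
    then show False using x(2) by simp
  qed
  then show ?thesis
    using value_and_optimality[OF less_imp_le[OF theta] mu1] by blast
qed

end
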